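(* Let $|q|<1$. Then \begin{align*} \sum_{i,j\geq 0} \frac{q^{i^2+ij+\frac{1}{2}j^2-i+\frac{1}{2}j}}{(q;q)_i(q;q)_j}&=2\frac{(q^4;q^4)_\infty}{(q;q)_\infty},\\ \sum_{i,j\geq 0} \frac{q^{2i^2+2ij+j^2}}{(q^2;q^2)_i(q^2;q^2)_j}&=\frac{1}{(q,q^4,q^7;q^8)_\infty},\\ \sum_{i,j\geq 0}\frac{q^{i^2+ij+\frac{1}{2}j^2+\frac{1}{2}j}}{(q;q)_i(q;q)_j}&=\frac{(q^2;q^2)_\infty^3}{(q;q)_\infty^2 (q^4;q^4)_\infty},\\ \sum_{i,j\geq 0}\frac{q^{i^2+ij+\frac{1}{2}j^2+i+\frac{1}{2}j}}{(q;q)_i(q;q)_j}&=\frac{(q^4;q^4)_\infty}{(q;q)_\infty},\\ \sum_{i,j\geq 0}\frac{q^{2i^2+2ij+j^2+2i+2j}}{(q^2;q^2)_i(q^2;q^2)_j}&=\frac{1}{(q^3,q^4,q^5;q^8)_\infty}. \end{align*} As a consequence, with $A=\begin{pmatrix} 2&1\\1&1\end{pmatrix}$, for each of the five triples $(B,C,N)$ given by $B=(-1,1/2)^{\mathrm T}, C=1/8, N=256$; $B=(0,0)^{\mathrm T}, C=-1/32, N=1024$; $B=(0,1/2)^{\mathrm T}, C=0, N=32$; $B=(1,1/2)^{\mathrm T}, C=1/8, N=256$; $B=(1,1)^{\mathrm T}, C=7/32, N=1024$, the function $\tau\mapsto f_{A,B,C}(q^{\mathrm{denom}(C)})$ (with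 $q=e^{2\pi i\tau}$) is a modular function on $\Gamma_1(N)$.
   Context: Notation: $(a;q)_n=\prod_{k=0}^{n-1}(1-aq^k)$, $(a;q)_\infty=\prod_{k\ge0}(1-aq^k)$, $(a_1,\dots,a_m;q)_n=(a_1;q)_n\cdots(a_m;q)_n$. Half-integer powers $q^{x}$ mean $e^{2\pi i x\tau}$ where $q=e^{2\pi i\tau}$, $\tau$ in the upper half-plane. For a positive definite symmetric rational $2\times2$ matrix $A$, a rational vector $B$ and rational scalar $C$, the Nahm sum is $f_{A,B,C}(q)=\sum_{n=(n_1,n_2)^{\mathrm T}\in\mathbb{Z}_{\ge0}^2}\frac{q^{\frac12 n^{\mathrm T}An+n^{\mathrm T}B+C}}{(q;q)_{n_1}(q;q)_{n_2}}$. $\mathrm{denom}(C)$ is the denominator of $C$ in lowest terms (so $\mathrm{denom}(0)=1$). $\Gamma_1(N)=\{\gamma\in\mathrm{SL}_2(\mathbb Z):\gamma\equiv\begin{pmatrix}1&*\\0&1\end{pmatrix}\pmod N\}$. *)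

theory Defs
  imports "HOL-Complex_Analysis.Complex_Analysis" "HOL-Number_Theory.Cong"
begin

definition qpoch :: "complex \<Rightarrow> complex \<Rightarrow> nat \<Rightarrow> complex" where
  "qpoch a q n = (\<Prod>k<n. 1 - a * q ^ k)"

definition qpoch_inf :: "complex \<Rightarrow> complex \<Rightarrow> complex" where
  "qpoch_inf a q = (\<Prod>k. 1 - a * q ^ k)"

definition nahm_exponent :: "rat^2^2 \<Rightarrow> rat^2 \<Rightarrow> rat \<Rightarrow> nat^2 \<Rightarrow> rat" where
  "nahm_exponent A B C n =
     (let v = (\<chi> k. of_nat (n $ k))
      in (\<Sum>k\<in>UNIV. v $ k * (A *v v) $ k) / 2 + (\<Sum>k\<in>UNIV. v $ k * B $ k) + C)"

(* The Nahm sum as a function of tau, where q = exp (2 pi i tau) and a rational power q^x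
   means exp (2 pi i x tau).  Hence f(q^d) corresponds to replacing tau by d * tau. *)
definition nahm_sum :: "rat^2^2 \<Rightarrow> rat^2 \<Rightarrow> rat \<Rightarrow> complex \<Rightarrow> complex" where
  "nahm_sum A B C \<tau> =
     (let q = exp (2 * of_real pi * \<i> * \<tau>)
      in \<Sum>\<^sub>\<infinity>n\<in>UNIV. exp (2 * of_real pi * \<i> * of_rat (nahm_exponent A B C n) * \<tau>)
           / (qpoch q q (n $ 1) * qpoch q q (n $ 2)))"

definition denom :: "rat \<Rightarrow> int" where
  "denom x = snd (quotient_of x)"

definition upper_half_plane :: "complex set" where
  "upper_half_plane = {\<tau>. Im \<tau> > 0}"

definition SL2Z :: "(int^2^2) set" where
  "SL2Z = {\<gamma>. det \<gamma> = 1}"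

definition Gamma1 :: "nat \<Rightarrow> (int^2^2) set" where
  "Gamma1 N = {\<gamma> \<in> SL2Z. [\<gamma> $ 1 $ 1 = 1] (mod int N) \<and> [\<gamma> $ 2 $ 1 = 0] (mod int N) \<and>
                           [\<gamma> $ 2 $ 2 = 1] (mod int N)}"

definition moebius_action :: "int^2^2 \<Rightarrow> complex \<Rightarrow> complex" where
  "moebius_action \<gamma> \<tau> =
     (of_int (\<gamma> $ 1 $ 1) * \<tau> + of_int (\<gamma> $ 1 $ 2)) / (of_int (\<gamma> $ 2 $ 1) * \<tau> + of_int (\<gamma> $ 2 $ 2))"

(* f has a Laurent expansion with finite principal part in exp (2 pi i tau / h) near i*infinity,
   for some positive integer h. *)
definition meromorphic_at_ioo :: "(complex \<Rightarrow> complex) \<Rightarrow> bool" where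
  "meromorphic_at_ioo f \<longleftrightarrow>
     (\<exists>h>0::nat. \<exists>g. g meromorphic_on {0} \<and>
        (\<exists>Y>0. \<forall>\<tau>. Im \<tau> > Y \<longrightarrow> f \<tau> = g (exp (2 * of_real pi * \<i> * \<tau> / of_nat h))))"

(* Weight 0: meromorphic on the upper half-plane, invariant under \<Gamma>, and meromorphic at every cusp
   (the cusps being the images of i*infinity under SL2(Z)).  "Nicely" meromorphic functions have
   removable singularities removed and take the value 0 at poles, so that pointwise invariance
   is invariance as a map to the Riemann sphere. *)
definition modular_function_on :: "(int^2^2) set \<Rightarrow> (complex \<Rightarrow> complex) \<Rightarrow> bool" where
  "modular_function_on \<Gamma> f \<longleftrightarrow>
     f nicely_meromorphic_on upper_half_plane \<and>
     (\<forall>\<gamma>\<in>\<Gamma>. \<forall>\<tau>\<in>upper_half_plane. f (moebius_action \<gamma> \<tau>) = f \<tau>) \<and>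
     (\<forall>\<gamma>\<in>SL2Z. meromorphic_at_ioo (\<lambda>\<tau>. f (moebius_action \<gamma> \<tau>)))"

end

theory Submission
  imports Defs
begin

text \<open>
  Summing over \<open>j\<close> with Euler's formula for \<open>(-z;q)\<^sub>\<infinity>\<close> makes the first, third and fourth double
  sums instances of the same formula in the variable \<open>i\<close>.  In the second and fifth it leaves
  \<open>\<Sum> q^(2i^2+2ei)/((q^2;q^2)\<^sub>i (-q;q^2)\<^sub>i\<^sub>+\<^sub>e)\<close> with \<open>e \<in> {0, 1}\<close>.  With \<open>p = -q\<close> and \<open>P = p^2\<close> the
  summand \<open>1/((P;P)\<^sub>n (p;P)\<^sub>n\<^sub>+\<^sub>e)\<close> is a finite sum of terms \<open>p^(2r^2\<mp>r)/((P;P)\<^sub>n\<^sub>-\<^sub>r (P;P)\<^sub>n\<^sub>+\<^sub>r\<^sub>+\<^sub>e)\<close>,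
  and summing over \<open>n\<close> first turns the double sum into a theta series, which the triple product
  evaluates.

  For modularity, \<open>\<kappa>(x, y; \<tau>) = e(x(x\<tau> + y)/2) \<theta>(x\<tau> + y; \<tau>)\<close> satisfies
  \<open>\<kappa>(v; \<gamma>\<tau>) = C(\<gamma>, \<tau>) \<kappa>(v\<gamma>; \<tau>)\<close> with \<open>C\<close> independent of \<open>v\<close>: the quotient of the two sides, as a
  function of \<open>z = x\<tau> + y\<close>, is entire and elliptic.  Hence quotients of equally many \<open>\<kappa>\<close> are
  permuted up to roots of unity.  All five sums are, up to a constant, such quotients at \<open>8\<tau>\<close>; the
  multiplier of \<open>\<eta>\<close> never enters, because the product of \<open>\<kappa>\<close> over the 2-torsion points stands in for
  the power of \<open>\<eta>\<close> that would balance the weight.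
\<close>

section \<open>Pochhammer symbols and basic hypergeometric series\<close>

text \<open>The constants of the modular part are forced by the product sides. Let s = e(\<tau>/2).
  A Klein form with characteristic (x, 0) yields two complementary progressions at once. At 4\<tau>
  the factor (s^4; s^8)_inf would be its own partner and could occur only squared; at 8\<tau> it
  becomes (s^4, s^12; s^16)_inf, a single Klein form. This explains the argument 8\<tau> and the
  denominator 16. The Klein forms needed for each product then have total exponent -3, and the three
  nonzero 2-torsion points restore the balance, because there the theta products collapse to a
  monomial in q. Balance is essential, since the constant C(\<gamma>, \<tau>) is only shown to
  exist.

  The levels have the same origin. With M = 8 denom(C) each function is a quotient at M\<tau>, and
  conjugation by diag(M, 1) turns \<open>Gamma1 (4 * M)\<close> into matrices with M dividing b and
  4 dividing c. The condition on b removes the roots of unity produced by the points (x, 0), the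
  condition on c those of the 2-torsion points.\<close>

lemma qpoch_0 [simp]: "qpoch a q 0 = 1"
  by (simp add: qpoch_def)

lemma qpoch_Suc: "qpoch a q (Suc n) = qpoch a q n * (1 - a * q ^ n)"
  by (simp add: qpoch_def)

lemma qpoch_add: "qpoch a q (m + n) = qpoch a q m * qpoch (a * q ^ m) q n"
  by (induction n) (simp_all add: qpoch_Suc power_add mult_ac)

lemma convergent_qpoch:
  fixes a q :: complex
  assumes "norm q < 1"
  shows "convergent_prod (\<lambda>k. 1 - a * q ^ k)"
proof -
  have "summable (\<lambda>k. norm a * norm q ^ k)"
    using assms by (intro summable_mult summable_geometric) auto
  moreover have "norm (1 - a * q ^ k - 1) = norm a * norm q ^ k" for k
    by (simp add: norm_mult norm_power)
  ultimately have "summable (\<lambda>k. norm (1 - a * q ^ k - 1))"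
    by presburger
  thus ?thesis
    by (intro abs_convergent_prod_imp_convergent_prod)
       (simp add: abs_convergent_prod_conv_summable)
qed

lemma qpoch_tendsto:
  assumes "norm q < 1"
  shows "qpoch a q \<longlonglongrightarrow> qpoch_inf a q"
proof -
  have "(\<lambda>n. \<Prod>k\<le>n. 1 - a * q ^ k) \<longlonglongrightarrow> qpoch_inf a q"
    unfolding qpoch_inf_def by (intro convergent_prod_LIMSEQ convergent_qpoch assms)
  hence "(\<lambda>n. qpoch a q (Suc n)) \<longlonglongrightarrow> qpoch_inf a q"
    by (simp add: qpoch_def lessThan_Suc_atMost)
  thus ?thesis
    by (rule LIMSEQ_imp_Suc)
qed

lemma qpoch_inf_eqI:
  assumes "norm q < 1" "qpoch a q \<longlonglongrightarrow> L"
  shows "qpoch_inf a q = L"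
  using LIMSEQ_unique[OF qpoch_tendsto[OF assms(1)] assms(2)] .

lemma qpoch_inf_0 [simp]: "qpoch_inf 0 q = 1"
  by (simp add: qpoch_inf_def)

lemma qpoch_inf_eq_0_iff:
  assumes "norm q < 1"
  shows "qpoch_inf a q = 0 \<longleftrightarrow> (\<exists>k. a * q ^ k = 1)"
proof -
  have "(\<lambda>k. 1 - a * q ^ k) has_prod qpoch_inf a q"
    unfolding qpoch_inf_def by (intro convergent_prod_has_prod convergent_qpoch assms)
  from has_prod_eq_0_iff[OF this] show ?thesis
    by (auto simp: image_iff eq_commute[of 1])
qed

lemma qpoch_eq_0_iff: "qpoch a q n = 0 \<longleftrightarrow> (\<exists>k<n. a * q ^ k = 1)"
  by (auto simp: qpoch_def)

lemma power_neq_1_norm_less_1: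
  fixes q :: complex
  assumes "norm q < 1" "n > 0"
  shows "q ^ n \<noteq> 1"
proof
  assume "q ^ n = 1"
  hence "norm q ^ n = 1"
    by (metis norm_one norm_power)
  moreover have "norm q ^ n < 1"
    using assms by (simp add: power_less_one_iff)
  ultimately show False by simp
qed

lemma qpoch_inf_neq_0_norm_less_1:
  assumes "norm q < 1" "norm a < 1"
  shows "qpoch_inf a q \<noteq> 0"
proof
  assume "qpoch_inf a q = 0"
  then obtain k where k: "a * q ^ k = 1"
    using qpoch_inf_eq_0_iff[OF assms(1)] by auto
  have "norm (a * q ^ k) \<le> norm a * 1"
    unfolding norm_mult norm_power using assms
    by (intro mult_left_mono power_le_one) auto
  thus False using k assms by simp
qed

lemma qpoch_neq_0_norm_less_1:
  assumes "norm q < 1" "norm a < 1"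
  shows "qpoch a q n \<noteq> 0"
  using qpoch_inf_neq_0_norm_less_1[OF assms] qpoch_inf_eq_0_iff[OF assms(1)] qpoch_eq_0_iff
  by blast

lemma qpoch_q_neq_0 [simp]: "norm q < 1 \<Longrightarrow> qpoch q q n \<noteq> 0"
  by (rule qpoch_neq_0_norm_less_1)

lemma qpoch_inf_q_neq_0 [simp]: "norm q < 1 \<Longrightarrow> qpoch_inf q q \<noteq> 0"
  by (rule qpoch_inf_neq_0_norm_less_1)

lemma qpoch_inf_split:
  assumes "norm q < 1"
  shows "qpoch_inf a q = qpoch a q n * qpoch_inf (a * q ^ n) q"
proof (rule qpoch_inf_eqI[OF assms])
  have "(\<lambda>m. qpoch a q n * qpoch (a * q ^ n) q m) \<longlonglongrightarrow> qpoch a q n * qpoch_inf (a * q ^ n) q"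
    by (intro tendsto_intros qpoch_tendsto assms)
  hence "(\<lambda>m. qpoch a q (m + n)) \<longlonglongrightarrow> qpoch a q n * qpoch_inf (a * q ^ n) q"
    by (subst add.commute) (simp add: qpoch_add)
  thus "qpoch a q \<longlonglongrightarrow> qpoch a q n * qpoch_inf (a * q ^ n) q"
    by (rule LIMSEQ_offset)
qed

lemma qpoch_inf_rec:
  assumes "norm q < 1"
  shows "qpoch_inf a q = (1 - a) * qpoch_inf (a * q) q"
  using qpoch_inf_split[OF assms, of a 1] by (simp add: qpoch_def)

lemma norm_power_less_1:
  fixes q :: complex
  assumes "norm q < 1" "n > 0"
  shows "norm (q ^ n) < 1"
  using assms by (simp add: norm_power power_less_one_iff)

lemma qpoch_inf_mult_minus:
  assumes "norm q < 1"
  shows "qpoch_inf a q * qpoch_inf (-a) q = qpoch_inf (a ^ 2) (q ^ 2)"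
proof (rule qpoch_inf_eqI[symmetric])
  have "qpoch (a ^ 2) (q ^ 2) n = qpoch a q n * qpoch (-a) q n" for n
    unfolding qpoch_def prod.distrib[symmetric]
    by (rule prod.cong) (simp_all add: algebra_simps power2_eq_square flip: power_mult_distrib)
  moreover have "(\<lambda>n. qpoch a q n * qpoch (-a) q n) \<longlonglongrightarrow> qpoch_inf a q * qpoch_inf (-a) q"
    by (intro tendsto_intros qpoch_tendsto assms)
  ultimately show "qpoch (a ^ 2) (q ^ 2) \<longlonglongrightarrow> qpoch_inf a q * qpoch_inf (-a) q"
    by presburger
qed (use assms in \<open>simp add: norm_power_less_1\<close>)

lemma qpoch_inf_dissect:
  assumes "norm q < 1"
  shows "qpoch_inf a q = qpoch_inf a (q ^ 2) * qpoch_inf (a * q) (q ^ 2)"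
proof -
  have q2: "norm (q ^ 2) < 1"
    using assms by (simp add: norm_power_less_1)
  have "qpoch a q (2 * n) = qpoch a (q ^ 2) n * qpoch (a * q) (q ^ 2) n" for n
    by (induction n) (simp_all add: qpoch_Suc mult_ac flip: power_mult)
  moreover have "(\<lambda>n. qpoch a (q ^ 2) n * qpoch (a * q) (q ^ 2) n)
      \<longlonglongrightarrow> qpoch_inf a (q ^ 2) * qpoch_inf (a * q) (q ^ 2)"
    by (intro tendsto_intros qpoch_tendsto q2)
  moreover have "(\<lambda>n. qpoch a q (2 * n)) \<longlonglongrightarrow> qpoch_inf a q"
    using LIMSEQ_subseq_LIMSEQ[OF qpoch_tendsto[OF assms], of "\<lambda>n. 2 * n"]
    by (simp add: strict_mono_def o_def)
  ultimately show ?thesis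
    using LIMSEQ_unique by auto
qed

text \<open>Convergence to a nonzero limit bounds the reciprocals. This bound dominates the
  denominators of the double families whose summation order is exchanged.\<close>

lemma qpoch_q_inverse_bounded:
  assumes "norm q < 1"
  obtains C where "C > 0" "\<And>n. norm (inverse (qpoch q q n)) \<le> C"
proof -
  have "(\<lambda>n. inverse (qpoch q q n)) \<longlonglongrightarrow> inverse (qpoch_inf q q)"
    by (intro tendsto_inverse qpoch_tendsto assms) (use assms in auto)
  hence "Bseq (\<lambda>n. inverse (qpoch q q n))"
    using convergentI convergent_imp_Bseq by blast
  thus ?thesis
    using that unfolding Bseq_def by blast
qed

section \<open>Euler's expansion of (-z;q)_inf\<close>

lemma Suc_choose_2: "Suc k choose 2 = (k choose 2) + k"
  by (simp add: numeral_2_eq_2)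

lemma choose_2_add: "(m + n) choose 2 = (m choose 2) + (n choose 2) + m * n"
  by (induction n) (simp_all add: Suc_choose_2)

lemma two_choose_2: "2 * (n choose 2) + n = n ^ 2"
  by (induction n) (simp_all add: Suc_choose_2 power2_eq_square)

lemma euler_summable:
  assumes "norm q < 1"
  shows "summable (\<lambda>k. norm (q ^ (k choose 2) * z ^ k / qpoch q q k))"
proof -
  have lim: "(\<lambda>k. norm (q ^ k * z / (1 - q * q ^ k))) \<longlonglongrightarrow> norm (0 * z / (1 - q * 0))"
    by (intro tendsto_intros LIMSEQ_power_zero assms) auto
  have "eventually (\<lambda>k. norm (q ^ k * z / (1 - q * q ^ k)) < 1/2) sequentially"
    by (rule order_tendstoD(2)[OF lim]) auto
  then obtain N where N: "\<And>k. k \<ge> N \<Longrightarrow> norm (q ^ k * z / (1 - q * q ^ k)) < 1/2"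
    by (auto simp: eventually_sequentially)
  show ?thesis
  proof (rule summable_ratio_test[of "1/2" N])
    fix k assume "k \<ge> N"
    have "q ^ (Suc k choose 2) * z ^ Suc k / qpoch q q (Suc k) =
          (q ^ k * z / (1 - q * q ^ k)) * (q ^ (k choose 2) * z ^ k / qpoch q q k)"
      by (simp add: Suc_choose_2 power_add qpoch_Suc mult_ac)
    hence "norm (q ^ (Suc k choose 2) * z ^ Suc k / qpoch q q (Suc k)) =
          norm (q ^ k * z / (1 - q * q ^ k)) * norm (q ^ (k choose 2) * z ^ k / qpoch q q k)"
      by (simp only: norm_mult)
    also have "\<dots> \<le> 1/2 * norm (q ^ (k choose 2) * z ^ k / qpoch q q k)"
      by (rule mult_right_mono[OF less_imp_le[OF N[OF \<open>k \<ge> N\<close>]]]) simp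
    finally show "norm (norm (q ^ (Suc k choose 2) * z ^ Suc k / qpoch q q (Suc k)))
       \<le> 1/2 * norm (norm (q ^ (k choose 2) * z ^ k / qpoch q q k))"
      by simp
  qed auto
qed

text \<open>The coefficient recursion \<open>c_Suc\<close> amounts to the functional equation E(z) =
  (1 + z) E(q z). Iterating it moves the argument to z q^n, and continuity at 0 leaves only the
  infinite product.\<close>

lemma euler_has_sum:
  assumes q: "norm q < 1"
  shows "((\<lambda>k. q ^ (k choose 2) * z ^ k / qpoch q q k) has_sum qpoch_inf (-z) q) UNIV"
proof -
  define c where "c k = q ^ (k choose 2) / qpoch q q k" for k
  define E where "E z = (\<Sum>k. c k * z ^ k)" for z
  have summ: "summable (\<lambda>k. c k * z ^ k)" for z
    using summable_norm_cancel[OF euler_summable[OF q, of z]] by (simp add: c_def)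
  have c_Suc: "c (Suc k) * (1 - q ^ Suc k) = q ^ k * c k" for k
    using power_neq_1_norm_less_1[OF q, of "Suc k"]
    by (simp add: c_def Suc_choose_2 power_add qpoch_Suc)
  have func: "E z = (1 + z) * E (q * z)" for z
  proof -
    have "E z - E (q * z) = (\<Sum>k. c k * z ^ k - c k * (q * z) ^ k)"
      unfolding E_def by (rule suminf_diff) (rule summ)+
    also have "\<dots> = (\<Sum>k. c (Suc k) * z ^ Suc k - c (Suc k) * (q * z) ^ Suc k)"
      by (subst suminf_split_head) (auto intro!: summable_diff summ)
    also have "\<dots> = (\<Sum>k. z * (c k * (q * z) ^ k))"
    proof (rule suminf_cong)
      fix k
      have "c (Suc k) * z ^ Suc k - c (Suc k) * (q * z) ^ Suc k =
            (c (Suc k) * (1 - q ^ Suc k)) * z ^ Suc k"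
        by (simp add: algebra_simps power_mult_distrib)
      also have "\<dots> = z * (c k * (q * z) ^ k)"
        unfolding c_Suc by (simp add: power_mult_distrib)
      finally show "c (Suc k) * z ^ Suc k - c (Suc k) * (q * z) ^ Suc k = z * (c k * (q * z) ^ k)" .
    qed
    also have "\<dots> = z * E (q * z)"
      unfolding E_def by (rule suminf_mult) (rule summ)
    finally show ?thesis by (simp add: algebra_simps)
  qed
  have iter: "E z = qpoch (-z) q n * E (z * q ^ n)" for n
  proof (induction n)
    case (Suc n)
    show ?case
      by (subst Suc, subst func) (simp add: qpoch_Suc mult_ac)
  qed simp
  have "isCont E 0"
    unfolding E_def by (rule isCont_powser_converges_everywhere) (rule summ)
  moreover have "(\<lambda>n. z * q ^ n) \<longlonglongrightarrow> z * 0"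
    by (intro tendsto_intros LIMSEQ_power_zero q)
  ultimately have "(\<lambda>n. E (z * q ^ n)) \<longlonglongrightarrow> E 0"
    using isCont_tendsto_compose by fastforce
  moreover have "E 0 = 1"
    using powser_zero[of c] by (simp add: E_def c_def numeral_2_eq_2)
  ultimately have "(\<lambda>n. qpoch (-z) q n * E (z * q ^ n)) \<longlonglongrightarrow> qpoch_inf (-z) q * 1"
    by (intro tendsto_mult qpoch_tendsto q) auto
  hence "(\<lambda>_. E z) \<longlonglongrightarrow> qpoch_inf (-z) q"
    using iter by simp
  hence "E z = qpoch_inf (-z) q"
    by (simp add: LIMSEQ_const_iff)
  moreover have "(\<lambda>k. q ^ (k choose 2) * z ^ k / qpoch q q k) sums E z"
    using summable_sums[OF summ[of z]] by (simp add: E_def c_def)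
  ultimately show ?thesis
    using norm_summable_imp_has_sum[OF euler_summable[OF q, of z]] by simp
qed


section \<open>Products of sums, Durfee rectangles and the Jacobi triple product\<close>

lemma summable_on_power_int_abs:
  fixes x :: real
  assumes "0 \<le> x" "x < 1"
  shows "(\<lambda>r::int. x ^ nat \<bar>r\<bar>) summable_on UNIV"
proof -
  have nat: "(\<lambda>n. x ^ n) summable_on (UNIV :: nat set)"
    by (rule norm_summable_imp_summable_on) (use assms in \<open>auto intro: summable_geometric\<close>)
  have "(\<lambda>r::int. x ^ nat \<bar>r\<bar>) summable_on {0..}"
    by (subst summable_on_reindex_bij_witness[of _ int nat UNIV "\<lambda>n. x ^ n"]) (use nat in auto)
  moreover have "(\<lambda>r::int. x ^ nat \<bar>r\<bar>) summable_on {..0}"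
    by (subst summable_on_reindex_bij_witness[of _ "\<lambda>n. - int n" "\<lambda>r. nat (-r)" UNIV "\<lambda>n. x ^ n"])
       (use nat in auto)
  ultimately have "(\<lambda>r::int. x ^ nat \<bar>r\<bar>) summable_on ({0..} \<union> {..0})"
    by (rule summable_on_union)
  moreover have "{0..} \<union> {..0} = (UNIV :: int set)"
    by auto
  ultimately show ?thesis by simp
qed

lemma summable_on_power_nat:
  fixes x :: real
  assumes "0 \<le> x" "x < 1"
  shows "(\<lambda>n::nat. x ^ n) summable_on UNIV"
  by (rule norm_summable_imp_summable_on) (use assms in \<open>auto intro: summable_geometric\<close>)

lemma summable_on_prod:
  fixes f :: "'a \<Rightarrow> real" and g :: "'b \<Rightarrow> real"
  assumes "f summable_on A" "g summable_on B" "\<And>x. f x \<ge> 0" "\<And>y. g y \<ge> 0"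
  shows "(\<lambda>(x, y). f x * g y) summable_on A \<times> B"
proof (rule summable_on_SigmaI)
  show "((\<lambda>y. case (x, y) of (x, y) \<Rightarrow> f x * g y) has_sum f x * infsum g B) B" for x
    using has_sum_cmult_right[OF has_sum_infsum[OF assms(2)]] by simp
  show "(\<lambda>x. f x * infsum g B) summable_on A"
    by (intro summable_on_cmult_left assms)
qed (use assms in auto)

lemma summable_on_prod_comparison:
  fixes h :: "'a \<times> 'b \<Rightarrow> complex"
  assumes "f summable_on A" "g summable_on B" "\<And>x. f x \<ge> 0" "\<And>y. g y \<ge> 0"
  assumes "\<And>x y. x \<in> A \<Longrightarrow> y \<in> B \<Longrightarrow> norm (h (x, y)) \<le> C * (f x * g y)"
  shows "h summable_on A \<times> B"
proof (rule abs_summable_summable, rule Infinite_Sum.abs_summable_on_comparison_test')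
  show "(\<lambda>p. C * (case p of (x, y) \<Rightarrow> f x * g y)) summable_on A \<times> B"
    by (intro summable_on_cmult_right summable_on_prod assms)
qed (use assms(5) in auto)

lemma has_sum_prod:
  fixes f :: "'a \<Rightarrow> complex" and g :: "'b \<Rightarrow> complex"
  assumes "(f has_sum a) A" "(g has_sum b) B"
  shows "((\<lambda>(x, y). f x * g y) has_sum a * b) (A \<times> B)"
proof (rule has_sum_SigmaI)
  show "((\<lambda>y. case (x, y) of (x, y) \<Rightarrow> f x * g y) has_sum f x * b) B" for x
    using has_sum_cmult_right[OF assms(2)] by simp
  show "((\<lambda>x. f x * b) has_sum a * b) A"
    by (rule has_sum_cmult_left) (rule assms)
  have "(\<lambda>x. norm (f x)) summable_on A" "(\<lambda>y. norm (g y)) summable_on B"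
    using assms summable_on_iff_abs_summable_on_complex has_sum_imp_summable by blast+
  thus "(\<lambda>(x, y). f x * g y) summable_on A \<times> B"
    by (rule summable_on_prod_comparison[where C = 1]) (auto simp: norm_mult)
qed

text \<open>Combinatorially, partitions are sorted by their largest Durfee rectangle with sides m
  and m + k. The analytic proof shows that the sum \<open>D k\<close> does not depend on
  \<open>k\<close>: consecutive differences satisfy a recursion with factor -q^(k+1), so a uniform
  bound forces them to vanish. The value is read off as k tends to infinity, where only the term m =
  0 survives.\<close>

lemma durfee_has_sum:
  assumes q: "norm q < 1"
  shows "((\<lambda>m. q ^ (m ^ 2 + k * m) / (qpoch q q m * qpoch q q (m + k)))
           has_sum 1 / qpoch_inf q q) UNIV"
proof -
  obtain C where C: "C > 0" "\<And>n. norm (inverse (qpoch q q n)) \<le> C"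
    using qpoch_q_inverse_bounded[OF q] by blast
  define d where "d k m = q ^ (m ^ 2 + k * m) / (qpoch q q m * qpoch q q (m + k))" for k m
  define D where "D k = (\<Sum>m. d k m)" for k
  \<comment> \<open>The factor |q|^(k m) is kept because it makes the tail over m > 0 tend to 0 as
    \<open>k\<close> grows; without it one gets the bound uniform in \<open>k\<close>.\<close>
  have le: "norm (d k m) \<le> C ^ 2 * norm q ^ (k * m) * norm q ^ m" for k m
  proof -
    have "norm (d k m) =
            norm q ^ (m ^ 2 + k * m) * (norm (inverse (qpoch q q m)) * norm (inverse (qpoch q q (m + k))))"
      by (simp add: d_def divide_inverse norm_mult norm_power norm_inverse)
    also have "\<dots> \<le> norm q ^ (m + k * m) * (C * C)"
    proof (intro mult_mono C power_decreasing)
      show "m + k * m \<le> m ^ 2 + k * m"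
        by (cases m) (auto simp: power2_eq_square)
    qed (use q C in \<open>auto intro: less_imp_le\<close>)
    finally show ?thesis by (simp add: power2_eq_square power_add mult_ac)
  qed
  have le': "norm (d k m) \<le> C ^ 2 * norm q ^ m" for k m
    using mult_mono[OF power_le_one[of "norm q" "k * m"] order.refl, of "C ^ 2 * norm q ^ m"] le[of k m] q C
    by (simp add: mult_ac)
  have geo: "summable (\<lambda>m. C ^ 2 * norm q ^ m)"
    using q by (intro summable_mult summable_geometric) auto
  have summ: "summable (\<lambda>m. norm (d k m))" for k
    by (rule summable_comparison_test'[OF geo, of 0]) (use le' in auto)
  have summ': "summable (d k)" for k
    using summ summable_norm_cancel by blast
  define B where "B = (\<Sum>m. C ^ 2 * norm q ^ m)"
  have D_le: "norm (D k) \<le> B" for k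
    unfolding D_def B_def
    by (rule order.trans[OF summable_norm[OF summ] suminf_le]) (use le' summ geo in auto)
  have step: "D k - D (Suc k) = - (q ^ Suc k) * (D (Suc k) - D (Suc (Suc k)))" for k
  proof -
    \<comment> \<open>The difference contains the bracket (1 - q^(m+k+1)) - q^m, which is regrouped
      as (1 - q^m) - q^(m+k+1). The first part vanishes at m = 0 and may be shifted by one; shifted,
      it is q^(k+1) times \<open>d (Suc (Suc k)) m\<close>.\<close>
    define u where "u m = q ^ (m ^ 2 + k * m) * (1 - q ^ m) / (qpoch q q m * qpoch q q (m + Suc k))" for m
    define v where "v m = q ^ Suc k * d (Suc k) m" for m
    have v: "summable v"
      unfolding v_def by (intro summable_mult summ')
    have eq: "d k m - d (Suc k) m = u m - v m" for m
    proof -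
      have "qpoch q q (m + Suc k) = qpoch q q (m + k) * (1 - q ^ (m + Suc k))"
        by (simp add: qpoch_Suc)
      moreover have "1 - q ^ (m + Suc k) \<noteq> 0"
        using power_neq_1_norm_less_1[OF q, of "m + Suc k"] by simp
      ultimately show ?thesis
        using qpoch_q_neq_0[OF q, of m] qpoch_q_neq_0[OF q, of "m + k"]
        by (simp add: d_def u_def v_def divide_simps power_add) (simp add: algebra_simps)
    qed
    have u: "summable u"
    proof -
      have "u = (\<lambda>m. (d k m - d (Suc k) m) + v m)"
        using eq by (simp add: fun_eq_iff)
      thus ?thesis by (auto intro!: summable_add summable_diff summ' v)
    qed
    have "D k - D (Suc k) = (\<Sum>m. u m - v m)"
      unfolding D_def by (subst suminf_diff[OF summ' summ']) (simp add: eq)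
    also have "\<dots> = (\<Sum>m. u m) - (\<Sum>m. v m)"
      by (rule suminf_diff[symmetric]) (fact u v)+
    also have "(\<Sum>m. u m) = (\<Sum>m. u (Suc m))"
      by (subst suminf_split_head[OF u]) (simp add: u_def)
    also have "\<dots> - (\<Sum>m. v m) = (\<Sum>m. u (Suc m) - v m)"
      by (rule suminf_diff) (use u v in \<open>auto simp: summable_Suc_iff\<close>)
    also have "(\<lambda>m. u (Suc m) - v m) = (\<lambda>m. -(q ^ Suc k) * (d (Suc k) m - d (Suc (Suc k)) m))"
    proof
      fix m
      have "qpoch q q (Suc m + Suc k) = qpoch q q (m + Suc k) * (1 - q ^ (Suc m + Suc k))"
        "qpoch q q (Suc m) = qpoch q q m * (1 - q ^ Suc m)"
        by (simp_all add: qpoch_Suc)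
      moreover have "1 - q ^ (Suc m + Suc k) \<noteq> 0" "1 - q ^ Suc m \<noteq> 0"
        using power_neq_1_norm_less_1[OF q, of "Suc m + Suc k"]
          power_neq_1_norm_less_1[OF q, of "Suc m"] by simp_all
      moreover have "(Suc m)\<^sup>2 + k * Suc m = (m ^ 2 + Suc k * m) + m + Suc k"
        "m ^ 2 + Suc (Suc k) * m = m ^ 2 + Suc k * m + m"
        by (simp_all add: power2_eq_square)
      moreover have "m + Suc (Suc k) = Suc m + Suc k" by simp
      ultimately show "u (Suc m) - v m = - (q ^ Suc k) * (d (Suc k) m - d (Suc (Suc k)) m)"
        using qpoch_q_neq_0[OF q, of m] qpoch_q_neq_0[OF q, of "m + Suc k"]
        unfolding d_def u_def v_def
        by (simp add: divide_simps del: power_Suc) (simp add: algebra_simps power_add)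
    qed
    also have "(\<Sum>m. \<dots> m) = - (q ^ Suc k) * (D (Suc k) - D (Suc (Suc k)))"
      unfolding D_def suminf_diff[OF summ' summ']
      by (rule suminf_mult) (intro summable_diff summ')
    finally show ?thesis .
  qed
  have "norm (D k - D (Suc k)) \<le> norm q ^ n * (2 * B)" for n k
  proof (induction n arbitrary: k)
    case 0
    show ?case
      using norm_triangle_ineq4[of "D k" "D (Suc k)"] D_le[of k] D_le[of "Suc k"] by simp
  next
    case (Suc n)
    have "norm (D k - D (Suc k)) = norm q ^ Suc k * norm (D (Suc k) - D (Suc (Suc k)))"
      by (subst step) (simp add: norm_mult norm_power)
    also have "\<dots> \<le> norm q ^ 1 * (norm q ^ n * (2 * B))"
      by (intro mult_mono power_decreasing Suc) (use q in auto)
    finally show ?case by (simp add: mult_ac)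
  qed
  moreover have "(\<lambda>n. norm q ^ n * (2 * B)) \<longlonglongrightarrow> 0 * (2 * B)"
    using q by (intro tendsto_intros LIMSEQ_power_zero) auto
  ultimately have "norm (D k - D (Suc k)) \<le> 0" for k
    using LIMSEQ_le_const[of "\<lambda>n. norm q ^ n * (2 * B)" 0 "norm (D k - D (Suc k))"] by auto
  hence const: "D k = D 0" for k
    by (induction k) auto
  have "D \<longlonglongrightarrow> 1 / qpoch_inf q q"
  proof -
    have "(\<lambda>k. D k - d k 0) \<longlonglongrightarrow> 0"
    proof (rule Lim_null_comparison)
      show "(\<lambda>k. norm q ^ k * B) \<longlonglongrightarrow> 0"
        using tendsto_mult_left_zero[OF LIMSEQ_power_zero[of "norm q"], of B] q by simp
      have "norm (D k - d k 0) \<le> norm q ^ k * B" for k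
      proof -
        have summ_Suc: "summable (\<lambda>m. norm (d k (Suc m)))"
          by (subst summable_Suc_iff[of "\<lambda>m. norm (d k m)"]) (rule summ)
        have "norm (D k - d k 0) = norm (\<Sum>m. d k (Suc m))"
          unfolding D_def by (subst suminf_split_head[OF summ']) simp
        also have "\<dots> \<le> (\<Sum>m. norm (d k (Suc m)))"
          by (rule summable_norm) (rule summ_Suc)
        also have "\<dots> \<le> (\<Sum>m. norm q ^ k * (C ^ 2 * norm q ^ m))"
        proof (rule suminf_le)
          fix m
          have "norm (d k (Suc m)) \<le> C ^ 2 * norm q ^ (k * Suc m) * norm q ^ Suc m"
            by (rule le)
          also have "\<dots> \<le> C ^ 2 * norm q ^ k * norm q ^ m"
            by (rule mult_mono[OF mult_left_mono[OF power_decreasing] power_decreasing])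
               (use q C in auto)
          finally show "norm (d k (Suc m)) \<le> norm q ^ k * (C ^ 2 * norm q ^ m)"
            by (simp add: mult_ac)
        qed (intro summ_Suc summable_mult[OF geo])+
        also have "\<dots> = norm q ^ k * B"
          unfolding B_def by (rule suminf_mult) (rule geo)
        finally show ?thesis .
      qed
      thus "eventually (\<lambda>k. norm (D k - d k 0) \<le> norm q ^ k * B) sequentially"
        by simp
    qed
    moreover have "(\<lambda>k. d k 0) \<longlonglongrightarrow> 1 / qpoch_inf q q"
      unfolding d_def using q by (auto intro!: tendsto_intros qpoch_tendsto)
    ultimately show ?thesis
      using tendsto_add by fastforce
  qed
  moreover have "D \<longlonglongrightarrow> D k"
    using const by (metis (no_types, lifting) LIMSEQ_offset ext tendsto_const)
  ultimately have "D k = 1 / qpoch_inf q q"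
    using LIMSEQ_unique by blast
  moreover have "d k sums D k"
    unfolding D_def by (rule summable_sums) (rule summ')
  ultimately show ?thesis
    using norm_summable_imp_has_sum[OF summ[of k]] unfolding d_def by simp
qed

text \<open>The series is Ramanujan's theta function f(a, b). In the product of the Euler series for
  (-a;ab)_inf and (-b;ab)_inf, the terms with fixed r = i - j form a Durfee sum over m = min i j,
  whose value 1/(ab;ab)_inf is the same for every r.\<close>

lemma jacobi_triple_product_has_sum:
  fixes a b :: complex
  assumes ab: "norm (a * b) < 1"
  shows "((\<lambda>r::int. a ^ nat (r * (r + 1) div 2) * b ^ nat (r * (r - 1) div 2))
           has_sum qpoch_inf (-a) (a * b) * qpoch_inf (-b) (a * b) * qpoch_inf (a * b) (a * b)) UNIV"
proof -
  define q where "q = a * b"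
  have q: "norm q < 1"
    using ab by (simp add: q_def)
  define t where "t r = a ^ nat (r * (r + 1) div 2) * b ^ nat (r * (r - 1) div 2)" for r :: int
  define f where "f z k = q ^ (k choose 2) * z ^ k / qpoch q q k" for z k
  define g where "g r m = t r * (q ^ (m ^ 2 + nat \<bar>r\<bar> * m) / (qpoch q q m * qpoch q q (m + nat \<bar>r\<bar>)))"
    for r m
  have sum: "((\<lambda>(i, j). f a i * f b j) has_sum qpoch_inf (-a) q * qpoch_inf (-b) q) (UNIV \<times> UNIV)"
    unfolding f_def by (intro has_sum_prod euler_has_sum q)
  have tri: "nat (int k * (int k + 1) div 2) = (k choose 2) + k"
    "nat (int k * (int k - 1) div 2) = k choose 2" for k
  proof -
    have *: "int k * (int k - 1) = 2 * int (k choose 2)"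
      using arg_cong[OF two_choose_2[of k], of int] by (simp add: power2_eq_square algebra_simps)
    show "nat (int k * (int k - 1) div 2) = k choose 2"
      unfolding * by simp
    have "int k * (int k + 1) = 2 * int ((k choose 2) + k)"
      using * by (simp add: algebra_simps)
    thus "nat (int k * (int k + 1) div 2) = (k choose 2) + k"
      by (simp only: nonzero_mult_div_cancel_left[of "2::int"] nat_int)
  qed
  have expo: "((m + k) choose 2) + (m choose 2) + m = (k choose 2) + (m ^ 2 + k * m)" for m k
    unfolding choose_2_add two_choose_2[symmetric] by simp
  have gpos: "g (int k) m = f a (m + k) * f b m" for k m
  proof -
    have "f a (m + k) * f b m = q ^ (((m + k) choose 2) + (m choose 2)) * (a * b) ^ m * a ^ k
             / (qpoch q q m * qpoch q q (m + k))"
      by (simp add: f_def power_add power_mult_distrib mult_ac)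
    also have "\<dots> = q ^ (((m + k) choose 2) + (m choose 2) + m) * a ^ k
             / (qpoch q q m * qpoch q q (m + k))"
      by (simp add: q_def power_add)
    also have "\<dots> = g (int k) m"
      unfolding expo g_def t_def tri
      by (simp add: power_add power_mult_distrib q_def mult_ac)
    finally show ?thesis ..
  qed
  have gneg: "g (- int k) m = f a m * f b (m + k)" for k m
  proof -
    have "f a m * f b (m + k) = q ^ (((m + k) choose 2) + (m choose 2)) * (a * b) ^ m * b ^ k
             / (qpoch q q m * qpoch q q (m + k))"
      by (simp add: f_def power_add power_mult_distrib mult_ac)
    also have "\<dots> = q ^ (((m + k) choose 2) + (m choose 2) + m) * b ^ k
             / (qpoch q q m * qpoch q q (m + k))"
      by (simp add: q_def power_add)
    also have "\<dots> = g (- int k) m"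
    proof -
      have "t (- int k) = a ^ (k choose 2) * b ^ ((k choose 2) + k)"
      proof -
        have "- int k * (- int k + 1) = int k * (int k - 1)"
          "- int k * (- int k - 1) = int k * (int k + 1)"
          by (simp_all add: algebra_simps)
        thus ?thesis
          unfolding t_def by (simp only: tri)
      qed
      thus ?thesis
        unfolding expo g_def by (simp add: power_add power_mult_distrib q_def mult_ac)
    qed
    finally show ?thesis ..
  qed
  have "((\<lambda>(r, m). g r m) has_sum qpoch_inf (-a) q * qpoch_inf (-b) q) (UNIV \<times> UNIV)"
  \<comment> \<open>Since \<open>nat\<close> sends negative integers to 0, at most one of the two
    indices exceeds m, and one formula covers both signs of r.\<close>
  proof (subst has_sum_reindex_bij_witness[where
        j = "\<lambda>(r, m). (m + nat r, m + nat (-r))" and i = "\<lambda>(i, j). (int i - int j, min i j)"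
        and h = "\<lambda>(i, j). f a i * f b j" and T = "UNIV \<times> UNIV"])
    fix x :: "int \<times> nat"
    obtain r m where x: "x = (r, m)" by force
    show "(case (case x of (r, m) \<Rightarrow> (m + nat r, m + nat (-r))) of (i, j) \<Rightarrow> f a i * f b j) =
          (case x of (r, m) \<Rightarrow> g r m)"
    proof (cases "r \<ge> 0")
      case True
      thus ?thesis using gpos[of "nat r" m] by (simp add: x)
    next
      case False
      thus ?thesis using gneg[of "nat (-r)" m] by (simp add: x)
    qed
  qed (use sum in \<open>auto simp: min_def\<close>)
  hence "((\<lambda>r. t r * (1 / qpoch_inf q q)) has_sum qpoch_inf (-a) q * qpoch_inf (-b) q) UNIV"
  proof (rule has_sum_SigmaD)
    show "((\<lambda>m. case (r, m) of (r, m) \<Rightarrow> g r m) has_sum t r * (1 / qpoch_inf q q)) UNIV" for r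
      using has_sum_cmult_right[OF durfee_has_sum[OF q, of "nat \<bar>r\<bar>"], of "t r"]
      by (simp add: g_def)
  qed
  from has_sum_cmult_left[OF this, of "qpoch_inf q q"] show ?thesis
    using q by (simp add: t_def[abs_def] q_def[symmetric])
qed

section \<open>Bailey pairs in base p^2 and two Slater-type sums\<close>

text \<open>The Gauss-type evaluations below are Bailey pairs with the common factor
  \<open>(P;P)\<^sub>2\<^sub>n\<close> divided out; they are proved together, each from the other by the
  \<open>q\<close>-Pascal rule.\<close>

context
  fixes p :: complex
  assumes p: "norm p < 1" "p \<noteq> 0"
begin

text \<open>Extending the reciprocals by 0 to negative indices turns the finite sums over r into
  sums over all integers, so reflections and shifts of r need no boundary terms.\<close>

definition rqpoch :: "int \<Rightarrow> complex" where
  "rqpoch k = (if k < 0 then 0 else inverse (qpoch (p ^ 2) (p ^ 2) (nat k)))"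

lemma norm_p2: "norm (p ^ 2) < 1"
  using p by (simp add: norm_power_less_1)

lemma rqpoch_rec: "(1 - p powi (2 * k)) * rqpoch k = rqpoch (k - 1)"
proof (cases "k > 0")
  case True
  then obtain n where k: "k = int (Suc n)"
    by (metis zero_less_imp_eq_int gr0_implies_Suc)
  have "p powi (2 * k) = (p ^ 2) ^ Suc n"
    unfolding k power_mult[symmetric] by (metis of_nat_mult of_nat_numeral power_int_of_nat)
  moreover have "nat (k - 1) = n" "nat k = Suc n" using k by auto
  ultimately show ?thesis
    using k power_neq_1_norm_less_1[OF norm_p2, of "Suc n"]
    by (simp add: rqpoch_def qpoch_Suc)
qed (auto simp: rqpoch_def)

text \<open>The q-Pascal rule for Gaussian binomials with the numerator factorial divided out; it
  comes from 1 - x y = (1 - y) + y (1 - x).\<close>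

lemma rqpoch_pascal:
  "(1 - p powi (2 * (k + l))) * (rqpoch k * rqpoch l) =
     rqpoch k * rqpoch (l - 1) + p powi (2 * l) * (rqpoch (k - 1) * rqpoch l)"
proof -
  have "1 - p powi (2 * (k + l)) = (1 - p powi (2 * l)) + p powi (2 * l) * (1 - p powi (2 * k))"
    using p by (simp add: algebra_simps power_int_add)
  thus ?thesis
    by (simp add: rqpoch_rec[symmetric] algebra_simps)
qed

lemma bailey_pair_even_odd:
  fixes n :: nat
  shows "((\<lambda>r. p powi (2 * r ^ 2 - r) * (rqpoch (int n - r) * rqpoch (int n + r)))
           has_sum 1 / (qpoch (p ^ 2) (p ^ 2) n * qpoch p (p ^ 2) n)) UNIV" (is "?V n")
    and "((\<lambda>r. p powi (2 * r ^ 2 + r) * (rqpoch (int n - r) * rqpoch (int n + 1 + r)))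
           has_sum 1 / (qpoch (p ^ 2) (p ^ 2) n * qpoch p (p ^ 2) (Suc n))) UNIV" (is "?W n")
proof -
  define v w where "v r n = p powi (2 * r ^ 2 - r) * (rqpoch (int n - r) * rqpoch (int n + r))"
    and "w r n = p powi (2 * r ^ 2 + r) * (rqpoch (int n - r) * rqpoch (int n + 1 + r))" for r n
  have pow_neq: "p ^ k \<noteq> 1" if "k > 0" for k
    using power_neq_1_norm_less_1[OF p(1) that] .
  have neq: "1 - p ^ k \<noteq> 0" "1 + p ^ k \<noteq> 0" if "k > 0" for k
  proof -
    show "1 - p ^ k \<noteq> 0" using pow_neq[OF that] by simp
    show "1 + p ^ k \<noteq> 0"
    proof
      assume "1 + p ^ k = 0"
      hence "p ^ k = -1" by (metis add.commute eq_neg_iff_add_eq_0)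
      hence "p ^ (2 * k) = 1" by (simp add: power_mult mult.commute[of 2])
      thus False using pow_neq[of "2 * k"] that by simp
    qed
  qed
  \<comment> \<open>The reflection r -> -r exchanges the exponents 2r^2 - r and 2r^2 + r. Hence,
    summed over r, the right-hand side is 1 + p^(2n+2) times one and the same sum, and this factor
    cancels against 1 - p^(4n+4).\<close>
  have step_V: "(v r (Suc n)) * (1 - p ^ (4 * Suc n)) =
                w (-r) n + p ^ (2 * Suc n) * w r n" for r n
  proof -
    have "p ^ (4 * Suc n) = p powi (2 * ((int (Suc n) - r) + (int (Suc n) + r)))"
      by (subst power_int_of_nat[symmetric]) simp
    hence "v r (Suc n) * (1 - p ^ (4 * Suc n)) = p powi (2 * r ^ 2 - r) *
            ((1 - p powi (2 * ((int (Suc n) - r) + (int (Suc n) + r)))) * 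
              (rqpoch (int (Suc n) - r) * rqpoch (int (Suc n) + r)))"
      by (simp only: v_def mult_ac)
    also have "\<dots> = w (-r) n + 
        p powi (2 * r ^ 2 - r) * p powi (2 * (int (Suc n) + r)) * (rqpoch (int n - r) * rqpoch (int n + 1 + r))"
      unfolding rqpoch_pascal by (simp add: w_def algebra_simps)
    also have "p powi (2 * r ^ 2 - r) * p powi (2 * (int (Suc n) + r)) =
               p powi (int (2 * Suc n)) * p powi (2 * r ^ 2 + r)"
      by (subst (1 2) power_int_add[symmetric]) (use p in \<open>auto simp: algebra_simps\<close>)
    finally show ?thesis
      by (simp only: power_int_of_nat w_def mult_ac)
  qed
  \<comment> \<open>Here the second term reappears at r + 1, so a shift of r joins the
    reflection.\<close>
  have step_W: "w r n * (1 - p ^ (4 * n + 2)) =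
                v (-r) n + p ^ (2 * n + 1) * v (r + 1) n" for r n
  proof -
    have "p ^ (4 * n + 2) = p powi (2 * ((int n - r) + (int n + 1 + r)))"
      by (subst power_int_of_nat[symmetric]) (simp add: add.commute)
    hence "w r n * (1 - p ^ (4 * n + 2)) = p powi (2 * r ^ 2 + r) *
            ((1 - p powi (2 * ((int n - r) + (int n + 1 + r)))) * 
              (rqpoch (int n - r) * rqpoch (int n + 1 + r)))"
      by (simp only: w_def mult_ac)
    also have "\<dots> = v (-r) n + 
        p powi (2 * r ^ 2 + r) * p powi (2 * (int n + 1 + r)) * (rqpoch (int n - (r + 1)) * rqpoch (int n + (r + 1)))"
      unfolding rqpoch_pascal by (simp add: v_def algebra_simps)
    also have "p powi (2 * r ^ 2 + r) * p powi (2 * (int n + 1 + r)) =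
               p powi (int (2 * n + 1)) * p powi (2 * (r + 1) ^ 2 - (r + 1))"
      by (subst (1 2) power_int_add[symmetric])
         (use p in \<open>auto simp: algebra_simps power2_eq_square\<close>)
    finally show ?thesis
      by (simp only: power_int_of_nat v_def mult_ac)
  qed
  have neg: "((\<lambda>r. f (-r)) has_sum S) UNIV \<longleftrightarrow> (f has_sum S) UNIV" for f :: "int \<Rightarrow> complex" and S
    by (rule has_sum_reindex_bij_witness[of _ uminus uminus]) auto
  have shift: "((\<lambda>r. f (r + 1)) has_sum S) UNIV \<longleftrightarrow> (f has_sum S) UNIV" for f :: "int \<Rightarrow> complex" and S
    by (rule has_sum_reindex_bij_witness[of _ "\<lambda>r. r - 1" "\<lambda>r. r + 1"]) auto
  have diff_square: "1 - p ^ k = (1 + p ^ l) * (1 - p ^ l)" if "k = l + l" for k l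
    unfolding that power_add by (simp add: algebra_simps)
  have VW: "?W n" if V: "?V n" for n
  proof -
    let ?s = "1 / (qpoch (p ^ 2) (p ^ 2) n * qpoch p (p ^ 2) n)"
    have V': "((\<lambda>r. v r n) has_sum ?s) UNIV"
      using V unfolding v_def .
    have "((\<lambda>r. v (-r) n + p ^ (2 * n + 1) * v (r + 1) n) has_sum (?s + p ^ (2 * n + 1) * ?s)) UNIV"
      by (intro has_sum_add has_sum_cmult_right)
         (use V' in \<open>simp_all only: neg[of "\<lambda>r. v r n"] shift[of "\<lambda>r. v r n"]\<close>)
    hence "((\<lambda>r. w r n * (1 - p ^ (4 * n + 2))) has_sum (?s + p ^ (2 * n + 1) * ?s)) UNIV"
      by (simp only: step_W)
    from has_sum_cmult_left[OF this, of "1 / (1 - p ^ (4 * n + 2))"]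
    have "((\<lambda>r. w r n) has_sum (?s + p ^ (2 * n + 1) * ?s) / (1 - p ^ (4 * n + 2))) UNIV"
      using neq[of "4 * n + 2"] by simp
    also have "1 - p ^ (4 * n + 2) = (1 + p ^ (2 * n + 1)) * (1 - p ^ (2 * n + 1))"
      by (rule diff_square[of "4 * n + 2" "2 * n + 1"]) simp
    also have "(?s + p ^ (2 * n + 1) * ?s) / \<dots> = 
        1 / (qpoch (p ^ 2) (p ^ 2) n * qpoch p (p ^ 2) (Suc n))"
    proof -
      have "?s + p ^ (2 * n + 1) * ?s = (1 + p ^ (2 * n + 1)) * ?s"
        by (simp only: distrib_right mult_1)
      moreover have "qpoch p (p ^ 2) (Suc n) = qpoch p (p ^ 2) n * (1 - p ^ (2 * n + 1))"
        by (simp add: qpoch_Suc power_mult)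
      ultimately show ?thesis
        using neq[of "2 * n + 1"] by (simp del: power_Suc)
    qed
    finally show ?thesis unfolding w_def .
  qed
  have WV: "?V (Suc n)" if W: "?W n" for n
  proof -
    let ?s = "1 / (qpoch (p ^ 2) (p ^ 2) n * qpoch p (p ^ 2) (Suc n))"
    have W': "((\<lambda>r. w r n) has_sum ?s) UNIV"
      using W unfolding w_def .
    have "((\<lambda>r. w (-r) n + p ^ (2 * Suc n) * w r n) has_sum (?s + p ^ (2 * Suc n) * ?s)) UNIV"
      by (intro has_sum_add has_sum_cmult_right W')
         (use W' in \<open>simp_all only: neg[of "\<lambda>r. w r n"]\<close>)
    hence "((\<lambda>r. v r (Suc n) * (1 - p ^ (4 * Suc n))) has_sum (?s + p ^ (2 * Suc n) * ?s)) UNIV"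
      by (simp only: step_V)
    from has_sum_cmult_left[OF this, of "1 / (1 - p ^ (4 * Suc n))"]
    have "((\<lambda>r. v r (Suc n)) has_sum (?s + p ^ (2 * Suc n) * ?s) / (1 - p ^ (4 * Suc n))) UNIV"
      using neq[of "4 * Suc n"] by simp
    also have "1 - p ^ (4 * Suc n) = (1 + p ^ (2 * Suc n)) * (1 - p ^ (2 * Suc n))"
      by (rule diff_square) simp
    also have "(?s + p ^ (2 * Suc n) * ?s) / \<dots> = 
        1 / (qpoch (p ^ 2) (p ^ 2) (Suc n) * qpoch p (p ^ 2) (Suc n))"
    proof -
      have "?s + p ^ (2 * Suc n) * ?s = (1 + p ^ (2 * Suc n)) * ?s"
        by (simp only: distrib_right mult_1)
      moreover have "qpoch (p ^ 2) (p ^ 2) (Suc n) = qpoch (p ^ 2) (p ^ 2) n * (1 - p ^ (2 * Suc n))"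
        by (simp only: qpoch_Suc power_mult power_Suc)
      ultimately show ?thesis
        using neq[of "2 * Suc n"] by (simp del: power_Suc)
    qed
    finally show ?thesis unfolding v_def .
  qed
  have V0: "?V 0"
  proof (rule has_sum_finite_neutralI[of "{0}"])
    show "p powi (2 * r ^ 2 - r) * (rqpoch (int 0 - r) * rqpoch (int 0 + r)) = 0"
      if "r \<in> UNIV - {0}" for r
      using that by (auto simp: rqpoch_def)
  qed (auto simp: rqpoch_def)
  have "?V n" for n
    by (induction n) (use V0 VW WV in blast)+
  thus "?V n" "?W n" using VW by blast+
qed

lemma norm_rqpoch_le:
  obtains C where "C > 0" "\<And>k. norm (rqpoch k) \<le> C"
proof -
  obtain C where C: "C > 0" "\<And>n. norm (inverse (qpoch (p ^ 2) (p ^ 2) n)) \<le> C"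
    using qpoch_q_inverse_bounded[OF norm_p2] by blast
  hence "norm (rqpoch k) \<le> C" for k
    by (auto simp: rqpoch_def)
  thus ?thesis using that C(1) by blast
qed

text \<open>The terms with n < s vanish. Putting n = m + s gives the Durfee sum for k = 2s + e,
  because (m + s)^2 + e (m + s) = (s^2 + e s) + m^2 + (2s + e) m.\<close>

lemma durfee_rqpoch_has_sum:
  "((\<lambda>n. (p ^ 2) ^ (n ^ 2 + e * n) * (rqpoch (int n - int s) * rqpoch (int n + int e + int s)))
     has_sum (p ^ 2) ^ (s ^ 2 + e * s) / qpoch_inf (p ^ 2) (p ^ 2)) UNIV"
proof -
  let ?f = "\<lambda>n. (p ^ 2) ^ (n ^ 2 + e * n) * (rqpoch (int n - int s) * rqpoch (int n + int e + int s))"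
  have "((\<lambda>m. (p ^ 2) ^ (s ^ 2 + e * s) * ((p ^ 2) ^ (m ^ 2 + (2 * s + e) * m) /
            (qpoch (p ^ 2) (p ^ 2) m * qpoch (p ^ 2) (p ^ 2) (m + (2 * s + e)))))
         has_sum (p ^ 2) ^ (s ^ 2 + e * s) * (1 / qpoch_inf (p ^ 2) (p ^ 2))) UNIV"
    by (intro has_sum_cmult_right durfee_has_sum norm_p2)
  also have "?this \<longleftrightarrow> (?f has_sum (p ^ 2) ^ (s ^ 2 + e * s) / qpoch_inf (p ^ 2) (p ^ 2)) {s..}"
  proof (rule has_sum_reindex_bij_witness[of _ "\<lambda>n. n - s" "\<lambda>m. m + s"])
    fix m
    have "(m + s) ^ 2 + e * (m + s) = (s ^ 2 + e * s) + (m ^ 2 + (2 * s + e) * m)"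
      by (simp add: power2_eq_square algebra_simps)
    moreover have "nat (int (m + s) + int e + int s) = m + (2 * s + e)"
      by simp
    ultimately show "?f (m + s) = (p ^ 2) ^ (s ^ 2 + e * s) * ((p ^ 2) ^ (m ^ 2 + (2 * s + e) * m) /
            (qpoch (p ^ 2) (p ^ 2) m * qpoch (p ^ 2) (p ^ 2) (m + (2 * s + e))))"
      by (simp add: rqpoch_def power_add divide_inverse del: power_mult_distrib)
  qed auto
  also have "\<dots> \<longleftrightarrow> (?f has_sum (p ^ 2) ^ (s ^ 2 + e * s) / qpoch_inf (p ^ 2) (p ^ 2)) UNIV"
    by (rule has_sum_cong_neutral) (auto simp: rqpoch_def)
  finally show ?thesis .
qed

text \<open>The limiting case of Bailey's lemma. Weighting row n by (p^2)^(n^2 + e n) makes each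
  column a Durfee sum, so after the interchange only the series of \<open>c r * d r\<close> is left.
  The bound on \<open>c\<close> makes the double family absolutely summable.\<close>

lemma bailey_interchange:
  fixes c d :: "int \<Rightarrow> complex"
  assumes row: "\<And>n. ((\<lambda>r. c r * (rqpoch (int n - r) * rqpoch (int n + int e + r))) has_sum b n) UNIV"
  assumes c: "\<And>r. norm (c r) \<le> norm p ^ nat \<bar>r\<bar>"
  assumes col: "\<And>r. ((\<lambda>n. (p ^ 2) ^ (n ^ 2 + e * n) * (rqpoch (int n - r) * rqpoch (int n + int e + r)))
     has_sum d r / qpoch_inf (p ^ 2) (p ^ 2)) UNIV"
  assumes theta: "((\<lambda>r. c r * d r) has_sum S) UNIV"
  shows "((\<lambda>n. (p ^ 2) ^ (n ^ 2 + e * n) * b n) has_sum S / qpoch_inf (p ^ 2) (p ^ 2)) UNIV"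
proof -
  define f where "f n r = (p ^ 2) ^ (n ^ 2 + e * n) *
    (c r * (rqpoch (int n - r) * rqpoch (int n + int e + r)))" for n r
  obtain C where C: "C > 0" "\<And>k. norm (rqpoch k) \<le> C"
    using norm_rqpoch_le by blast
  have "(\<lambda>(n, r). f n r) summable_on UNIV \<times> UNIV"
  proof (rule summable_on_prod_comparison[where f = "\<lambda>n. norm p ^ n" and g = "\<lambda>r. norm p ^ nat \<bar>r\<bar>"
        and C = "C ^ 2"])
    fix n r
    have "norm (f n r) = norm p ^ (2 * (n ^ 2 + e * n)) *
            (norm (c r) * (norm (rqpoch (int n - r)) * norm (rqpoch (int n + int e + r))))"
      unfolding f_def norm_mult by (simp only: norm_power power_mult)
    also have "\<dots> \<le> norm p ^ n * (norm p ^ nat \<bar>r\<bar> * (C * C))"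
    proof (intro mult_mono C c power_decreasing)
      show "n \<le> 2 * (n ^ 2 + e * n)"
        by (cases n) (auto simp: power2_eq_square)
    qed (use p C in \<open>auto intro: less_imp_le\<close>)
    finally show "norm (case (n, r) of (n, r) \<Rightarrow> f n r) \<le> C ^ 2 * (norm p ^ n * norm p ^ nat \<bar>r\<bar>)"
      by (simp add: power2_eq_square mult_ac)
  qed (use p in \<open>auto intro!: summable_on_power_nat summable_on_power_int_abs\<close>)
  then obtain T where T: "((\<lambda>(n, r). f n r) has_sum T) (UNIV \<times> UNIV)"
    using has_sum_infsum by blast
  have rows: "((\<lambda>n. (p ^ 2) ^ (n ^ 2 + e * n) * b n) has_sum T) UNIV"
    using T by (rule has_sum_SigmaD) (auto simp: f_def intro!: has_sum_cmult_right row)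
  have "((\<lambda>(r, n). f n r) has_sum T) (UNIV \<times> UNIV)"
    using T by (subst has_sum_swap) simp
  hence "((\<lambda>r. c r * (d r / qpoch_inf (p ^ 2) (p ^ 2))) has_sum T) UNIV"
  proof (rule has_sum_SigmaD)
    fix r
    show "((\<lambda>n. case (r, n) of (r, n) \<Rightarrow> f n r) has_sum c r * (d r / qpoch_inf (p ^ 2) (p ^ 2))) UNIV"
      using has_sum_cmult_right[OF col[of r], where c = "c r"] by (simp add: f_def mult_ac)
  qed
  moreover have "((\<lambda>r. c r * d r * inverse (qpoch_inf (p ^ 2) (p ^ 2)))
      has_sum S * inverse (qpoch_inf (p ^ 2) (p ^ 2))) UNIV"
    by (rule has_sum_cmult_left) (rule theta)
  ultimately have "T = S / qpoch_inf (p ^ 2) (p ^ 2)"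
    using has_sum_unique by (fastforce simp: divide_inverse mult_ac)
  with rows show ?thesis by simp
qed

lemma theta_power_int:
  "(p ^ i) ^ nat (r * (r + 1) div 2) * (p ^ j) ^ nat (r * (r - 1) div 2) =
     p powi (int (i + j) * (r * (r - 1) div 2) + int i * r)"
proof -
  have "even (r * (r - 1))" by auto
  then obtain T where T: "r * (r - 1) = 2 * T" by (metis evenE)
  have T': "r * (r + 1) = 2 * (T + r)"
    using T by (simp add: algebra_simps)
  have "r * (r - 1) \<ge> 0" "r * (r + 1) \<ge> 0"
    by (auto simp: zero_le_mult_iff)
  hence "T \<ge> 0" "T + r \<ge> 0"
    using T T' by simp_all
  hence "(p ^ i) ^ nat (T + r) * (p ^ j) ^ nat T = p powi (int i * (T + r)) * p powi (int j * T)"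
    by (simp add: power_int_mult flip: power_int_of_nat)
  also have "\<dots> = p powi (int i * (T + r) + int j * T)"
    using p by (simp add: power_int_add)
  also have "int i * (T + r) + int j * T = int (i + j) * T + int i * r"
    by (simp add: algebra_simps)
  finally show ?thesis
    unfolding T T' by simp
qed

lemma norm_power_int_le:
  assumes "k \<ge> \<bar>r\<bar>"
  shows "norm (p powi k) \<le> norm p ^ nat \<bar>r\<bar>"
proof -
  have "norm (p powi k) = norm p ^ nat k"
    using assms by (simp add: power_int_def norm_power)
  also have "\<dots> \<le> norm p ^ nat \<bar>r\<bar>"
    using assms p by (intro power_decreasing) auto
  finally show ?thesis .
qed

lemma norm_p_power_mult_less_1: "norm (p ^ i * p ^ j) < 1" if "i + j > 0"
  using that p by (simp add: norm_power_less_1 flip: power_add)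

lemma abs_le_square: "\<bar>r\<bar> \<le> r ^ 2" for r :: int
  using self_le_power[of "\<bar>r\<bar>" 2] by (cases "r = 0") auto

text \<open>The column at r contributes p^(2r^2), so the theta exponent is 4r^2 - r = 3 r(r+1)/2 + 5
  r(r-1)/2, which is the triple product at a = p^3, b = p^5. All exponents of p in its linear
  factors are odd, so p = -q removes the signs.\<close>

lemma slater_even_has_sum:
  "((\<lambda>n. (p ^ 2) ^ (n ^ 2) * (1 / (qpoch (p ^ 2) (p ^ 2) n * qpoch p (p ^ 2) n)))
     has_sum qpoch_inf (-(p ^ 3)) (p ^ 8) * qpoch_inf (-(p ^ 5)) (p ^ 8) * qpoch_inf (p ^ 8) (p ^ 8)
       / qpoch_inf (p ^ 2) (p ^ 2)) UNIV"
proof -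
  have "((\<lambda>n. (p ^ 2) ^ (n ^ 2 + 0 * n) * (1 / (qpoch (p ^ 2) (p ^ 2) n * qpoch p (p ^ 2) n)))
     has_sum qpoch_inf (-(p ^ 3)) (p ^ 8) * qpoch_inf (-(p ^ 5)) (p ^ 8) * qpoch_inf (p ^ 8) (p ^ 8)
       / qpoch_inf (p ^ 2) (p ^ 2)) UNIV"
  proof (rule bailey_interchange)
    show "((\<lambda>r. p powi (2 * r ^ 2 - r) * (rqpoch (int n - r) * rqpoch (int n + int 0 + r)))
            has_sum 1 / (qpoch (p ^ 2) (p ^ 2) n * qpoch p (p ^ 2) n)) UNIV" for n
      using bailey_pair_even_odd(1)[of n] by simp
    show "norm (p powi (2 * r ^ 2 - r)) \<le> norm p ^ nat \<bar>r\<bar>" for r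
      by (rule norm_power_int_le) (use abs_le_square[of r] in linarith)
    show "((\<lambda>n. (p ^ 2) ^ (n ^ 2 + 0 * n) * (rqpoch (int n - r) * rqpoch (int n + int 0 + r)))
            has_sum p powi (2 * r ^ 2) / qpoch_inf (p ^ 2) (p ^ 2)) UNIV" for r
    proof -
      have "rqpoch (int n - \<bar>r\<bar>) * rqpoch (int n + \<bar>r\<bar>) = rqpoch (int n - r) * rqpoch (int n + r)" for n
        by (simp add: abs_if mult_ac)
      moreover have "(p ^ 2) ^ ((nat \<bar>r\<bar>) ^ 2) = p powi (2 * r ^ 2)"
      proof -
        have "(p ^ 2) ^ ((nat \<bar>r\<bar>) ^ 2) = p powi int (2 * (nat \<bar>r\<bar>) ^ 2)"
          by (simp only: power_int_of_nat power_mult)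
        thus ?thesis by simp
      qed
      ultimately show ?thesis
        using durfee_rqpoch_has_sum[of 0 "nat \<bar>r\<bar>"] by simp
    qed
    have "((\<lambda>r. p powi (int (3 + 5) * (r * (r - 1) div 2) + int 3 * r)) has_sum 
       qpoch_inf (-(p ^ 3)) (p ^ 8) * qpoch_inf (-(p ^ 5)) (p ^ 8) * qpoch_inf (p ^ 8) (p ^ 8)) UNIV"
      using jacobi_triple_product_has_sum[OF norm_p_power_mult_less_1[of 3 5]]
      unfolding theta_power_int by (simp flip: power_add)
    moreover have "p powi (int (3 + 5) * (r * (r - 1) div 2) + int 3 * r) =
        p powi (2 * r ^ 2 - r) * p powi (2 * r ^ 2)" for r
    proof -
      have "even (r * (r - 1))" by auto
      then obtain T where T: "r * (r - 1) = 2 * T" by (metis evenE)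
      have *: "int (3 + 5) * (r * (r - 1) div 2) + int 3 * r = (2 * r ^ 2 - r) + 2 * r ^ 2"
        by (subst T) (use T in \<open>simp add: power2_eq_square algebra_simps\<close>)
      show ?thesis
        unfolding * by (rule power_int_add) (use p in simp)
    qed
    ultimately show "((\<lambda>r. p powi (2 * r ^ 2 - r) * p powi (2 * r ^ 2)) has_sum 
        qpoch_inf (-(p ^ 3)) (p ^ 8) * qpoch_inf (-(p ^ 5)) (p ^ 8) * qpoch_inf (p ^ 8) (p ^ 8)) UNIV"
      by simp
  qed
  thus ?thesis by simp
qed

text \<open>Now the column contributes p^(2r^2 + 2r), and 4r^2 + 3r = 7 r(r+1)/2 + r(r-1)/2 calls
  for the triple product at a = p^7, b = p.\<close>

lemma slater_odd_has_sum:
  "((\<lambda>n. (p ^ 2) ^ (n ^ 2 + 1 * n) * (1 / (qpoch (p ^ 2) (p ^ 2) n * qpoch p (p ^ 2) (Suc n))))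
     has_sum qpoch_inf (-(p ^ 7)) (p ^ 8) * qpoch_inf (-p) (p ^ 8) * qpoch_inf (p ^ 8) (p ^ 8)
       / qpoch_inf (p ^ 2) (p ^ 2)) UNIV"
proof (rule bailey_interchange)
  show "((\<lambda>r. p powi (2 * r ^ 2 + r) * (rqpoch (int n - r) * rqpoch (int n + int 1 + r)))
          has_sum 1 / (qpoch (p ^ 2) (p ^ 2) n * qpoch p (p ^ 2) (Suc n))) UNIV" for n
    using bailey_pair_even_odd(2)[of n] by simp
  show "norm (p powi (2 * r ^ 2 + r)) \<le> norm p ^ nat \<bar>r\<bar>" for r
    by (rule norm_power_int_le) (use abs_le_square[of r] in linarith)
  show "((\<lambda>n. (p ^ 2) ^ (n ^ 2 + 1 * n) * (rqpoch (int n - r) * rqpoch (int n + int 1 + r)))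
          has_sum p powi (2 * r ^ 2 + 2 * r) / qpoch_inf (p ^ 2) (p ^ 2)) UNIV" for r
  proof -
    \<comment> \<open>The column is invariant under r -> -1 - r, which also fixes r^2 + r;
      \<open>s\<close> is the nonnegative member of the orbit.\<close>
    define s where "s = (if r \<ge> 0 then nat r else nat (-1 - r))"
    have s: "r = int s \<or> r = -1 - int s"
      by (auto simp: s_def)
    hence "rqpoch (int n - int s) * rqpoch (int n + int 1 + int s) =
           rqpoch (int n - r) * rqpoch (int n + int 1 + r)" for n
      by (elim disjE; simp only:; simp add: algebra_simps)
    moreover have "(p ^ 2) ^ (s ^ 2 + 1 * s) = p powi (2 * r ^ 2 + 2 * r)"
    proof -
      have "(p ^ 2) ^ (s ^ 2 + 1 * s) = p powi int (2 * (s ^ 2 + 1 * s))"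
        by (simp only: power_int_of_nat power_mult)
      also have "int (2 * (s ^ 2 + 1 * s)) = 2 * (int s) ^ 2 + 2 * int s"
        by simp
      also have "\<dots> = 2 * r ^ 2 + 2 * r"
        using s by (elim disjE; simp only:; simp add: power2_eq_square algebra_simps)
      finally show ?thesis .
    qed
    ultimately show ?thesis
      using durfee_rqpoch_has_sum[of 1 s] by (simp only:)
  qed
  have "((\<lambda>r. p powi (int (7 + 1) * (r * (r - 1) div 2) + int 7 * r)) has_sum 
     qpoch_inf (-(p ^ 7)) (p ^ 8) * qpoch_inf (-p) (p ^ 8) * qpoch_inf (p ^ 8) (p ^ 8)) UNIV"
    using jacobi_triple_product_has_sum[OF norm_p_power_mult_less_1[of 7 1]]
    unfolding theta_power_int by (simp flip: power_Suc2)
  moreover have "p powi (int (7 + 1) * (r * (r - 1) div 2) + int 7 * r) =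
      p powi (2 * r ^ 2 + r) * p powi (2 * r ^ 2 + 2 * r)" for r
  proof -
    have "even (r * (r - 1))" by auto
    then obtain T where T: "r * (r - 1) = 2 * T" by (metis evenE)
    have *: "int (7 + 1) * (r * (r - 1) div 2) + int 7 * r = (2 * r ^ 2 + r) + (2 * r ^ 2 + 2 * r)"
      by (subst T) (use T in \<open>simp add: power2_eq_square algebra_simps\<close>)
    show ?thesis
        unfolding * by (rule power_int_add) (use p in simp)
  qed
  ultimately show "((\<lambda>r. p powi (2 * r ^ 2 + r) * p powi (2 * r ^ 2 + 2 * r)) has_sum 
      qpoch_inf (-(p ^ 7)) (p ^ 8) * qpoch_inf (-p) (p ^ 8) * qpoch_inf (p ^ 8) (p ^ 8)) UNIV"
    by simp
qed

end


section \<open>Reduction of the double sums to single sums\<close>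

text \<open>Summing over j gives (-q^(i+1);q)_inf = (-q;q)_inf / (-q;q)_i. Since (q;q)_i (-q;q)_i =
  (q^2;q^2)_i, the sum over i is again Euler's series, in base q^2 at z = q^e. The values e = 0, 1,
  2 give the first, third and fourth identities.\<close>

lemma nahm_sum_euler_has_sum:
  assumes q: "norm q < 1"
  shows "((\<lambda>(i, j). q ^ (i ^ 2 - i + e * i + i * j + (j ^ 2 + j) div 2) / (qpoch q q i * qpoch q q j))
           has_sum qpoch_inf (-q) q * qpoch_inf (-(q ^ e)) (q ^ 2)) UNIV"
proof -
  obtain C where C: "C > 0" "\<And>n. norm (inverse (qpoch q q n)) \<le> C"
    using qpoch_q_inverse_bounded[OF q] by blast
  have q2: "norm (q ^ 2) < 1"
    using q by (simp add: norm_power_less_1)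
  have tri: "(j ^ 2 + j) div 2 = (j choose 2) + j" for j :: nat
    by (simp flip: two_choose_2)
  have tri': "i ^ 2 - i = 2 * (i choose 2)" for i :: nat
    by (simp flip: two_choose_2)
  define f where "f i j = q ^ (i ^ 2 - i + e * i + i * j + (j ^ 2 + j) div 2) /
    (qpoch q q i * qpoch q q j)" for i j
  have "((\<lambda>(i, j). f i j) has_sum qpoch_inf (-q) q * qpoch_inf (-(q ^ e)) (q ^ 2)) (UNIV \<times> UNIV)"
  proof (rule has_sum_SigmaI)
    fix i
    have "((\<lambda>j. q ^ (i ^ 2 - i + e * i) / qpoch q q i * (q ^ (j choose 2) * (q ^ Suc i) ^ j / qpoch q q j))
            has_sum q ^ (i ^ 2 - i + e * i) / qpoch q q i * qpoch_inf (-(q ^ Suc i)) q) UNIV"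
      by (intro has_sum_cmult_right euler_has_sum q)
    also have "(\<lambda>j. q ^ (i ^ 2 - i + e * i) / qpoch q q i * (q ^ (j choose 2) * (q ^ Suc i) ^ j / qpoch q q j))
        = (\<lambda>j. case (i, j) of (i, j) \<Rightarrow> f i j)"
    proof
      fix j
      have expo: "i ^ 2 - i + e * i + i * j + ((j choose 2) + j) =
          (i ^ 2 - i + e * i) + ((j choose 2) + Suc i * j)"
        by simp
      show "q ^ (i ^ 2 - i + e * i) / qpoch q q i * (q ^ (j choose 2) * (q ^ Suc i) ^ j / qpoch q q j) =
          (case (i, j) of (i, j) \<Rightarrow> f i j)"
        unfolding f_def tri prod.case unfolding expo unfolding power_add power_mult
        by (simp add: power_mult_distrib mult_ac)
    qed
    finally show "((\<lambda>j. case (i, j) of (i, j) \<Rightarrow> f i j) has_sum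
       q ^ (i ^ 2 - i + e * i) / qpoch q q i * qpoch_inf (-(q ^ Suc i)) q) UNIV" .
  next
    have "((\<lambda>i. qpoch_inf (-q) q * ((q ^ 2) ^ (i choose 2) * (q ^ e) ^ i / qpoch (q ^ 2) (q ^ 2) i))
        has_sum qpoch_inf (-q) q * qpoch_inf (-(q ^ e)) (q ^ 2)) UNIV"
      by (intro has_sum_cmult_right euler_has_sum q2)
    also have "(\<lambda>i. qpoch_inf (-q) q * ((q ^ 2) ^ (i choose 2) * (q ^ e) ^ i / qpoch (q ^ 2) (q ^ 2) i))
       = (\<lambda>i. q ^ (i ^ 2 - i + e * i) / qpoch q q i * qpoch_inf (-(q ^ Suc i)) q)"
    proof
      fix i
      have "qpoch_inf (-q) q = qpoch (-q) q i * qpoch_inf (-(q ^ Suc i)) q"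
        using qpoch_inf_split[OF q, of "-q" i] by simp
      moreover have "qpoch (q ^ 2) (q ^ 2) i = qpoch q q i * qpoch (-q) q i"
        unfolding qpoch_def prod.distrib[symmetric]
        by (rule prod.cong) (simp_all add: algebra_simps power2_eq_square flip: power_mult_distrib)
      moreover have "qpoch (-q) q i \<noteq> 0"
        by (rule qpoch_neq_0_norm_less_1) (use q in auto)
      ultimately show "qpoch_inf (-q) q * ((q ^ 2) ^ (i choose 2) * (q ^ e) ^ i / qpoch (q ^ 2) (q ^ 2) i)
         = q ^ (i ^ 2 - i + e * i) / qpoch q q i * qpoch_inf (-(q ^ Suc i)) q"
        using qpoch_q_neq_0[OF q, of i] by (simp add: tri' power_add power_mult mult_ac)
    qed
    finally show "((\<lambda>i. q ^ (i ^ 2 - i + e * i) / qpoch q q i * qpoch_inf (-(q ^ Suc i)) q)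
       has_sum qpoch_inf (-q) q * qpoch_inf (-(q ^ e)) (q ^ 2)) UNIV" .
  next
    \<comment> \<open>For e = 0 the exponent i^2 - i vanishes at i = 0 and at i = 1, so comparison
      with the geometric series starts at i = 2.\<close>
    define g where "g i = norm q ^ (i ^ 2 - i)" for i :: nat
    have "g summable_on UNIV"
    proof -
      have "summable (\<lambda>i. norm (g i))"
      proof (rule summable_comparison_test'[where N = 2])
        show "summable (\<lambda>i. norm q ^ i)" using q by simp
        fix i :: nat assume "i \<ge> 2"
        hence "2 * i \<le> i * i" by simp
        hence "i \<le> i ^ 2 - i" unfolding power2_eq_square by linarith
        thus "norm (norm (g i)) \<le> norm q ^ i"
          unfolding g_def using q by (auto intro: power_decreasing)
      qed
      thus ?thesis by (rule norm_summable_imp_summable_on)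
    qed
    thus "(\<lambda>(i, j). f i j) summable_on UNIV \<times> UNIV"
    proof (rule summable_on_prod_comparison[where g = "\<lambda>j. norm q ^ j" and C = "C ^ 2"])
      fix i j
      have "norm (f i j) = norm q ^ (i ^ 2 - i + e * i + i * j + (j ^ 2 + j) div 2) *
             (norm (inverse (qpoch q q i)) * norm (inverse (qpoch q q j)))"
        by (simp add: f_def divide_inverse norm_mult norm_power norm_inverse)
      also have "\<dots> \<le> norm q ^ (i ^ 2 - i + j) * (C * C)"
        by (intro mult_mono C power_decreasing) (use q C in \<open>auto simp: tri intro: less_imp_le\<close>)
      finally show "norm (case (i, j) of (i, j) \<Rightarrow> f i j) \<le> C ^ 2 * (g i * norm q ^ j)"
        by (simp add: power2_eq_square[of C] g_def power_add mult_ac)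
    qed (use q in \<open>auto simp: g_def intro!: summable_on_power_nat\<close>)
  qed
  thus ?thesis by (simp add: f_def case_prod_unfold)
qed

text \<open>Summing over j gives (-q^(2(i+e)+1);q^2)_inf, a tail of (-q;q^2)_inf; dividing the full
  product by its first i + e factors produces the denominators of the single series in
  \<open>slater\<close>.\<close>

lemma nahm_sum_slater_has_sum:
  assumes q: "norm q < 1"
  assumes slater: "((\<lambda>i. (q ^ 2) ^ (i ^ 2 + e * i) *
      (1 / (qpoch (q ^ 2) (q ^ 2) i * qpoch (-q) (q ^ 2) (i + e)))) has_sum S) UNIV"
  shows "((\<lambda>(i, j). q ^ (2 * i ^ 2 + 2 * i * j + j ^ 2 + 2 * e * i + 2 * e * j) /
            (qpoch (q ^ 2) (q ^ 2) i * qpoch (q ^ 2) (q ^ 2) j))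
           has_sum qpoch_inf (-q) (q ^ 2) * S) UNIV"
proof -
  have q2: "norm (q ^ 2) < 1"
    using q by (simp add: norm_power_less_1)
  obtain C where C: "C > 0" "\<And>n. norm (inverse (qpoch (q ^ 2) (q ^ 2) n)) \<le> C"
    using qpoch_q_inverse_bounded[OF q2] by blast
  define f where "f i j = q ^ (2 * i ^ 2 + 2 * i * j + j ^ 2 + 2 * e * i + 2 * e * j) /
    (qpoch (q ^ 2) (q ^ 2) i * qpoch (q ^ 2) (q ^ 2) j)" for i j
  have "((\<lambda>(i, j). f i j) has_sum qpoch_inf (-q) (q ^ 2) * S) (UNIV \<times> UNIV)"
  proof (rule has_sum_SigmaI)
    fix i
    let ?c = "(q ^ 2) ^ (i ^ 2 + e * i) / qpoch (q ^ 2) (q ^ 2) i"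
    let ?z = "q * (q ^ 2) ^ (i + e)"
    have "((\<lambda>j. ?c * ((q ^ 2) ^ (j choose 2) * ?z ^ j / qpoch (q ^ 2) (q ^ 2) j))
            has_sum ?c * qpoch_inf (-?z) (q ^ 2)) UNIV"
      by (intro has_sum_cmult_right euler_has_sum q2)
    also have "(\<lambda>j. ?c * ((q ^ 2) ^ (j choose 2) * ?z ^ j / qpoch (q ^ 2) (q ^ 2) j))
        = (\<lambda>j. case (i, j) of (i, j) \<Rightarrow> f i j)"
    proof
      fix j
      have "2 * (j choose 2) + (2 * (i + e) + 1) * j + 2 * (i ^ 2 + e * i) =
            (2 * (j choose 2) + j) + 2 * (i + e) * j + 2 * (i ^ 2 + e * i)"
        by (simp add: algebra_simps)
      also have "\<dots> = 2 * i ^ 2 + 2 * i * j + j ^ 2 + 2 * e * i + 2 * e * j"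
        unfolding two_choose_2 by (simp add: algebra_simps)
      finally have expo: "2 * i ^ 2 + 2 * i * j + j ^ 2 + 2 * e * i + 2 * e * j =
          2 * (j choose 2) + (2 * (i + e) + 1) * j + 2 * (i ^ 2 + e * i)" ..
      have z: "?z = q ^ (2 * (i + e) + 1)"
        unfolding power_add power_mult power_one_right by (simp only: mult_ac)
      show "?c * ((q ^ 2) ^ (j choose 2) * ?z ^ j / qpoch (q ^ 2) (q ^ 2) j) = (case (i, j) of (i, j) \<Rightarrow> f i j)"
        unfolding f_def prod.case z unfolding expo unfolding power_add power_mult
        by (simp add: mult_ac)
    qed
    finally show "((\<lambda>j. case (i, j) of (i, j) \<Rightarrow> f i j) has_sum ?c * qpoch_inf (-?z) (q ^ 2)) UNIV" .
  next
    have "((\<lambda>i. qpoch_inf (-q) (q ^ 2) * ((q ^ 2) ^ (i ^ 2 + e * i) *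
      (1 / (qpoch (q ^ 2) (q ^ 2) i * qpoch (-q) (q ^ 2) (i + e))))) has_sum qpoch_inf (-q) (q ^ 2) * S) UNIV"
      by (intro has_sum_cmult_right slater)
    also have "(\<lambda>i. qpoch_inf (-q) (q ^ 2) * ((q ^ 2) ^ (i ^ 2 + e * i) *
        (1 / (qpoch (q ^ 2) (q ^ 2) i * qpoch (-q) (q ^ 2) (i + e))))) =
      (\<lambda>i. (q ^ 2) ^ (i ^ 2 + e * i) / qpoch (q ^ 2) (q ^ 2) i * qpoch_inf (-(q * (q ^ 2) ^ (i + e))) (q ^ 2))"
    proof
      fix i
      have "qpoch_inf (-q) (q ^ 2) =
          qpoch (-q) (q ^ 2) (i + e) * qpoch_inf (-(q * (q ^ 2) ^ (i + e))) (q ^ 2)"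
        using qpoch_inf_split[OF q2, of "-q" "i + e"] by simp
      moreover have "qpoch (-q) (q ^ 2) (i + e) \<noteq> 0"
        by (rule qpoch_neq_0_norm_less_1) (use q q2 in auto)
      ultimately show "qpoch_inf (-q) (q ^ 2) * ((q ^ 2) ^ (i ^ 2 + e * i) *
          (1 / (qpoch (q ^ 2) (q ^ 2) i * qpoch (-q) (q ^ 2) (i + e)))) =
        (q ^ 2) ^ (i ^ 2 + e * i) / qpoch (q ^ 2) (q ^ 2) i * qpoch_inf (-(q * (q ^ 2) ^ (i + e))) (q ^ 2)"
        by (simp del: power_mult_distrib)
    qed
    finally show "((\<lambda>i. (q ^ 2) ^ (i ^ 2 + e * i) / qpoch (q ^ 2) (q ^ 2) i *
      qpoch_inf (-(q * (q ^ 2) ^ (i + e))) (q ^ 2)) has_sum qpoch_inf (-q) (q ^ 2) * S) UNIV" .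
  next
    show "(\<lambda>(i, j). f i j) summable_on UNIV \<times> UNIV"
    proof (rule summable_on_prod_comparison[where f = "\<lambda>i. norm q ^ i" and g = "\<lambda>j. norm q ^ j"
          and C = "C ^ 2"])
      fix i j
      have sq: "n \<le> n ^ 2" for n :: nat
        by (cases n) (auto simp: power2_eq_square)
      have "norm (f i j) = norm q ^ (2 * i ^ 2 + 2 * i * j + j ^ 2 + 2 * e * i + 2 * e * j) *
             (norm (inverse (qpoch (q ^ 2) (q ^ 2) i)) * norm (inverse (qpoch (q ^ 2) (q ^ 2) j)))"
        by (simp add: f_def divide_inverse norm_mult norm_power norm_inverse)
      also have "\<dots> \<le> norm q ^ (i + j) * (C * C)"
      proof (intro mult_mono C power_decreasing)
        show "i + j \<le> 2 * i ^ 2 + 2 * i * j + j ^ 2 + 2 * e * i + 2 * e * j"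
          using sq[of i] sq[of j] by linarith
      qed (use q C in \<open>auto intro: less_imp_le\<close>)
      finally show "norm (case (i, j) of (i, j) \<Rightarrow> f i j) \<le> C ^ 2 * (norm q ^ i * norm q ^ j)"
        by (simp add: power2_eq_square[of C] power_add mult_ac)
    qed (use q in \<open>auto intro!: summable_on_power_nat\<close>)
  qed
  thus ?thesis by (simp add: f_def case_prod_unfold)
qed


section \<open>Infinite products and the five sum-product identities\<close>

lemma qpoch_inf_even_odd:
  fixes q :: complex
  assumes q: "norm q < 1" and k: "k > 0"
  shows "qpoch_inf (q ^ k) (q ^ k) = qpoch_inf (q ^ k) (q ^ (2 * k)) * qpoch_inf (q ^ (2 * k)) (q ^ (2 * k))"
  using qpoch_inf_dissect[OF norm_power_less_1[OF q k], of "q ^ k"]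
  by (simp add: mult.commute[of 2] flip: power_mult power_add mult_2_right)

lemma qpoch_inf_minus_q:
  assumes q: "norm q < 1"
  shows "qpoch_inf (-q) q = qpoch_inf (q ^ 2) (q ^ 2) / qpoch_inf q q"
  using qpoch_inf_mult_minus[OF q, of q] qpoch_inf_q_neq_0[OF q] by (simp add: field_simps)

text \<open>The classes 1, 3, 5, 7 modulo 8 make up (q;q^2)_inf, which together with (-q;q^2)_inf
  gives (q^2;q^4)_inf. Substituted for (q^2;q^2)_inf in a Slater sum, the formula cancels the two
  odd classes of the numerator and leaves the other two in the denominator.\<close>

lemma slater_product:
  assumes q: "norm q < 1"
  shows "qpoch_inf (-q) (q ^ 2) * (qpoch_inf q (q ^ 8) * qpoch_inf (q ^ 3) (q ^ 8) * qpoch_inf (q ^ 5) (q ^ 8) *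
           qpoch_inf (q ^ 7) (q ^ 8)) * (qpoch_inf (q ^ 4) (q ^ 8) * qpoch_inf (q ^ 8) (q ^ 8)) =
         qpoch_inf (q ^ 2) (q ^ 2)"
proof -
  note n = norm_power_less_1[OF q]
  have "qpoch_inf q (q ^ 2) = qpoch_inf q (q ^ 4) * qpoch_inf (q ^ 3) (q ^ 4)"
    using qpoch_inf_dissect[OF n[of 2], of q] by (simp flip: power_mult power_Suc)
  also have "qpoch_inf q (q ^ 4) = qpoch_inf q (q ^ 8) * qpoch_inf (q ^ 5) (q ^ 8)"
    using qpoch_inf_dissect[OF n[of 4], of q] by (simp flip: power_mult power_Suc)
  also have "qpoch_inf (q ^ 3) (q ^ 4) = qpoch_inf (q ^ 3) (q ^ 8) * qpoch_inf (q ^ 7) (q ^ 8)"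
    using qpoch_inf_dissect[OF n[of 4], of "q ^ 3"] by (simp flip: power_mult power_add)
  finally have 1: "qpoch_inf q (q ^ 8) * qpoch_inf (q ^ 3) (q ^ 8) * qpoch_inf (q ^ 5) (q ^ 8) *
           qpoch_inf (q ^ 7) (q ^ 8) = qpoch_inf q (q ^ 2)"
    by (simp add: mult_ac)
  have 2: "qpoch_inf (q ^ 4) (q ^ 8) * qpoch_inf (q ^ 8) (q ^ 8) = qpoch_inf (q ^ 4) (q ^ 4)"
    using qpoch_inf_even_odd[OF q, of 4] by simp
  have 3: "qpoch_inf (-q) (q ^ 2) * qpoch_inf q (q ^ 2) = qpoch_inf (q ^ 2) (q ^ 4)"
    using qpoch_inf_mult_minus[OF n[of 2], of q] by (simp add: mult_ac flip: power_mult)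
  show ?thesis
    unfolding 1 2 3 using qpoch_inf_even_odd[OF q, of 2] by simp
qed

lemma qpoch_inf_power_neq_0:
  assumes "norm q < 1" "k > 0" "l > 0"
  shows "qpoch_inf (q ^ k) (q ^ l) \<noteq> 0"
  by (rule qpoch_inf_neq_0_norm_less_1) (use assms in \<open>auto simp: norm_power_less_1\<close>)

lemma has_sum_delta_complex:
  assumes "f (0, 0) = 1" "\<And>x. x \<noteq> (0, 0) \<Longrightarrow> f x = 0"
  shows "(f has_sum (1::complex)) UNIV"
  by (rule has_sum_finite_neutralI[of "{(0, 0)}"]) (use assms in auto)

lemma nahm_identity_1:
  assumes q: "norm q < 1"
  shows "((\<lambda>(i::nat, j::nat). q ^ (i^2 - i + i*j + (j^2 + j) div 2) / (qpoch q q i * qpoch q q j))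
         has_sum 2 * (qpoch_inf (q^4) (q^4) / qpoch_inf q q)) UNIV"
proof -
  have q2: "norm (q ^ 2) < 1"
    using q by (simp add: norm_power_less_1)
  \<comment> \<open>The factor 2 of the identity is the leading factor 1 - (-1) of
    (-1;q^2)_inf.\<close>
  have "qpoch_inf (-1) (q ^ 2) = 2 * qpoch_inf (-(q ^ 2)) (q ^ 2)"
    by (subst qpoch_inf_rec[OF q2]) simp
  also have "\<dots> = 2 * (qpoch_inf (q ^ 4) (q ^ 4) / qpoch_inf (q ^ 2) (q ^ 2))"
    using qpoch_inf_minus_q[OF q2] by (simp flip: power_mult)
  finally have "qpoch_inf (-q) q * qpoch_inf (-(q ^ 0)) (q ^ 2) = 2 * (qpoch_inf (q^4) (q^4) / qpoch_inf q q)"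
    using q q2 by (simp add: qpoch_inf_minus_q)
  with nahm_sum_euler_has_sum[OF q, of 0] show ?thesis
    by simp
qed

lemma nahm_identity_2:
  assumes q: "norm q < 1"
  shows "((\<lambda>(i::nat, j::nat). q ^ (2*i^2 + 2*i*j + j^2) / (qpoch (q^2) (q^2) i * qpoch (q^2) (q^2) j))
         has_sum 1 / (qpoch_inf q (q^8) * qpoch_inf (q^4) (q^8) * qpoch_inf (q^7) (q^8))) UNIV"
\<comment> \<open>The Slater sums involve negative powers of p = -q and so assume p nonzero; at q =
  0 only the term (0, 0) remains.\<close>
proof (cases "q = 0")
  case True
  thus ?thesis by (auto intro!: has_sum_delta_complex)
next
  case False
  have "((\<lambda>n. (q ^ 2) ^ (n ^ 2 + 0 * n) * (1 / (qpoch (q ^ 2) (q ^ 2) n * qpoch (-q) (q ^ 2) (n + 0))))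
     has_sum qpoch_inf (q ^ 3) (q ^ 8) * qpoch_inf (q ^ 5) (q ^ 8) * qpoch_inf (q ^ 8) (q ^ 8)
       / qpoch_inf (q ^ 2) (q ^ 2)) UNIV"
    using slater_even_has_sum[of "-q"] q False by simp
  note sum = nahm_sum_slater_has_sum[OF q this]
  have "qpoch_inf (-q) (q ^ 2) * (qpoch_inf (q ^ 3) (q ^ 8) * qpoch_inf (q ^ 5) (q ^ 8) * qpoch_inf (q ^ 8) (q ^ 8)
       / qpoch_inf (q ^ 2) (q ^ 2)) = 1 / (qpoch_inf q (q^8) * qpoch_inf (q^4) (q^8) * qpoch_inf (q^7) (q^8))"
    unfolding slater_product[OF q, symmetric]
    using qpoch_inf_power_neq_0[OF q _ zero_less_numeral] qpoch_inf_power_neq_0[OF q, of 1 8]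
      qpoch_inf_neq_0_norm_less_1[OF norm_power_less_1[OF q, of 2], of "-q"] q
    by simp
  with sum show ?thesis
    by simp
qed

lemma nahm_identity_3:
  assumes q: "norm q < 1"
  shows "((\<lambda>(i::nat, j::nat). q ^ (i^2 + i*j + (j^2 + j) div 2) / (qpoch q q i * qpoch q q j))
         has_sum (qpoch_inf (q^2) (q^2))^3 / ((qpoch_inf q q)^2 * qpoch_inf (q^4) (q^4))) UNIV"
proof -
  have q2: "norm (q ^ 2) < 1"
    using q by (simp add: norm_power_less_1)
  have "qpoch_inf (-q) q = qpoch_inf (-q) (q ^ 2) * qpoch_inf (-(q ^ 2)) (q ^ 2)"
    using qpoch_inf_dissect[OF q, of "-q"] by (simp add: power2_eq_square)
  also have "qpoch_inf (-(q ^ 2)) (q ^ 2) = qpoch_inf (q ^ 4) (q ^ 4) / qpoch_inf (q ^ 2) (q ^ 2)"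
    using qpoch_inf_minus_q[OF q2] by (simp flip: power_mult)
  finally have "qpoch_inf (-q) q * qpoch_inf (-(q ^ 1)) (q ^ 2) = 
      (qpoch_inf (q^2) (q^2))^3 / ((qpoch_inf q q)^2 * qpoch_inf (q^4) (q^4))"
    using q q2 by (simp add: qpoch_inf_minus_q norm_power_less_1 field_simps power2_eq_square power3_eq_cube)
  moreover have "i ^ 2 - i + 1 * i = i ^ 2" for i :: nat
    by (cases i) (auto simp: power2_eq_square)
  ultimately show ?thesis
    using nahm_sum_euler_has_sum[OF q, of 1] by simp
qed

lemma nahm_identity_4:
  assumes q: "norm q < 1"
  shows "((\<lambda>(i::nat, j::nat). q ^ (i^2 + i*j + (j^2 + j) div 2 + i) / (qpoch q q i * qpoch q q j))
         has_sum qpoch_inf (q^4) (q^4) / qpoch_inf q q) UNIV"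
proof -
  have q2: "norm (q ^ 2) < 1"
    using q by (simp add: norm_power_less_1)
  have "qpoch_inf (-(q ^ 2)) (q ^ 2) = qpoch_inf (q ^ 4) (q ^ 4) / qpoch_inf (q ^ 2) (q ^ 2)"
    using qpoch_inf_minus_q[OF q2] by (simp flip: power_mult)
  hence "qpoch_inf (-q) q * qpoch_inf (-(q ^ 2)) (q ^ 2) = qpoch_inf (q^4) (q^4) / qpoch_inf q q"
    using q q2 by (simp add: qpoch_inf_minus_q)
  moreover have "i ^ 2 - i + 2 * i + i * j + k = i ^ 2 + i * j + k + i" for i j k :: nat
    by (cases i) (auto simp: power2_eq_square)
  ultimately show ?thesis
    using nahm_sum_euler_has_sum[OF q, of 2] by (simp only:)
qed

lemma nahm_identity_5:
  assumes q: "norm q < 1"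
  shows "((\<lambda>(i::nat, j::nat). q ^ (2*i^2 + 2*i*j + j^2 + 2*i + 2*j)
                               / (qpoch (q^2) (q^2) i * qpoch (q^2) (q^2) j))
         has_sum 1 / (qpoch_inf (q^3) (q^8) * qpoch_inf (q^4) (q^8) * qpoch_inf (q^5) (q^8))) UNIV"
proof (cases "q = 0")
  case True
  thus ?thesis by (auto intro!: has_sum_delta_complex)
next
  case False
  have "((\<lambda>n. (q ^ 2) ^ (n ^ 2 + 1 * n) * (1 / (qpoch (q ^ 2) (q ^ 2) n * qpoch (-q) (q ^ 2) (n + 1))))
     has_sum qpoch_inf (q ^ 7) (q ^ 8) * qpoch_inf q (q ^ 8) * qpoch_inf (q ^ 8) (q ^ 8)
       / qpoch_inf (q ^ 2) (q ^ 2)) UNIV"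
    using slater_odd_has_sum[of "-q"] q False by simp
  note sum = nahm_sum_slater_has_sum[OF q this]
  have "qpoch_inf (-q) (q ^ 2) * (qpoch_inf (q ^ 7) (q ^ 8) * qpoch_inf q (q ^ 8) * qpoch_inf (q ^ 8) (q ^ 8)
       / qpoch_inf (q ^ 2) (q ^ 2)) = 1 / (qpoch_inf (q^3) (q^8) * qpoch_inf (q^4) (q^8) * qpoch_inf (q^5) (q^8))"
    unfolding slater_product[OF q, symmetric]
    using qpoch_inf_power_neq_0[OF q _ zero_less_numeral] qpoch_inf_power_neq_0[OF q, of 1 8]
      qpoch_inf_neq_0_norm_less_1[OF norm_power_less_1[OF q, of 2], of "-q"] q
    by simp
  with sum show ?thesis
    by simp
qed

section \<open>The theta function and Klein forms\<close>

text \<open>On a closed ball compactness bounds the base by some R < 1 and the first argument by B,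
  so the n-th factor differs from 1 by at most B R^n and the partial products converge
  uniformly.\<close>

lemma holomorphic_on_qpoch_inf:
  assumes S: "open S" and f: "f holomorphic_on S" and g: "g holomorphic_on S"
    and lt: "\<And>z. z \<in> S \<Longrightarrow> norm (g z) < 1"
  shows "(\<lambda>z. qpoch_inf (f z) (g z)) holomorphic_on S"
proof (rule holomorphic_uniform_sequence[OF S])
  show "(\<lambda>z. qpoch (f z) (g z) n) holomorphic_on S" for n
    unfolding qpoch_def by (intro holomorphic_intros f g)
  fix z assume "z \<in> S"
  then obtain d where d: "d > 0" "cball z d \<subseteq> S"
    using S open_contains_cball by blast
  let ?A = "cball z d"
  have cont: "continuous_on ?A f" "continuous_on ?A g"
    using f g d holomorphic_on_imp_continuous_on holomorphic_on_subset by blast+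
  obtain B where B: "\<And>w. w \<in> ?A \<Longrightarrow> norm (f w) \<le> B"
    using compact_imp_bounded[OF compact_continuous_image[OF cont(1) compact_cball]]
    unfolding bounded_iff by blast
  have "compact ((\<lambda>w. norm (g w)) ` ?A)" "(\<lambda>w. norm (g w)) ` ?A \<noteq> {}"
    using cont d by (auto intro!: compact_continuous_image continuous_intros)
  then obtain w0 where w0: "w0 \<in> ?A" "\<And>w. w \<in> ?A \<Longrightarrow> norm (g w) \<le> norm (g w0)"
    using compact_attains_sup[of "(\<lambda>w. norm (g w)) ` ?A"] by auto
  define R where "R = norm (g w0)"
  have R: "0 \<le> R" "R < 1"
    using lt[of w0] w0(1) d by (auto simp: R_def)
  have "uniformly_convergent_on ?A (\<lambda>N w. \<Sum>n<N. norm ((1 - f w * g w ^ n) - 1))"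
  proof (rule Weierstrass_m_test')
    show "norm (norm ((1 - f w * g w ^ n) - 1)) \<le> B * R ^ n" if "w \<in> ?A" for n w
      using B[OF that] w0(2)[OF that] order.trans[OF norm_ge_zero B[OF that]]
      by (auto simp: norm_mult norm_power R_def intro!: mult_mono power_mono)
    show "summable (\<lambda>n. B * R ^ n)"
      using R by (intro summable_mult summable_geometric) auto
  qed
  hence "uniformly_convergent_on ?A (\<lambda>N w. \<Prod>n<N. 1 - f w * g w ^ n)"
    by (intro uniformly_convergent_on_prod' continuous_intros cont) auto
  then obtain l where l: "uniform_limit ?A (\<lambda>N w. qpoch (f w) (g w) N) l sequentially"
    unfolding uniformly_convergent_on_def qpoch_def by blast
  have "l w = qpoch_inf (f w) (g w)" if "w \<in> ?A" for w
    using LIMSEQ_unique[OF tendsto_uniform_limitI[OF l that] qpoch_tendsto] lt d that by blast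
  hence "uniform_limit ?A (\<lambda>N w. qpoch (f w) (g w) N) (\<lambda>w. qpoch_inf (f w) (g w)) sequentially"
    using uniform_limit_cong'[of ?A] l by (metis (no_types, lifting))
  with d show "\<exists>d>0. cball z d \<subseteq> S \<and>
      uniform_limit (cball z d) (\<lambda>n z. qpoch (f z) (g z) n) (\<lambda>z. qpoch_inf (f z) (g z)) sequentially"
    by blast
qed

section \<open>The theta function: quasi-periods and zeros\<close>

definition qexp :: "complex \<Rightarrow> complex" where
  "qexp z = exp (2 * of_real pi * \<i> * z)"

lemma qexp_0 [simp]: "qexp 0 = 1"
  by (simp add: qexp_def)

lemma qexp_neq_0 [simp]: "qexp z \<noteq> 0"
  by (simp add: qexp_def)

lemma qexp_add: "qexp (w + z) = qexp w * qexp z"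
  by (simp add: qexp_def exp_add ring_distribs)

lemma qexp_minus: "qexp (-z) = inverse (qexp z)"
  by (simp add: qexp_def exp_minus)

lemma qexp_diff: "qexp (w - z) = qexp w / qexp z"
  by (simp add: qexp_def exp_diff ring_distribs)

lemma qexp_of_nat_mult: "qexp (of_nat n * z) = qexp z ^ n"
  by (simp add: qexp_def exp_of_nat_mult[symmetric] mult_ac)

lemma norm_qexp: "norm (qexp z) = exp (-(2 * pi * Im z))"
  by (simp add: qexp_def)

lemma norm_qexp_less_1: "Im z > 0 \<Longrightarrow> norm (qexp z) < 1"
  by (simp add: norm_qexp)

lemma qexp_eq_1_iff: "qexp z = 1 \<longleftrightarrow> z \<in> \<int>"
proof
  assume "qexp z = 1"
  then obtain n :: int where n: "- (2 * pi * Im z) = 0" "2 * pi * Re z = of_int (2 * n) * pi"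
    by (auto simp: qexp_def exp_eq_1)
  hence "z = of_int n"
    by (auto simp: complex_eq_iff)
  thus "z \<in> \<int>" by simp
next
  assume "z \<in> \<int>"
  then obtain n where "z = of_int n" by (auto elim: Ints_cases)
  thus "qexp z = 1"
    unfolding qexp_def exp_eq_1 by (auto intro!: exI[of _ n])
qed

lemma qexp_of_int [simp]: "qexp (of_int n) = 1"
  by (simp add: qexp_eq_1_iff)

lemma holomorphic_on_qexp [holomorphic_intros]:
  "f holomorphic_on A \<Longrightarrow> (\<lambda>z. qexp (f z)) holomorphic_on A"
  unfolding qexp_def by (intro holomorphic_intros)

text \<open>Up to a constant this is Jacobi's theta_1 with its z-independent factor q^(1/8)
  (q;q)_inf removed, so that only Pochhammer symbols of the kind found in the product sides
  remain.\<close>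

definition theta :: "complex \<Rightarrow> complex \<Rightarrow> complex" where
  "theta z \<tau> = qexp (-z / 2) * qpoch_inf (qexp z) (qexp \<tau>) * qpoch_inf (qexp (\<tau> - z)) (qexp \<tau>)"

lemma holomorphic_on_theta:
  assumes "open S" "f holomorphic_on S" "g holomorphic_on S" "\<And>z. z \<in> S \<Longrightarrow> Im (g z) > 0"
  shows "(\<lambda>z. theta (f z) (g z)) holomorphic_on S"
  unfolding theta_def
  by (intro holomorphic_intros holomorphic_on_qpoch_inf) (use assms in \<open>auto intro: norm_qexp_less_1\<close>)

lemma theta_add_of_int: "theta (z + of_int n) \<tau> = qexp (of_int n / 2) * theta z \<tau>"
proof -
  have "qexp (-(z + of_int n) / 2) = qexp (-z / 2 + of_int n / 2 + of_int (-n))"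
    by (simp add: field_simps)
  also have "\<dots> = qexp (-z / 2) * qexp (of_int n / 2)"
    by (simp only: qexp_add qexp_of_int mult_1_right)
  finally have 1: "qexp (-(z + of_int n) / 2) = qexp (-z / 2) * qexp (of_int n / 2)" .
  have 2: "qexp (z + of_int n) = qexp z" "qexp (\<tau> - (z + of_int n)) = qexp (\<tau> - z)"
    by (simp_all add: qexp_add qexp_diff)
  show ?thesis
    unfolding theta_def 1 2 by (simp add: mult_ac)
qed

lemma theta_add_tau:
  assumes \<tau>: "Im \<tau> > 0"
  shows "theta (z + \<tau>) \<tau> = qexp (1/2 - z - \<tau> / 2) * theta z \<tau>"
proof -
  let ?q = "qexp \<tau>"
  have q: "norm ?q < 1"
    using \<tau> by (rule norm_qexp_less_1)
  have half: "qexp (1/2) = -1"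
    by (simp add: qexp_def)
  have 1: "qpoch_inf (qexp z) ?q = (1 - qexp z) * qpoch_inf (qexp (z + \<tau>)) ?q"
    using qpoch_inf_rec[OF q, of "qexp z"] by (simp add: qexp_add)
  have 2: "qpoch_inf (qexp (-z)) ?q = (1 - qexp (-z)) * qpoch_inf (qexp (\<tau> - z)) ?q"
    using qpoch_inf_rec[OF q, of "qexp (-z)"] by (simp add: qexp_diff qexp_minus field_simps)
  have 3: "qexp (1/2 - z - \<tau> / 2) = - qexp (-\<tau> / 2) * qexp (-z)"
  proof -
    have "1/2 - z - \<tau> / 2 = 1/2 + (-\<tau> / 2) + (-z)"
      by simp
    thus ?thesis
      by (simp only: qexp_add half mult_minus1)
  qed
  have 4: "qexp (-(z + \<tau>) / 2) = qexp (-z / 2) * qexp (-\<tau> / 2)"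
    by (simp add: field_simps flip: qexp_add)
  have 5: "-(qexp (-z) * (1 - qexp z)) = 1 - qexp (-z)"
    by (simp add: qexp_minus field_simps)
  have "theta (z + \<tau>) \<tau> = qexp (-z / 2) * qexp (-\<tau> / 2) * qpoch_inf (qexp (z + \<tau>)) ?q *
      (1 - qexp (-z)) * qpoch_inf (qexp (\<tau> - z)) ?q"
    unfolding theta_def 4 using 2 by (simp add: mult_ac)
  also have "\<dots> = qexp (1/2 - z - \<tau> / 2) * theta z \<tau>"
    unfolding 5[symmetric] theta_def 1 3 by (simp add: mult_ac)
  finally show ?thesis .
qed

text \<open>The two Pochhammer symbols share out the lattice: the first vanishes at the points
  m\<tau> + n with m \<le> 0, the second at those with m > 0.\<close>

lemma theta_eq_0_iff:
  assumes \<tau>: "Im \<tau> > 0"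
  shows "theta z \<tau> = 0 \<longleftrightarrow> (\<exists>m n::int. z = of_int m * \<tau> + of_int n)"
proof -
  have q: "norm (qexp \<tau>) < 1"
    using \<tau> by (rule norm_qexp_less_1)
  have "theta z \<tau> = 0 \<longleftrightarrow> (\<exists>k::nat. qexp (z + of_nat k * \<tau>) = 1) \<or>
      (\<exists>k::nat. qexp (of_nat (Suc k) * \<tau> - z) = 1)"
    unfolding theta_def
    by (simp add: qpoch_inf_eq_0_iff[OF q] qexp_add qexp_diff qexp_of_nat_mult ring_distribs)
  also have "\<dots> \<longleftrightarrow> (\<exists>m n::int. z = of_int m * \<tau> + of_int n)" (is "?L \<longleftrightarrow> ?R")
  proof
    assume ?L
    thus ?R
    proof (elim disjE exE)
      fix k :: nat assume "qexp (z + of_nat k * \<tau>) = 1"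
      then obtain n where "z + of_nat k * \<tau> = of_int n"
        by (auto simp: qexp_eq_1_iff elim: Ints_cases)
      hence "z = of_int (- int k) * \<tau> + of_int n"
        by (simp add: algebra_simps)
      thus ?R by blast
    next
      fix k :: nat assume "qexp (of_nat (Suc k) * \<tau> - z) = 1"
      then obtain n where "of_nat (Suc k) * \<tau> - z = of_int n"
        by (auto simp: qexp_eq_1_iff elim: Ints_cases)
      hence "z = of_int (int (Suc k)) * \<tau> + of_int (-n)"
        by (simp add: algebra_simps)
      thus ?R by blast
    qed
  next
    assume ?R
    then obtain m n :: int where z: "z = of_int m * \<tau> + of_int n" by blast
    show ?L
    proof (cases "m \<le> 0")
      case True
      hence "z + of_nat (nat (-m)) * \<tau> = of_int n"
        by (simp add: z)
      thus ?thesis by (metis qexp_of_int)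
    next
      case False
      hence "of_nat (Suc (nat (m - 1))) * \<tau> - z = of_int (-n)"
        by (simp add: z algebra_simps)
      thus ?thesis by (metis qexp_of_int)
    qed
  qed
  finally show ?thesis .
qed

section \<open>Klein forms under translation of the characteristic\<close>

text \<open>Up to the factor \<open>\<theta>'(0)\<close>, this is the Klein form with characteristic \<open>(x, y)\<close>.  The
  exponential prefactor makes the multipliers under \<open>\<int>\<^sup>2\<close>-translations of the characteristic
  constants, and these constants are invariant under \<open>SL\<^sub>2(\<int>)\<close>.\<close>

definition klein :: "real \<Rightarrow> real \<Rightarrow> complex \<Rightarrow> complex" where
  "klein x y \<tau> = qexp (of_real x * (of_real x * \<tau> + of_real y) / 2) * theta (of_real x * \<tau> + of_real y) \<tau>"

lemma klein_shift_y: "klein x (y + of_int n) \<tau> = qexp (of_int n * (1 + of_real x) / 2) * klein x y \<tau>"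
proof -
  have 1: "of_real x * \<tau> + of_real (y + of_int n) = (of_real x * \<tau> + of_real y) + of_int n"
    by simp
  have 2: "of_real x * (of_real x * \<tau> + of_real y + of_int n) / 2 + of_int n / 2 =
     of_int n * (1 + of_real x) / 2 + of_real x * (of_real x * \<tau> + of_real y) / (2::complex)"
    by (simp add: field_simps)
  have "klein x (y + of_int n) \<tau> = qexp (of_real x * (of_real x * \<tau> + of_real y + of_int n) / 2 + of_int n / 2)
      * theta (of_real x * \<tau> + of_real y) \<tau>"
    unfolding klein_def 1 theta_add_of_int by (simp add: qexp_add)
  thus ?thesis
    unfolding 2 klein_def by (simp add: qexp_add)
qed

lemma klein_shift_x_1:
  assumes \<tau>: "Im \<tau> > 0"
  shows "klein (x + 1) y \<tau> = qexp ((1 - of_real y) / 2) * klein x y \<tau>"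
proof -
  let ?z = "of_real x * \<tau> + of_real y"
  have 1: "of_real (x + 1) * \<tau> + of_real y = ?z + \<tau>"
    by (simp add: algebra_simps)
  have 2: "of_real (x + 1) * (?z + \<tau>) / 2 + (1/2 - ?z - \<tau> / 2) =
      (1 - of_real y) / 2 + of_real x * ?z / 2"
    by (simp add: field_simps)
  have "klein (x + 1) y \<tau> = qexp (of_real (x + 1) * (?z + \<tau>) / 2 + (1/2 - ?z - \<tau> / 2)) * theta ?z \<tau>"
    unfolding klein_def 1 theta_add_tau[OF \<tau>] by (simp only: qexp_add mult.assoc)
  thus ?thesis
    unfolding 2 klein_def by (simp only: qexp_add mult.assoc)
qed

lemma klein_shift_x:
  assumes \<tau>: "Im \<tau> > 0"
  shows "klein (x + of_int m) y \<tau> = qexp (of_int m * (1 - of_real y) / 2) * klein x y \<tau>"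
proof (induction m rule: int_induct[of _ 0])
  case (step1 i)
  have "klein (x + of_int (i + 1)) y \<tau> = klein ((x + of_int i) + 1) y \<tau>"
    by (simp add: add_ac)
  also have "\<dots> = qexp ((1 - of_real y) / 2 + of_int i * (1 - of_real y) / 2) * klein x y \<tau>"
    unfolding klein_shift_x_1[OF \<tau>] step1 by (simp add: qexp_add)
  also have "(1 - of_real y) / 2 + of_int i * (1 - of_real y) / 2 =
      of_int (i + 1) * (1 - of_real y) / (2 :: complex)"
    by (simp add: field_simps)
  finally show ?case .
next
  case (step2 i)
  have "qexp ((1 - of_real y) / 2) * klein (x + of_int (i - 1)) y \<tau> = klein ((x + of_int (i - 1)) + 1) y \<tau>"
    unfolding klein_shift_x_1[OF \<tau>] ..
  also have "\<dots> = klein (x + of_int i) y \<tau>"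
    by simp
  also have "\<dots> = qexp (of_int i * (1 - of_real y) / 2) * klein x y \<tau>"
    by (rule step2)
  also have "of_int i * (1 - of_real y) / 2 =
      (1 - of_real y) / 2 + of_int (i - 1) * (1 - of_real y) / (2 :: complex)"
    by (simp add: field_simps)
  finally show ?case
    unfolding qexp_add mult.assoc by simp
qed simp_all

definition klein_mult :: "int \<Rightarrow> int \<Rightarrow> real \<Rightarrow> real \<Rightarrow> complex" where
  "klein_mult m n x y =
     qexp (of_real ((of_int m + of_int n - of_int (m * n) + of_int n * x - of_int m * y) / 2))"

lemma klein_shift:
  assumes \<tau>: "Im \<tau> > 0"
  shows "klein (x + of_int m) (y + of_int n) \<tau> = klein_mult m n x y * klein x y \<tau>"
proof -
  have "klein (x + of_int m) (y + of_int n) \<tau> =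
      qexp (of_int m * (1 - of_real (y + of_int n)) / 2 + of_int n * (1 + of_real x) / 2) * klein x y \<tau>"
    unfolding klein_shift_x[OF \<tau>] unfolding klein_shift_y by (simp add: qexp_add)
  also have "of_int m * (1 - of_real (y + of_int n)) / 2 + of_int n * (1 + of_real x) / 2 =
      (of_real ((of_int m + of_int n - of_int (m * n) + of_int n * x - of_int m * y) / 2) :: complex)"
    by (simp add: field_simps)
  finally show ?thesis
    unfolding klein_mult_def .
qed


text \<open>The term n x - m y is a determinant, hence unchanged when both vectors are multiplied by
  a matrix of determinant 1. The term m + n - m n matters only modulo 2; it is even exactly when m
  and n both are, a property preserved by matrices invertible modulo 2.\<close>

lemma klein_mult_SL2:
  fixes x y :: real
  assumes "a * d - b * c = (1::int)"
  shows "klein_mult (d * m - c * n) (- b * m + a * n) (of_int d * x - of_int c * y) (- of_int b * x + of_int a * y) = klein_mult m n x y"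
proof -
  let ?m = "d * m - c * n" and ?n = "- b * m + a * n"
  have "of_int ?n * (of_int d * x - of_int c * y) - of_int ?m * (- of_int b * x + of_int a * y) = of_int (a * d - b * c) * (of_int n * x - of_int m * y)"
    by (simp add: algebra_simps)
  hence eq: "of_int ?n * (of_int d * x - of_int c * y) - of_int ?m * (- of_int b * x + of_int a * y) = of_int n * x - of_int m * y"
    unfolding assms by simp
  have "even (?m + ?n - ?m * ?n - (m + n - m * n))"
  proof -
    have "a * d = b * c + 1"
      using assms by simp
    hence "odd (a * d) \<noteq> odd (b * c)"
      by simp
    thus ?thesis by (auto simp: even_add even_mult_iff)
  qed
  then obtain k where k: "?m + ?n - ?m * ?n = m + n - m * n + 2 * k"
    by (metis add.commute diff_add_cancel evenE)
  have "(of_int ?m + of_int ?n - of_int (?m * ?n) + of_int ?n * (of_int d * x - of_int c * y) - of_int ?m * (- of_int b * x + of_int a * y)) / 2 =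
        (of_int (?m + ?n - ?m * ?n) + (of_int ?n * (of_int d * x - of_int c * y) - of_int ?m * (- of_int b * x + of_int a * y))) / 2"
    by simp
  also have "\<dots> = (of_int m + of_int n - of_int (m * n) + of_int n * x - of_int m * y) / 2 + of_int k"
    unfolding eq k by (simp add: field_simps)
  finally show ?thesis
    unfolding klein_mult_def by (simp only: of_real_add of_real_of_int_eq qexp_add qexp_of_int mult_1_right)
qed

section \<open>Transformation of Klein forms under SL2(Z)\<close>

lemma Im_moebius:
  assumes "a * d - b * c = (1::int)"
  shows "Im ((of_int a * \<tau> + of_int b) / (of_int c * \<tau> + of_int d)) =
           Im \<tau> / norm (of_int c * \<tau> + of_int d) ^ 2"
proof -
  have "real_of_int (a * d - b * c) = 1"
    unfolding assms by simp
  hence "real_of_int a * of_int d = 1 + of_int b * of_int c"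
    by simp
  hence "of_int a * Im \<tau> * (of_int c * Re \<tau> + of_int d) - (of_int a * Re \<tau> + of_int b) * (of_int c * Im \<tau>) = Im \<tau>"
    by (simp add: algebra_simps)
  thus ?thesis
    by (simp add: Im_divide cmod_power2)
qed

lemma moebius_denom_neq_0:
  assumes "a * d - b * c = (1::int)" "Im \<tau> > 0"
  shows "of_int c * \<tau> + of_int d \<noteq> 0"
proof
  assume *: "of_int c * \<tau> + of_int d = 0"
  hence "of_int c * Im \<tau> = 0"
    by (simp add: complex_eq_iff)
  hence "c = 0" using assms by simp
  with * assms show False by simp
qed

lemma Im_moebius_pos:
  assumes "a * d - b * c = (1::int)" "Im \<tau> > 0"
  shows "Im ((of_int a * \<tau> + of_int b) / (of_int c * \<tau> + of_int d)) > 0"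
  using moebius_denom_neq_0[OF assms] assms by (simp add: Im_moebius)

lemma real_coordinates:
  assumes "Im \<tau> > 0"
  obtains x y where "z = of_real x * \<tau> + of_real y"
proof
  show "z = of_real (Im z / Im \<tau>) * \<tau> + of_real (Re z - Im z / Im \<tau> * Re \<tau>)"
    using assms by (simp add: complex_eq_iff)
qed

text \<open>Periodicity confines the values to those on the compact parallelogram \<open>K\<close>,
  so the function is bounded and Liouville's theorem applies.\<close>

lemma elliptic_const:
  fixes h :: "complex \<Rightarrow> complex"
  assumes \<tau>: "Im \<tau> > 0" and hol: "h holomorphic_on UNIV"
    and per: "\<And>z m n. h (z + (of_int m * \<tau> + of_int n)) = h z"
  shows "\<exists>C. \<forall>z. h z = C"
proof -
  define K where "K = (\<lambda>(s, t). of_real s * \<tau> + of_real t) ` ({0..1::real} \<times> {0..1::real})"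
  have "compact K"
    unfolding K_def case_prod_unfold
    by (intro compact_continuous_image continuous_intros compact_Times compact_Icc)
  hence bdd: "bounded (h ` K)"
    by (intro compact_imp_bounded compact_continuous_image
        holomorphic_on_imp_continuous_on holomorphic_on_subset[OF hol]) auto
  have "range h \<subseteq> h ` K"
  proof safe
    fix z
    obtain x y where z: "z = of_real x * \<tau> + of_real y"
      using real_coordinates[OF \<tau>] by blast
    let ?k = "of_real (frac x) * \<tau> + of_real (frac y)"
    have "z = ?k + (of_int \<lfloor>x\<rfloor> * \<tau> + of_int \<lfloor>y\<rfloor>)"
      by (simp add: z frac_def algebra_simps)
    hence "h z = h ?k"
      using per by metis
    moreover have "?k \<in> K"
      unfolding K_def by (rule image_eqI[of _ _ "(frac x, frac y)"]) (auto intro: less_imp_le frac_lt_1)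
    ultimately show "h z \<in> h ` K" by blast
  qed
  hence "bounded (range h)"
    using bdd bounded_subset by blast
  from Liouville_theorem[OF hol this] show ?thesis
    by (auto simp: constant_on_def)
qed

text \<open>The zeros of \<open>G = \<theta>(\<cdot>, \<tau>)\<close> are simple, so a quotient \<open>F/G\<close> with the same multipliers
  and with \<open>F\<close> vanishing at these zeros is entire and doubly periodic.\<close>

lemma theta_quotient_const:
  assumes \<tau>: "Im \<tau> > 0"
  assumes F: "F holomorphic_on UNIV"
  assumes zero: "\<And>m n. F (of_int m * \<tau> + of_int n) = 0"
  assumes per: "\<And>z m n. F (z + (of_int m * \<tau> + of_int n)) * theta z \<tau> =
                           F z * theta (z + (of_int m * \<tau> + of_int n)) \<tau>"
  shows "\<exists>C. \<forall>z. F z = C * theta z \<tau>"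
proof -
  define G where "G z = theta z \<tau>" for z
  define L where "L = {of_int m * \<tau> + of_int n |m n :: int. True}"
  have G: "G holomorphic_on UNIV"
    unfolding G_def by (intro holomorphic_on_theta holomorphic_intros) (use \<tau> in auto)
  have G0: "G z = 0 \<longleftrightarrow> z \<in> L" for z
    unfolding G_def L_def theta_eq_0_iff[OF \<tau>] by auto
  have L_shift: "z + (of_int m * \<tau> + of_int n) \<in> L \<longleftrightarrow> z \<in> L" for z and m n :: int
  proof
    assume "z \<in> L"
    then obtain k l where "z = of_int k * \<tau> + of_int l"
      unfolding L_def by blast
    hence "z + (of_int m * \<tau> + of_int n) = of_int (k + m) * \<tau> + of_int (l + n)"
      by (simp add: algebra_simps)
    thus "z + (of_int m * \<tau> + of_int n) \<in> L"
      unfolding L_def by blast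
  next
    assume "z + (of_int m * \<tau> + of_int n) \<in> L"
    then obtain k l where "z + (of_int m * \<tau> + of_int n) = of_int k * \<tau> + of_int l"
      unfolding L_def by blast
    hence "z = of_int (k - m) * \<tau> + of_int (l - n)"
      by (simp add: algebra_simps)
    thus "z \<in> L"
      unfolding L_def by blast
  qed
  have L0: "0 \<in> L"
    unfolding L_def by (auto intro!: exI[of _ 0])
  have F0: "F 0 = 0"
    using zero[of 0 0] by simp
  have deriv_G0: "deriv G 0 \<noteq> 0"
  proof -
    \<comment> \<open>Only the factor 1 - e(z) vanishes at 0; splitting it off shows that the zero
      is simple.\<close>
    define R where "R z = qexp (-z / 2) * qpoch_inf (qexp z * qexp \<tau>) (qexp \<tau>) *
      qpoch_inf (qexp (\<tau> - z)) (qexp \<tau>)" for z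
    have q: "norm (qexp \<tau>) < 1"
      by (rule norm_qexp_less_1) (rule \<tau>)
    have "G z = (1 - qexp z) * R z" for z
      unfolding G_def theta_def R_def using qpoch_inf_rec[OF q, of "qexp z"] by simp
    hence G_eq: "G = (\<lambda>z. (1 - qexp z) * R z)" by blast
    have "R holomorphic_on UNIV"
      unfolding R_def
      by (intro holomorphic_intros holomorphic_on_qpoch_inf) (use q in auto)
    hence "R field_differentiable at 0"
      using holomorphic_on_imp_differentiable_at by blast
    then obtain R' where R': "(R has_field_derivative R') (at 0)"
      unfolding field_differentiable_def by blast
    have "((\<lambda>z. 1 - qexp z) has_field_derivative (- 2 * of_real pi * \<i>)) (at 0)"
      unfolding qexp_def by (auto intro!: derivative_eq_intros)
    from DERIV_mult[OF this R'] have "(G has_field_derivative (- 2 * of_real pi * \<i> * R 0)) (at 0)"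
      unfolding G_eq by simp
    moreover have "R 0 \<noteq> 0"
      unfolding R_def using q by (simp add: qpoch_inf_neq_0_norm_less_1)
    ultimately show ?thesis
      by (simp add: DERIV_imp_deriv)
  qed
  \<comment> \<open>On the lattice the value is the limit of F/G at 0; periodicity carries it to all
    other lattice points.\<close>
  define h where "h z = (if z \<in> L then deriv F 0 / deriv G 0 else F z / G z)" for z
  have h_per: "h (z + (of_int m * \<tau> + of_int n)) = h z" for z m n
  proof (cases "z \<in> L")
    case False
    thus ?thesis
      using per[of z m n] G0[of z] G0[of "z + (of_int m * \<tau> + of_int n)"]
      unfolding h_def L_shift by (simp add: G_def frac_eq_eq)
  qed (simp add: h_def L_shift)
  have h_0: "h field_differentiable at 0"
  proof -
    \<comment> \<open>The difference quotients extend holomorphically over 0, and \<open>h\<close>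
      equals \<open>F1 / G1\<close> wherever \<open>G1\<close> is nonzero, in particular near 0
      because the zero of \<open>G\<close> is simple.\<close>
    define F1 where "F1 z = (if z = 0 then deriv F 0 else (F z - F 0) / (z - 0))" for z
    define G1 where "G1 z = (if z = 0 then deriv G 0 else (G z - G 0) / (z - 0))" for z
    have F1: "F1 holomorphic_on UNIV" and G1: "G1 holomorphic_on UNIV"
      unfolding F1_def G1_def by (rule pole_lemma[OF F] pole_lemma[OF G]; simp)+
    define U where "U = {z. G1 z \<noteq> 0}"
    have "open U"
    proof -
      have "continuous_on UNIV G1"
        using G1 by (rule holomorphic_on_imp_continuous_on)
      thus ?thesis
        unfolding U_def by (intro open_Collect_neq continuous_intros)
    qed
    have eq: "F1 z / G1 z = h z" if "z \<in> U" for z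
    proof (cases "z = 0")
      case False
      hence "G z \<noteq> 0"
        using that G0[of 0] L0 by (simp add: U_def G1_def)
      with False show ?thesis
        using G0[of z] G0[of 0] L0 F0 by (simp add: h_def F1_def G1_def)
    qed (use L0 in \<open>simp add: h_def F1_def G1_def\<close>)
    have "(\<lambda>z. F1 z / G1 z) holomorphic_on U"
      by (intro holomorphic_intros holomorphic_on_subset[OF F1] holomorphic_on_subset[OF G1])
         (auto simp: U_def)
    hence "h holomorphic_on U"
      using eq holomorphic_transform by blast
    moreover have "0 \<in> U"
      using deriv_G0 by (simp add: U_def G1_def)
    ultimately show ?thesis
      using \<open>open U\<close> holomorphic_on_imp_differentiable_at by blast
  qed
  have "h field_differentiable at z" for z
  proof (cases "z \<in> L")
    case True
    then obtain m n where mn: "z = of_int m * \<tau> + of_int n"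
      unfolding L_def by blast
    have "(\<lambda>w. h (w + z)) = h"
      using h_per[of _ m n] by (simp add: mn fun_eq_iff)
    with h_0 show ?thesis
      unfolding field_differentiable_def using DERIV_shift[of h _ 0 z] by auto
  next
    case False
    have "open (- L)"
    proof -
      have "- L = {z. G z \<noteq> 0}" using G0 by auto
      moreover have "continuous_on UNIV G"
        using G by (rule holomorphic_on_imp_continuous_on)
      ultimately show ?thesis
        by (auto intro!: open_Collect_neq continuous_intros)
    qed
    have "(\<lambda>z. F z / G z) holomorphic_on - L"
      by (intro holomorphic_intros holomorphic_on_subset[OF F] holomorphic_on_subset[OF G])
         (auto simp: G0)
    hence "h holomorphic_on - L"
      by (rule holomorphic_transform) (auto simp: h_def)
    thus ?thesis
      using False \<open>open (- L)\<close> holomorphic_on_imp_differentiable_at by blast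
  qed
  hence "h holomorphic_on UNIV"
    by (simp add: holomorphic_on_def field_differentiable_at_within)
  then obtain C where C: "\<And>z. h z = C"
    using elliptic_const[OF \<tau> _ h_per] by blast
  have "F z = C * theta z \<tau>" for z
  proof (cases "z \<in> L")
    case True
    hence "F z = 0"
      unfolding L_def using zero by auto
    moreover have "theta z \<tau> = 0"
      using G0[of z] True by (simp add: G_def)
    ultimately show ?thesis by simp
  next
    case False
    thus ?thesis
      using C[of z] G0[of z] by (simp add: h_def G_def field_simps)
  qed
  thus ?thesis by blast
qed

lemma klein_eq_0_iff:
  assumes "Im \<tau> > 0"
  shows "klein x y \<tau> = 0 \<longleftrightarrow> x \<in> \<int> \<and> y \<in> \<int>"
proof
  assume "klein x y \<tau> = 0"
  then obtain m n where mn: "of_real x * \<tau> + of_real y = of_int m * \<tau> + of_int n"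
    unfolding klein_def by (auto simp: theta_eq_0_iff[OF assms])
  hence "x * Im \<tau> = of_int m * Im \<tau>"
    by (simp add: complex_eq_iff)
  hence x: "x = of_int m" using assms by simp
  with mn have "of_real y = (of_int n :: complex)" by simp
  hence "y = of_int n" by (simp add: complex_eq_iff)
  with x show "x \<in> \<int> \<and> y \<in> \<int>" by simp
next
  assume "x \<in> \<int> \<and> y \<in> \<int>"
  then obtain m n where "x = of_int m" "y = of_int n"
    by (metis Ints_cases)
  hence "of_real x * \<tau> + of_real y = of_int m * \<tau> + of_int n" by simp
  thus "klein x y \<tau> = 0"
    unfolding klein_def by (metis theta_eq_0_iff[OF assms] mult_zero_right)
qed

text \<open>The inverse matrix stands on the left so that the right-hand side has the plain argument
  z = x\<tau> + y, in which both sides are compared. The constant is obtained from an existence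
  argument and never computed.\<close>

lemma klein_transform_inverse:
  assumes det: "a * d - b * c = (1::int)" and \<tau>: "Im \<tau> > 0"
  shows "\<exists>C. C \<noteq> 0 \<and> (\<forall>x y. klein (of_int d * x - of_int c * y) (- of_int b * x + of_int a * y)
             ((of_int a * \<tau> + of_int b) / (of_int c * \<tau> + of_int d)) = C * klein x y \<tau>)"
proof -
  define j where "j = of_int c * \<tau> + of_int d"
  define \<tau>' where "\<tau>' = (of_int a * \<tau> + of_int b) / j"
  have j: "j \<noteq> 0"
    unfolding j_def by (rule moebius_denom_neq_0[OF det \<tau>])
  have \<tau>': "Im \<tau>' > 0"
    unfolding \<tau>'_def j_def by (rule Im_moebius_pos[OF det \<tau>])
  \<comment> \<open>The transformed first coordinate is x j - c z and the transformed argument is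
    z/j, so the prefactor becomes e(x z/2) e(-c z^2/(2j)). The real coordinate x, which is not
    holomorphic in z, is thus confined to a factor common to both sides, and \<open>F\<close>
    collects the holomorphic rest.\<close>
  define F where "F z = qexp (- of_int c * z ^ 2 / (2 * j)) * theta (z / j) \<tau>'" for z
  have F: "F holomorphic_on UNIV"
    unfolding F_def by (intro holomorphic_intros holomorphic_on_theta) (use j \<tau>' in auto)
  have det': "of_int a * of_int d = 1 + of_int b * (of_int c :: complex)"
    using arg_cong[OF det, of "of_int :: int \<Rightarrow> complex"] by (simp add: algebra_simps)
  have K: "klein (of_int d * x - of_int c * y) (- of_int b * x + of_int a * y) \<tau>' =
      qexp (of_real x * (of_real x * \<tau> + of_real y) / 2) * F (of_real x * \<tau> + of_real y)" for x y
  proof -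
    let ?z = "of_real x * \<tau> + of_real y"
    let ?x' = "of_int d * of_real x - of_int c * of_real y :: complex"
    have "?x' * (of_int a * \<tau> + of_int b) + (- of_int b * of_real x + of_int a * of_real y) * j =
          (of_int a * of_int d - of_int b * of_int c) * ?z"
      by (simp add: j_def algebra_simps)
    hence z: "?x' * \<tau>' + (- of_int b * of_real x + of_int a * of_real y) = ?z / j"
      unfolding \<tau>'_def det' using j by (simp add: field_simps)
    have x': "?x' = of_real x * j - of_int c * ?z"
      by (simp add: j_def algebra_simps)
    have "?x' * (?z / j) / 2 = of_real x * ?z / 2 + (- of_int c * ?z ^ 2 / (2 * j))"
      unfolding x' using j by (simp add: field_simps power2_eq_square)
    hence "qexp (?x' * (?z / j) / 2) = qexp (of_real x * ?z / 2) * qexp (- of_int c * ?z ^ 2 / (2 * j))"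
      by (simp only: qexp_add)
    thus ?thesis
      unfolding klein_def F_def using z by simp
  qed
  have K': "klein x y \<tau> = qexp (of_real x * (of_real x * \<tau> + of_real y) / 2) *
     theta (of_real x * \<tau> + of_real y) \<tau>" for x y
    by (simp add: klein_def)
  have zero: "F (of_int m * \<tau> + of_int n) = 0" for m n
  proof -
    have "klein (of_int d * of_int m - of_int c * of_int n) (- of_int b * of_int m + of_int a * of_int n) \<tau>' = 0"
      unfolding klein_eq_0_iff[OF \<tau>'] by (auto intro!: Ints_add Ints_diff Ints_mult)
    thus ?thesis
      using K[of "of_int m" "of_int n"] by simp
  qed
  have per: "F (z + (of_int m * \<tau> + of_int n)) * theta z \<tau> =
             F z * theta (z + (of_int m * \<tau> + of_int n)) \<tau>" for z m n
  proof -
    obtain x y where z: "z = of_real x * \<tau> + of_real y"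
      using real_coordinates[OF \<tau>] by blast
    define e1 e2 where "e1 = qexp (of_real x * (of_real x * \<tau> + of_real y) / 2)"
      and "e2 = qexp (of_real (x + of_int m) * (of_real (x + of_int m) * \<tau> + of_real (y + of_int n)) / 2)"
    have z': "z + (of_int m * \<tau> + of_int n) = of_real (x + of_int m) * \<tau> + of_real (y + of_int n)"
      by (simp add: z algebra_simps)
    have "e2 * F (z + (of_int m * \<tau> + of_int n)) =
      klein (of_int d * (x + of_int m) - of_int c * (y + of_int n)) (- of_int b * (x + of_int m) + of_int a * (y + of_int n)) \<tau>'"
      unfolding K z' e2_def ..
    also have "\<dots> = klein ((of_int d * x - of_int c * y) + of_int (d * m - c * n)) ((- of_int b * x + of_int a * y) + of_int (- b * m + a * n)) \<tau>'"
      by (simp add: algebra_simps)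
    also have "\<dots> = klein_mult m n x y * (e1 * F z)"
      unfolding klein_shift[OF \<tau>'] klein_mult_SL2[OF det] K e1_def z ..
    finally have 1: "e2 * F (z + (of_int m * \<tau> + of_int n)) = klein_mult m n x y * (e1 * F z)" .
    have 2: "e2 * theta (z + (of_int m * \<tau> + of_int n)) \<tau> = klein_mult m n x y * (e1 * theta z \<tau>)"
      using klein_shift[OF \<tau>, of x m y n] unfolding K' e1_def e2_def unfolding z' unfolding z .
    have "e2 * (F (z + (of_int m * \<tau> + of_int n)) * theta z \<tau>) =
          klein_mult m n x y * (e1 * F z) * theta z \<tau>"
      unfolding 1[symmetric] by (simp only: mult.assoc)
    also have "\<dots> = F z * (klein_mult m n x y * (e1 * theta z \<tau>))"
      by (simp only: mult_ac)
    also have "\<dots> = e2 * (F z * theta (z + (of_int m * \<tau> + of_int n)) \<tau>)"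
      unfolding 2[symmetric] by (simp only: mult_ac)
    finally have "e2 * (F (z + (of_int m * \<tau> + of_int n)) * theta z \<tau>) =
          e2 * (F z * theta (z + (of_int m * \<tau> + of_int n)) \<tau>)" .
    thus ?thesis
      by (simp add: e2_def)
  qed
  obtain C where C: "\<And>z. F z = C * theta z \<tau>"
    using theta_quotient_const[OF \<tau> F zero per] by blast
  have eq: "klein (of_int d * x - of_int c * y) (- of_int b * x + of_int a * y) \<tau>' = C * klein x y \<tau>" for x y
    unfolding K K' C by (simp add: mult_ac)
  have "C \<noteq> 0"
  proof
    assume "C = 0"
    hence "klein (of_int d * x - of_int c * y) (- of_int b * x + of_int a * y) \<tau>' = 0" for x y
      using eq by simp
    \<comment> \<open>The characteristic (a/2, b/2) is sent to (1/2, 0), which is not integral, so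
      the Klein form does not vanish there.\<close>
    from this[of "of_int a / 2" "of_int b / 2"] have "(of_int a * of_int d - of_int b * of_int c) / 2 \<in> (\<int> :: real set)"
      unfolding klein_eq_0_iff[OF \<tau>'] by (simp add: algebra_simps diff_divide_distrib)
    moreover have "(of_int a * of_int d - of_int b * of_int c) / (2 :: real) = of_int (a * d - b * c) / 2"
      by simp
    ultimately have "1/2 \<in> (\<int> :: real set)"
      unfolding det by simp
    then obtain k :: int where "1/2 = real_of_int k"
      by (auto elim: Ints_cases)
    hence "1 = 2 * k" by linarith
    thus False by presburger
  qed
  with eq show ?thesis
    unfolding \<tau>'_def j_def by blast
qed

lemma klein_transform:
  assumes det: "a * d - b * c = (1::int)" and \<tau>: "Im \<tau> > 0"
  obtains C where "C \<noteq> 0" "\<And>x y. klein x y ((of_int a * \<tau> + of_int b) / (of_int c * \<tau> + of_int d)) =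
             C * klein (of_int a * x + of_int c * y) (of_int b * x + of_int d * y) \<tau>"
proof -
  obtain C where C: "C \<noteq> 0" "\<And>x y. klein (of_int d * x - of_int c * y) (- of_int b * x + of_int a * y)
             ((of_int a * \<tau> + of_int b) / (of_int c * \<tau> + of_int d)) = C * klein x y \<tau>"
    using klein_transform_inverse[OF det \<tau>] by blast
  have det': "real_of_int a * of_int d = 1 + of_int b * of_int c"
    using arg_cong[OF det, of real_of_int] by simp
  have x: "of_int d * (of_int a * x + of_int c * y) - of_int c * (of_int b * x + of_int d * y) = x" for x y :: real
  proof -
    have "of_int d * (of_int a * x + of_int c * y) - of_int c * (of_int b * x + of_int d * y) =
        (of_int a * of_int d - of_int b * of_int c) * x"
      by (simp add: algebra_simps)
    thus ?thesis unfolding det' by simp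
  qed
  have y: "- of_int b * (of_int a * x + of_int c * y) + of_int a * (of_int b * x + of_int d * y) = y" for x y :: real
  proof -
    have "- of_int b * (of_int a * x + of_int c * y) + of_int a * (of_int b * x + of_int d * y) =
        (of_int a * of_int d - of_int b * of_int c) * y"
      by (simp add: algebra_simps)
    thus ?thesis unfolding det' by simp
  qed
  show ?thesis
    using C(2)[of "of_int a * x + of_int c * y" "of_int b * x + of_int d * y" for x y] C(1) that
    unfolding x y by blast
qed

section \<open>Modularity of quotients of Klein forms\<close>

definition klein_quot :: "(real \<times> real \<times> int) list \<Rightarrow> complex \<Rightarrow> complex" where
  "klein_quot ws \<tau> = (\<Prod>(x, y, k)\<leftarrow>ws. klein x y \<tau> powi k)"

lemma klein_quot_Nil [simp]: "klein_quot [] \<tau> = 1"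
  by (simp add: klein_quot_def)

lemma klein_quot_Cons [simp]: "klein_quot ((x, y, k) # ws) \<tau> = klein x y \<tau> powi k * klein_quot ws \<tau>"
  by (simp add: klein_quot_def)

definition act :: "int \<Rightarrow> int \<Rightarrow> int \<Rightarrow> int \<Rightarrow> (real \<times> real \<times> int) list \<Rightarrow> (real \<times> real \<times> int) list" where
  "act a b c d = map (\<lambda>(x, y, k). (of_int a * x + of_int c * y, of_int b * x + of_int d * y, k))"

lemma act_Nil [simp]: "act a b c d [] = []"
  by (simp add: act_def)

lemma act_Cons [simp]:
  "act a b c d ((x, y, k) # ws) = (of_int a * x + of_int c * y, of_int b * x + of_int d * y, k) # act a b c d ws"
  by (simp add: act_def)

text \<open>The constant of \<open>klein_transform\<close> is the same for all characteristics, so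
  it enters with the total exponent and disappears when that is 0.\<close>

lemma klein_quot_transform:
  assumes "a * d - b * c = (1::int)" "Im \<tau> > 0" and weight: "(\<Sum>(x, y, k)\<leftarrow>ws. k) = 0"
  shows "klein_quot ws ((of_int a * \<tau> + of_int b) / (of_int c * \<tau> + of_int d)) =
           klein_quot (act a b c d ws) \<tau>"
proof -
  obtain C where C: "C \<noteq> 0" "\<And>x y. klein x y ((of_int a * \<tau> + of_int b) / (of_int c * \<tau> + of_int d)) =
             C * klein (of_int a * x + of_int c * y) (of_int b * x + of_int d * y) \<tau>"
    using klein_transform[OF assms(1,2)] by blast
  have "klein_quot ws ((of_int a * \<tau> + of_int b) / (of_int c * \<tau> + of_int d)) =
          C powi (\<Sum>(x, y, k)\<leftarrow>ws. k) * klein_quot (act a b c d ws) \<tau>"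
  proof (induction ws)
    case (Cons w ws)
    obtain x y k where w: "w = (x, y, k)"
      using prod_cases3 by blast
    have "C powi (\<Sum>(x, y, k)\<leftarrow>w # ws. k) = C powi k * C powi (\<Sum>(x, y, k)\<leftarrow>ws. k)"
      using C(1) by (simp add: w power_int_add)
    thus ?case
      unfolding w act_Cons klein_quot_Cons Cons C(2) by (simp add: power_int_mult_distrib mult_ac)
  qed simp
  thus ?thesis
    unfolding weight by simp
qed

section \<open>Holomorphy, expansions at the cusps and the modularity criterion\<close>

lemma holomorphic_on_klein:
  assumes "open S" "f holomorphic_on S" "\<And>z. z \<in> S \<Longrightarrow> Im (f z) > 0"
  shows "(\<lambda>z. klein x y (f z)) holomorphic_on S"
  unfolding klein_def by (intro holomorphic_intros holomorphic_on_theta assms) auto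

lemma holomorphic_on_klein_quot:
  assumes "open S" "f holomorphic_on S" "\<And>z. z \<in> S \<Longrightarrow> Im (f z) > 0"
    and "\<forall>(x, y, k)\<in>set ws. x \<notin> \<int> \<or> y \<notin> \<int>"
  shows "(\<lambda>z. klein_quot ws (f z)) holomorphic_on S"
  using assms(4)
proof (induction ws)
  case (Cons w ws)
  obtain x y k where w: "w = (x, y, k)"
    using prod_cases3 by blast
  have "klein x y (f z) \<noteq> 0" if "z \<in> S" for z
    using assms(3)[OF that] Cons.prems by (auto simp: klein_eq_0_iff w)
  thus ?case
    using Cons unfolding w klein_quot_Cons
    by (intro holomorphic_intros holomorphic_on_power_int holomorphic_on_klein assms) auto
qed auto

text \<open>Writing x = k/D + m with 0 \<le> k < D, the power q^(k^2/(2 D^2) - k/(2D)) is t^(k^2 - k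
  D) for t = e(\<tau>/(2 D^2)), and both Pochhammer arguments are nonnegative powers of t times
  constants. The exponent k^2 - k D is at most 0, hence the quotient of two powers in
  \<open>g\<close>.\<close>

lemma klein_meromorphic_at_0:
  assumes D: "D > 0" and x: "x * of_nat D \<in> \<int>"
  shows "\<exists>g. g meromorphic_on {0} \<and> (\<forall>\<tau>. Im \<tau> > 0 \<longrightarrow> klein x y \<tau> = g (qexp (\<tau> / of_nat (2 * D ^ 2))))"
proof -
  obtain n where n: "x * of_nat D = of_int n"
    using x by (auto elim: Ints_cases)
  define m where "m = n div int D"
  define k where "k = nat (n mod int D)"
  have k: "k < D" "int k = n mod int D"
    using D by (auto simp: k_def nat_less_iff)
  have "n = int k + int D * m"
    unfolding k m_def by simp
  hence "x * of_nat D = of_nat k + of_nat D * of_int m"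
    using n by simp
  hence xk: "x = of_nat k / of_nat D + of_int m"
    using D by (simp add: field_simps)
  define h where "h = 2 * D ^ 2"
  have h: "h > 0" using D by (simp add: h_def)
  define A where "A = qexp (of_int m * (1 - of_real y) / 2 + (of_nat k / of_nat D) * of_real y / 2 - of_real y / 2)"
  define g where "g t = A * (t ^ (k ^ 2) / t ^ (k * D)) * qpoch_inf (qexp (of_real y) * t ^ (2 * k * D)) (t ^ h) *
      qpoch_inf (qexp (-of_real y) * t ^ (2 * D * (D - k))) (t ^ h)" for t
  have mero: "(\<lambda>t. qpoch_inf (c * t ^ i) (t ^ h)) meromorphic_on {0}" for c i
  proof -
    have "(\<lambda>t. qpoch_inf (c * t ^ i) (t ^ h)) holomorphic_on ball 0 1"
      by (intro holomorphic_intros holomorphic_on_qpoch_inf) (auto simp: norm_power_less_1 h)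
    thus ?thesis
      by (intro analytic_on_imp_meromorphic_on)
         (auto simp: analytic_on_holomorphic intro!: exI[of _ "ball 0 1"])
  qed
  have "g meromorphic_on {0}"
    unfolding g_def by (intro meromorphic_intros mero)
  moreover have "klein x y \<tau> = g (qexp (\<tau> / of_nat h))" if \<tau>: "Im \<tau> > 0" for \<tau>
  proof -
    define t where "t = qexp (\<tau> / of_nat h)"
    have t: "t ^ i = qexp (of_nat i * \<tau> / of_nat h)" for i
      unfolding t_def qexp_of_nat_mult[symmetric] by simp
    have D': "of_nat D \<noteq> (0::complex)" using D by simp
    have h': "of_nat h = 2 * (of_nat D :: complex) ^ 2"
      by (simp add: h_def)
    let ?x = "of_nat k / of_nat D :: complex"
    have 1: "t ^ h = qexp \<tau>"
      unfolding t using h by simp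
    have 2: "qexp (of_real y) * t ^ (2 * k * D) = qexp (?x * \<tau> + of_real y)"
      unfolding t h' qexp_add[symmetric] using D' by (simp add: field_simps power2_eq_square)
    have 3: "qexp (-of_real y) * t ^ (2 * D * (D - k)) = qexp (\<tau> - (?x * \<tau> + of_real y))"
    proof -
      have "of_nat (D - k) = (of_nat D - of_nat k :: complex)"
        using k(1) by (simp add: of_nat_diff)
      hence "-of_real y + of_nat (2 * D * (D - k)) * \<tau> / of_nat h = \<tau> - (?x * \<tau> + of_real y)"
        unfolding h' using D' by (simp add: divide_simps power2_eq_square) (simp add: algebra_simps)
      thus ?thesis
        unfolding t qexp_add[symmetric] by (rule arg_cong)
    qed
    have 4: "t ^ (k ^ 2) / t ^ (k * D) = qexp (?x * ?x * \<tau> / 2 - ?x * \<tau> / 2)"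
      unfolding t h' qexp_diff[symmetric] using D' by (simp add: field_simps power2_eq_square)
    have "klein x y \<tau> = qexp (of_int m * (1 - of_real y) / 2) * klein (of_nat k / of_nat D) y \<tau>"
      unfolding xk by (rule klein_shift_x[OF \<tau>])
    also have "\<dots> = qexp (of_int m * (1 - of_real y) / 2 + ?x * (?x * \<tau> + of_real y) / 2 + (-(?x * \<tau> + of_real y) / 2)) *
        qpoch_inf (qexp (?x * \<tau> + of_real y)) (qexp \<tau>) * qpoch_inf (qexp (\<tau> - (?x * \<tau> + of_real y))) (qexp \<tau>)"
      unfolding klein_def theta_def by (simp add: qexp_add)
    also have "of_int m * (1 - of_real y) / 2 + ?x * (?x * \<tau> + of_real y) / 2 + (-(?x * \<tau> + of_real y) / 2) =
       (of_int m * (1 - of_real y) / 2 + ?x * of_real y / 2 - of_real y / 2) + (?x * ?x * \<tau> / 2 - ?x * \<tau> / 2)"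
      by (simp add: algebra_simps add_divide_distrib diff_divide_distrib)
    also have "qexp \<dots> = A * (t ^ (k ^ 2) / t ^ (k * D))"
      unfolding 4 A_def by (rule qexp_add)
    finally show ?thesis
      unfolding g_def t_def[symmetric] 1 2 3 .
  qed
  ultimately show ?thesis
    unfolding h_def by blast
qed

lemma klein_quot_meromorphic_at_0:
  assumes "D > 0" and "\<forall>(x, y, k)\<in>set ws. x * of_nat D \<in> \<int>"
  shows "\<exists>g. g meromorphic_on {0} \<and>
           (\<forall>\<tau>. Im \<tau> > 0 \<longrightarrow> klein_quot ws \<tau> = g (qexp (\<tau> / of_nat (2 * D ^ 2))))"
  using assms(2)
proof (induction ws)
  case Nil
  show ?case by (rule exI[of _ "\<lambda>_. 1"]) auto
next
  case (Cons w ws)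
  obtain x y k where w: "w = (x, y, k)"
    using prod_cases3 by blast
  obtain g1 where g1: "g1 meromorphic_on {0}"
    "\<And>\<tau>. Im \<tau> > 0 \<Longrightarrow> klein x y \<tau> = g1 (qexp (\<tau> / of_nat (2 * D ^ 2)))"
    using klein_meromorphic_at_0[OF assms(1), of x y] Cons.prems by (auto simp: w)
  obtain g2 where g2: "g2 meromorphic_on {0}"
    "\<And>\<tau>. Im \<tau> > 0 \<Longrightarrow> klein_quot ws \<tau> = g2 (qexp (\<tau> / of_nat (2 * D ^ 2)))"
    using Cons by auto
  show ?case
    using g1 g2 unfolding w
    by (intro exI[of _ "\<lambda>t. g1 t powi k * g2 t"]) (auto intro!: meromorphic_intros)
qed

text \<open>The expansion at infinity depends on the denominator of the first coordinate only, but
  the action mixes the coordinates, so both are controlled beforehand.\<close>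

lemma act_denominators:
  assumes "\<forall>(x, y, k)\<in>set ws. x * of_nat D \<in> \<int> \<and> y * of_nat D \<in> \<int>"
  shows "\<forall>(x, y, k)\<in>set (act a b c d ws). x * of_nat D \<in> \<int>"
proof -
  have "(of_int a * x + of_int c * y) * of_nat D \<in> \<int>"
    if "x * of_nat D \<in> \<int>" "y * of_nat D \<in> \<int>" for x y :: real
  proof -
    have "(of_int a * x + of_int c * y) * of_nat D = of_int a * (x * of_nat D) + of_int c * (y * of_nat D)"
      by (simp add: algebra_simps)
    thus ?thesis using that by (auto intro!: Ints_add Ints_mult)
  qed
  thus ?thesis
    using assms by (fastforce simp: act_def)
qed

text \<open>Hermite normal form: diag(M, 1) \<gamma> is an element of SL2(Z) times an upper
  triangular matrix with diagonal P, R. Here P is the gcd of the first column, the quotient column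
  is completed by Bezout, and P R = M by determinants. This moves every cusp of a function of
  M\<tau> to infinity.\<close>

lemma scaled_moebius_decomposition:
  fixes a b c d :: int and M :: nat
  assumes det: "a * d - b * c = 1" and M: "M > 0"
  obtains x u y v s :: int and p r :: nat where
    "x * v - u * y = 1" "p > 0" "r > 0"
    "\<And>\<tau>. Im \<tau> > 0 \<Longrightarrow> of_nat M * ((of_int a * \<tau> + of_int b) / (of_int c * \<tau> + of_int d)) =
       (of_int x * ((of_nat p * \<tau> + of_int s) / of_nat r) + of_int u) /
       (of_int y * ((of_nat p * \<tau> + of_int s) / of_nat r) + of_int v)"
proof -
  define P where "P = gcd (int M * a) c"
  have "int M * a \<noteq> 0 \<or> c \<noteq> 0"
    using det M by auto
  hence P: "P > 0"
    unfolding P_def by auto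
  define x y where "x = int M * a div P" and "y = c div P"
  have xy: "int M * a = x * P" "c = y * P"
    unfolding x_def y_def P_def by auto
  have "coprime x y"
    unfolding x_def y_def P_def using \<open>int M * a \<noteq> 0 \<or> c \<noteq> 0\<close> by (rule div_gcd_coprime)
  then obtain v u' where "v * x + u' * y = 1"
    using bezout_int[of x y] by (auto simp: coprime_iff_gcd_eq_1)
  then obtain u where uv: "x * v - u * y = 1"
    by (intro that[of "-u'"]) (simp add: mult.commute)
  define s R where "s = v * (int M * b) - u * d" and "R = x * d - y * (int M * b)"
  have PR: "P * R = int M"
  proof -
    have "P * R = (x * P) * d - (y * P) * (int M * b)"
      by (simp add: R_def algebra_simps)
    also have "\<dots> = int M * (a * d - b * c)"
      unfolding xy[symmetric] by (simp add: algebra_simps)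
    finally show ?thesis using det by simp
  qed
  hence R: "R > 0"
    using P M by (metis of_nat_0_less_iff zero_less_mult_pos)
  have top: "x * s + u * R = int M * b"
  proof -
    have "x * s + u * R = (x * v - u * y) * (int M * b)"
      by (simp add: s_def R_def algebra_simps)
    thus ?thesis using uv by simp
  qed
  have bot: "y * s + v * R = d"
  proof -
    have "y * s + v * R = (x * v - u * y) * d"
      by (simp add: s_def R_def algebra_simps)
    thus ?thesis using uv by simp
  qed
  show thesis
  proof (rule that[of x v u y "nat P" "nat R" s])
    fix \<tau> :: complex assume \<tau>: "Im \<tau> > 0"
    have R': "of_int R \<noteq> (0::complex)" using R by simp
    have eq: "(of_int x * ((of_nat (nat P) * \<tau> + of_int s) / of_nat (nat R)) + of_int u) =
              (of_nat M * (of_int a * \<tau> + of_int b)) / of_int R"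
    proof -
      have "of_int x * (of_int P * \<tau> + of_int s) + of_int u * of_int R =
            of_int (x * P) * \<tau> + of_int (x * s + u * R)"
        by (simp add: algebra_simps)
      also have "\<dots> = of_nat M * (of_int a * \<tau> + of_int b)"
        unfolding top xy(1)[symmetric] by (simp add: algebra_simps)
      finally show ?thesis
        using R' R P by (simp add: field_simps)
    qed
    have eq': "(of_int y * ((of_nat (nat P) * \<tau> + of_int s) / of_nat (nat R)) + of_int v) =
              (of_int c * \<tau> + of_int d) / of_int R"
    proof -
      have "of_int y * (of_int P * \<tau> + of_int s) + of_int v * of_int R =
            of_int (y * P) * \<tau> + of_int (y * s + v * R)"
        by (simp add: algebra_simps)
      also have "\<dots> = of_int c * \<tau> + of_int d"
        unfolding bot xy(2)[symmetric] ..
      finally show ?thesis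
        using R' R P by (simp add: field_simps)
    qed
    show "of_nat M * ((of_int a * \<tau> + of_int b) / (of_int c * \<tau> + of_int d)) =
       (of_int x * ((of_nat (nat P) * \<tau> + of_int s) / of_nat (nat R)) + of_int u) /
       (of_int y * ((of_nat (nat P) * \<tau> + of_int s) / of_nat (nat R)) + of_int v)"
      unfolding eq eq' using R' by simp
  qed (use uv P R in auto)
qed

lemma SL2Z_det:
  fixes \<gamma> :: "int^2^2"
  assumes "\<gamma> \<in> SL2Z"
  shows "\<gamma> $ 1 $ 1 * \<gamma> $ 2 $ 2 - \<gamma> $ 1 $ 2 * \<gamma> $ 2 $ 1 = 1"
  using assms by (simp add: SL2Z_def det_2)

text \<open>If \<gamma> has entries a, b, c, d, then M times \<gamma>\<tau> is the image of M\<tau>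
  under the matrix with entries a, M b, c/M, d. For \<gamma> in \<open>Gamma1 (4 * M)\<close> this
  matrix satisfies exactly the divisibilities assumed in \<open>invar\<close>.\<close>

lemma modular_function_klein_quot:
  fixes M N D :: nat and f :: "complex \<Rightarrow> complex"
  assumes M: "M > 0" and D: "D > 0"
    and nonint: "\<forall>(x, y, k)\<in>set ws. x \<notin> \<int> \<or> y \<notin> \<int>"
    and denoms: "\<forall>(x, y, k)\<in>set ws. x * of_nat D \<in> \<int> \<and> y * of_nat D \<in> \<int>"
    and weight: "(\<Sum>(x, y, k)\<leftarrow>ws. k) = 0"
    and N: "N = 4 * M"
    and invar: "\<And>a b c d \<tau>. a * d - b * c = 1 \<Longrightarrow> int (4 * M) dvd a - 1 \<Longrightarrow> int (4 * M) dvd d - 1 \<Longrightarrow>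
       int M dvd b \<Longrightarrow> 4 dvd c \<Longrightarrow> Im \<tau> > 0 \<Longrightarrow> klein_quot (act a b c d ws) \<tau> = klein_quot ws \<tau>"
    and f: "\<And>\<tau>. Im \<tau> > 0 \<Longrightarrow> f \<tau> = K * klein_quot ws (of_nat M * \<tau>)"
  shows "modular_function_on (Gamma1 N) f"
  unfolding modular_function_on_def
proof (intro conjI ballI)
  have open_H: "open upper_half_plane"
    unfolding upper_half_plane_def by (intro open_Collect_less continuous_intros)
  have "(\<lambda>\<tau>. K * klein_quot ws (of_nat M * \<tau>)) holomorphic_on upper_half_plane"
    by (intro holomorphic_on_klein_quot holomorphic_intros open_H nonint)
       (use M in \<open>auto simp: upper_half_plane_def\<close>)
  hence "f holomorphic_on upper_half_plane"
    by (rule holomorphic_transform) (simp add: f upper_half_plane_def)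
  thus "f nicely_meromorphic_on upper_half_plane"
    using open_H by (intro analytic_on_imp_nicely_meromorphic_on) (simp add: analytic_on_open)
next
  fix \<gamma> :: "int^2^2" and \<tau> assume \<gamma>: "\<gamma> \<in> Gamma1 N" and \<tau>: "\<tau> \<in> upper_half_plane"
  define a b c d where "a = \<gamma> $ 1 $ 1" and "b = \<gamma> $ 1 $ 2" and "c = \<gamma> $ 2 $ 1" and "d = \<gamma> $ 2 $ 2"
  have det: "a * d - b * c = 1"
    unfolding a_def b_def c_def d_def by (rule SL2Z_det) (use \<gamma> in \<open>simp add: Gamma1_def\<close>)
  have cong: "int (4 * M) dvd a - 1" "int (4 * M) dvd d - 1" "int (4 * M) dvd c"
    using \<gamma> by (auto simp: Gamma1_def a_def c_def d_def N cong_iff_dvd_diff cong_0_iff)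
  then obtain e where "c = int (4 * M) * e"
    by (elim dvdE)
  hence c: "c = int M * (4 * e)"
    by simp
  have det': "a * d - (int M * b) * (4 * e) = 1"
    using det by (simp add: c mult_ac)
  have Im: "Im \<tau> > 0" "Im (of_nat M * \<tau>) > 0"
    using \<tau> M by (auto simp: upper_half_plane_def)
  have "of_nat M * moebius_action \<gamma> \<tau> =
      (of_int a * (of_nat M * \<tau>) + of_int (int M * b)) / (of_int (4 * e) * (of_nat M * \<tau>) + of_int d)"
    unfolding moebius_action_def a_def[symmetric] b_def[symmetric] c_def[symmetric] d_def[symmetric]
    by (simp add: c algebra_simps)
  hence "klein_quot ws (of_nat M * moebius_action \<gamma> \<tau>) = klein_quot ws (of_nat M * \<tau>)"
    using klein_quot_transform[OF det' Im(2) weight] invar[OF det' cong(1,2) _ _ Im(2)] by simp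
  moreover have "Im (moebius_action \<gamma> \<tau>) > 0"
    unfolding moebius_action_def a_def[symmetric] b_def[symmetric] c_def[symmetric] d_def[symmetric]
    by (rule Im_moebius_pos[OF det Im(1)])
  ultimately show "f (moebius_action \<gamma> \<tau>) = f \<tau>"
    using Im(1) by (simp add: f)
next
  fix \<gamma> :: "int^2^2" assume \<gamma>: "\<gamma> \<in> SL2Z"
  define a b c d where "a = \<gamma> $ 1 $ 1" and "b = \<gamma> $ 1 $ 2" and "c = \<gamma> $ 2 $ 1" and "d = \<gamma> $ 2 $ 2"
  have det: "a * d - b * c = 1"
    unfolding a_def b_def c_def d_def by (rule SL2Z_det) (rule \<gamma>)
  obtain x u y v s :: int and p r :: nat where xuyv: "x * v - u * y = 1" and pr: "p > 0" "r > 0" and eq: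
    "\<And>\<tau>. Im \<tau> > 0 \<Longrightarrow> of_nat M * ((of_int a * \<tau> + of_int b) / (of_int c * \<tau> + of_int d)) =
       (of_int x * ((of_nat p * \<tau> + of_int s) / of_nat r) + of_int u) /
       (of_int y * ((of_nat p * \<tau> + of_int s) / of_nat r) + of_int v)"
    by (rule scaled_moebius_decomposition[OF det M]) blast
  obtain g where g: "g meromorphic_on {0}"
    "\<And>\<tau>. Im \<tau> > 0 \<Longrightarrow> klein_quot (act x u y v ws) \<tau> = g (qexp (\<tau> / of_nat (2 * D ^ 2)))"
    using klein_quot_meromorphic_at_0[OF D act_denominators[OF denoms]] by blast
  \<comment> \<open>For w = (p\<tau> + s)/r one has e(w/(2 D^2)) = A e(\<tau>/h)^p: the division by
    r enlarges the width, the translation by s becomes the constant A, and p becomes a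
    power.\<close>
  define h where "h = 2 * D ^ 2 * r"
  define A where "A = qexp (of_int s / of_nat h)"
  have "(\<lambda>t. K * g (A * t ^ p)) meromorphic_on {0}"
    by (intro meromorphic_intros meromorphic_on_compose[OF g(1)]) (use pr in \<open>auto intro!: analytic_intros\<close>)
  moreover have "f (moebius_action \<gamma> \<tau>) =
      K * g (A * exp (2 * of_real pi * \<i> * \<tau> / of_nat h) ^ p)" if \<tau>: "Im \<tau> > 0" for \<tau>
  proof -
    let ?w = "(of_nat p * \<tau> + of_int s) / of_nat r"
    have w: "Im ?w > 0"
      using \<tau> pr by (simp add: Im_divide_of_nat)
    have "klein_quot ws (of_nat M * moebius_action \<gamma> \<tau>) = klein_quot (act x u y v ws) ?w"
      unfolding moebius_action_def a_def[symmetric] b_def[symmetric] c_def[symmetric] d_def[symmetric]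
        eq[OF \<tau>] by (rule klein_quot_transform[OF xuyv w weight])
    also have "\<dots> = g (qexp (?w / of_nat (2 * D ^ 2)))"
      by (rule g(2)[OF w])
    also have "?w / of_nat (2 * D ^ 2) = of_int s / of_nat h + of_nat p * (\<tau> / of_nat h)"
      using pr D by (simp add: h_def field_simps)
    also have "qexp \<dots> = A * qexp (\<tau> / of_nat h) ^ p"
      by (simp only: qexp_add qexp_of_nat_mult A_def)
    finally have "klein_quot ws (of_nat M * moebius_action \<gamma> \<tau>) = g (A * qexp (\<tau> / of_nat h) ^ p)" .
    moreover have "Im (moebius_action \<gamma> \<tau>) > 0"
      unfolding moebius_action_def a_def[symmetric] b_def[symmetric] c_def[symmetric] d_def[symmetric]
      by (rule Im_moebius_pos[OF det \<tau>])
    ultimately show ?thesis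
      by (simp add: f qexp_def)
  qed
  moreover have "h > 0"
    using D pr by (simp add: h_def)
  ultimately show "meromorphic_at_ioo (\<lambda>\<tau>. f (moebius_action \<gamma> \<tau>))"
    unfolding meromorphic_at_ioo_def
    by (intro exI[of _ h] conjI exI[of _ "\<lambda>t. K * g (A * t ^ p)"] exI[of _ "1::real"]) auto
qed

section \<open>The Nahm sums as quotients of Klein forms\<close>

lemma qexp_power_int: "qexp z powi k = qexp (of_int k * z)"
proof (cases "k \<ge> 0")
  case True
  thus ?thesis by (simp add: power_int_def flip: qexp_of_nat_mult)
next
  case False
  thus ?thesis by (simp add: power_int_def flip: qexp_of_nat_mult qexp_minus)
qed

lemma klein_quot_append [simp]: "klein_quot (us @ vs) \<tau> = klein_quot us \<tau> * klein_quot vs \<tau>"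
  by (simp add: klein_quot_def)

lemma act_append [simp]: "act a b c d (us @ vs) = act a b c d us @ act a b c d vs"
  by (simp add: act_def)

text \<open>The exponent of a multiplier matters only modulo integers; \<open>j\<close> is the
  discarded integer, so \<open>t\<close> can be any convenient representative.\<close>

lemma klein_act:
  assumes \<tau>: "Im \<tau> > 0"
    and m: "(of_int a - 1) * x + of_int c * y = of_int m"
    and n: "of_int b * x + (of_int d - 1) * y = of_int n"
    and t: "(of_int m + of_int n - of_int (m * n) + of_int n * x - of_int m * y) / 2 = t + of_int j"
  shows "klein (of_int a * x + of_int c * y) (of_int b * x + of_int d * y) \<tau> = qexp (of_real t) * klein x y \<tau>"
proof -
  have "of_int a * x + of_int c * y = x + of_int m" "of_int b * x + of_int d * y = y + of_int n"
    using m n by (simp_all add: algebra_simps)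
  moreover have "klein_mult m n x y = qexp (of_real t)"
    unfolding klein_mult_def t by (simp add: qexp_add)
  ultimately show ?thesis
    using klein_shift[OF \<tau>, of x m y n] by simp
qed

text \<open>The product over the nonzero 2-torsion points is a constant times \<open>(\<theta>'(0)/\<eta>\<^sup>2)\<^sup>3\<close>
  (\<open>klein_quot_torsion\<close> below); it balances the weight of the Klein forms in the denominators.\<close>

definition torsion_list :: "(real \<times> real \<times> int) list" where
  "torsion_list = [(1/2, 0, 1), (0, 1/2, 1), (1/2, 1/2, 1)]"

text \<open>With c = 4C, the points (0, 1/2) and (1/2, 1/2) each contribute the sign (-1)^C, and
  (1/2, 0) contributes none. The two signs cancel.\<close>

lemma torsion_list_act:
  assumes \<tau>: "Im \<tau> > 0" and "8 dvd a - 1" "8 dvd d - 1" "8 dvd b" "4 dvd c"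
  shows "klein_quot (act a b c d torsion_list) \<tau> = klein_quot torsion_list \<tau>"
proof -
  obtain A B C D where eq: "a = 1 + 8 * A" "b = 8 * B" "c = 4 * C" "d = 1 + 8 * D"
    using assms(2-) by (elim dvdE) (auto simp: algebra_simps)
  have 1: "klein (of_int a * (1/2) + of_int c * 0) (of_int b * (1/2) + of_int d * 0) \<tau> =
      qexp (of_real 0) * klein (1/2) 0 \<tau>"
    by (rule klein_act[OF \<tau>, where m = "4 * A" and n = "4 * B" and j = "2 * A + 2 * B - 8 * A * B + B"])
       (simp_all add: eq field_simps)
  have 2: "klein (of_int a * 0 + of_int c * (1/2)) (of_int b * 0 + of_int d * (1/2)) \<tau> =
      qexp (of_real (- of_int C / 2)) * klein 0 (1/2) \<tau>"
    by (rule klein_act[OF \<tau>, where m = "2 * C" and n = "4 * D" and j = "C + 2 * D - 4 * C * D"])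
       (simp_all add: eq field_simps)
  have 3: "klein (of_int a * (1/2) + of_int c * (1/2)) (of_int b * (1/2) + of_int d * (1/2)) \<tau> =
      qexp (of_real (- of_int C / 2)) * klein (1/2) (1/2) \<tau>"
    by (rule klein_act[OF \<tau>, where m = "4 * A + 2 * C" and n = "4 * B + 4 * D" and
          j = "2 * A + C + 2 * B + 2 * D - (2 * A + C) * (4 * B + 4 * D) + B + D - A"])
       (simp_all add: eq field_simps)
  have "qexp (of_real (- of_int C / 2)) * qexp (of_real (- of_int C / 2)) = qexp (of_int (-C))"
    unfolding qexp_add[symmetric] by (rule arg_cong[of _ _ qexp]) simp
  hence 4: "qexp (of_real (- of_int C / 2)) * qexp (of_real (- of_int C / 2)) = 1"
    by (simp only: qexp_of_int)
  show ?thesis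
    unfolding torsion_list_def act_Cons act_Nil klein_quot_Cons klein_quot_Nil 1 2 3
    using 4 by (simp add: mult_ac)
qed

text \<open>Even shifts remove the parity part of the multiplier; since the second shift is b x, the
  determinant part is b x^2/2.\<close>

lemma klein_act_even:
  assumes \<tau>: "Im \<tau> > 0"
    and m: "(of_int a - 1) * x = 2 * of_int m" and n: "of_int b * x = 2 * of_int n"
  shows "klein (of_int a * x + of_int c * 0) (of_int b * x + of_int d * 0) \<tau> =
           qexp (of_real (of_int b * x ^ 2 / 2)) * klein x 0 \<tau>"
proof (rule klein_act[OF \<tau>, where m = "2 * m" and n = "2 * n" and j = "m + n - 2 * m * n"])
  have "of_int b * x ^ 2 = 2 * of_int n * x"
    using n by (simp add: power2_eq_square)
  thus "(of_int (2 * m) + of_int (2 * n) - of_int (2 * m * (2 * n)) + of_int (2 * n) * x - of_int (2 * m) * 0) / 2 =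
      of_int b * x ^ 2 / 2 + of_int (m + n - 2 * m * n)"
    by (simp add: field_simps)
qed (use m n in simp_all)

text \<open>With \<open>s = e(\<tau>/2)\<close>, the Klein forms in this list at \<open>8\<tau>\<close> multiply up to
  \<open>(s^r, s^(8-r), s^4; s^8)\<^sub>\<infinity>\<close>: the values \<open>r = 1, 3\<close> belong to the second and fifth identity
  and \<open>r = 2\<close> to the first and fourth.\<close>

definition triple_list :: "nat \<Rightarrow> (real \<times> real \<times> int) list" where
  "triple_list r = [(of_nat r / 16, 0, -1), (of_nat (8 - r) / 16, 0, -1), (1/4, 0, -1)]"

text \<open>\<open>32 dvd M * k\<close> makes the shifts of the characteristic k/16 even, so its
  multiplier is e(b k^2/512). The condition modulo 512 makes these exponents for k = r, 8 - r, 4 add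
  up to an integer; it forces 256 to divide M for r = 1, 3, whereas 64 suffices for r = 2.\<close>

lemma triple_list_act:
  fixes M r :: nat
  assumes \<tau>: "Im \<tau> > 0" and a: "int (4 * M) dvd a - 1" and b: "int M dvd b"
    and M: "32 dvd M * r" "32 dvd M * (8 - r)" "8 dvd M" "512 dvd M * (r ^ 2 + (8 - r) ^ 2 + 16)"
  shows "klein_quot (act a b c d (triple_list r)) \<tau> = klein_quot (triple_list r) \<tau>"
proof -
  obtain A where A: "a = 1 + int (4 * M) * A"
    using a by (metis add.commute diff_add_cancel dvdE)
  obtain B where B: "b = int M * B"
    using b by (elim dvdE)
  have single: "klein (of_int a * (of_nat k / 16) + of_int c * 0) (of_int b * (of_nat k / 16) + of_int d * 0) \<tau> =
           qexp (of_real (of_int b * (of_nat k / 16) ^ 2 / 2)) * klein (of_nat k / 16) 0 \<tau>"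
    if k: "32 dvd M * k" for k
  proof -
    obtain l where l: "M * k = 32 * l"
      using k by (elim dvdE)
    have l': "real M * real k = 32 * real l"
      using arg_cong[OF l, of real] by simp
    show ?thesis
    proof (rule klein_act_even[OF \<tau>, where m = "4 * A * int l" and n = "B * int l"])
      have "(real_of_int a - 1) * (real k / 16) = of_int A * (real M * real k) / 4"
        by (simp add: A)
      thus "(real_of_int a - 1) * (real k / 16) = 2 * of_int (4 * A * int l)"
        unfolding l' by simp
      have "real_of_int b * (real k / 16) = of_int B * (real M * real k) / 16"
        by (simp add: B)
      thus "real_of_int b * (real k / 16) = 2 * of_int (B * int l)"
        unfolding l' by simp
    qed
  qed
  define E where "E k = qexp (of_real (of_int b * (of_nat k / 16) ^ 2 / 2))" for k :: nat
  have "32 dvd M * 4"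
    using M(3) by (elim dvdE) simp
  from single[OF this] have 4: "klein (of_int a * (1/4) + of_int c * 0) (of_int b * (1/4) + of_int d * 0) \<tau> =
           E 4 * klein (1/4) 0 \<tau>"
    by (simp add: E_def)
  note 12 = single[OF M(1), folded E_def] single[OF M(2), folded E_def]
  have "E r * E (8 - r) * E 4 = 1"
  proof -
    obtain l where l: "M * (r ^ 2 + (8 - r) ^ 2 + 16) = 512 * l"
      using M(4) by (elim dvdE)
    have "E r * E (8 - r) * E 4 = qexp (of_real (of_int b * (of_nat r / 16) ^ 2 / 2 +
        of_int b * (of_nat (8 - r) / 16) ^ 2 / 2 + of_int b * (of_nat 4 / 16) ^ 2 / 2))"
      unfolding E_def of_real_add qexp_add ..
    also have "of_int b * (of_nat r / 16) ^ 2 / 2 + of_int b * (of_nat (8 - r) / 16) ^ 2 / 2 +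
        of_int b * (of_nat 4 / 16) ^ 2 / 2 = of_int B * real (M * (r ^ 2 + (8 - r) ^ 2 + 16)) / 512"
      unfolding B of_nat_mult of_nat_add of_nat_power by (simp add: power_divide field_simps)
    also have "\<dots> = of_int (B * int l)"
      unfolding l by simp
    finally show ?thesis
      by (simp only: of_real_of_int_eq qexp_of_int)
  qed
  hence "inverse (E r) * inverse (E (8 - r)) * inverse (E 4) = 1"
    by (metis inverse_1 inverse_mult_distrib)
  thus ?thesis
    unfolding triple_list_def act_Cons act_Nil klein_quot_Cons klein_quot_Nil 12 4
    by (simp add: power_int_minus mult_ac)
qed

text \<open>At 8\<tau> this is, up to a power of q, the third product in the form (q^2;q^4)_inf /
  (q, q^3; q^4)_inf^2. The total exponent is -3, as for \<open>triple_list\<close>.\<close>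

definition sextuple_list :: "(real \<times> real \<times> int) list" where
  "sextuple_list = [(1/4, 0, 1), (1/8, 0, -2), (3/8, 0, -2)]"

text \<open>Because b is divisible only by 8, the shifts b x may be odd, and parity contributes the
  summands B/2 and 3B/2. The exponents nevertheless add up to the integer -5B.\<close>

lemma sextuple_list_act:
  assumes \<tau>: "Im \<tau> > 0" and a: "32 dvd a - 1" and b: "8 dvd b"
  shows "klein_quot (act a b c d sextuple_list) \<tau> = klein_quot sextuple_list \<tau>"
proof -
  obtain A where A: "a = 1 + 32 * A"
    using a by (metis add.commute diff_add_cancel dvdE)
  obtain B where B: "b = 8 * B"
    using b by (elim dvdE)
  have 1: "klein (of_int a * (1/4) + of_int c * 0) (of_int b * (1/4) + of_int d * 0) \<tau> =
      qexp (of_real (of_int B / 4)) * klein (1/4) 0 \<tau>"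
    by (rule klein_act[OF \<tau>, where m = "8 * A" and n = "2 * B" and j = "4 * A + B - 8 * A * B"])
       (simp_all add: A B field_simps)
  have 2: "klein (of_int a * (1/8) + of_int c * 0) (of_int b * (1/8) + of_int d * 0) \<tau> =
      qexp (of_real (of_int B / 16 + of_int B / 2)) * klein (1/8) 0 \<tau>"
    by (rule klein_act[OF \<tau>, where m = "4 * A" and n = "B" and j = "2 * A - 2 * A * B"])
       (simp_all add: A B field_simps)
  have 3: "klein (of_int a * (3/8) + of_int c * 0) (of_int b * (3/8) + of_int d * 0) \<tau> =
      qexp (of_real (9 * of_int B / 16 + 3 * of_int B / 2)) * klein (3/8) 0 \<tau>"
    by (rule klein_act[OF \<tau>, where m = "12 * A" and n = "3 * B" and j = "6 * A - 18 * A * B"])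
       (simp_all add: A B field_simps)
  have "qexp (of_real (of_int B / 4)) * qexp (of_real (of_int B / 16 + of_int B / 2)) powi (-2) *
      qexp (of_real (9 * of_int B / 16 + 3 * of_int B / 2)) powi (-2) = qexp (of_int (-5 * B))"
    unfolding qexp_power_int qexp_add[symmetric]
    by (rule arg_cong[of _ _ qexp]) (simp add: field_simps)
  hence 4: "qexp (of_real (of_int B / 4)) * qexp (of_real (of_int B / 16 + of_int B / 2)) powi (-2) *
      qexp (of_real (9 * of_int B / 16 + 3 * of_int B / 2)) powi (-2) = 1"
    by (simp only: qexp_of_int)
  show ?thesis
    unfolding sextuple_list_def act_Cons act_Nil klein_quot_Cons klein_quot_Nil 1 2 3
    using 4 by (simp add: power_int_mult_distrib mult_ac)
qed

section \<open>Product expansions of the Klein quotients\<close>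

text \<open>At a 2-torsion point z and \<tau> - z agree up to the lattice, so each Klein form is a
  square of a Pochhammer symbol times elementary factors. With s = e(\<tau>/2) the three roots
  multiply to (s, -s, -q; q)_inf = (q;q^2)_inf (-q;q)_inf = 1, by Euler's identity. The 2 is the
  first factor of (-1;q)_inf.\<close>

lemma klein_quot_torsion:
  assumes \<tau>: "Im \<tau> > 0"
  shows "klein_quot torsion_list \<tau> = 2 * qexp (-3/8) * qexp (-\<tau> / 4)"
proof -
  let ?q = "qexp \<tau>" and ?s = "qexp (\<tau> / 2)"
  have q: "norm ?q < 1"
    using \<tau> by (rule norm_qexp_less_1)
  have half: "qexp (1/2) = -1"
    by (simp add: qexp_def)
  have minus: "qexp (z - 1/2) = - qexp z" "qexp (z + 1/2) = - qexp z" "qexp (-1/2) = -1" for z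
    using half by (simp_all add: qexp_diff qexp_add qexp_minus[of "1/2", simplified])
  have s2: "?s ^ 2 = ?q"
    by (simp flip: qexp_of_nat_mult)
  have 1: "klein (1/2) 0 \<tau> = qexp (\<tau> / 8) * qexp (- (\<tau> / 4)) * qpoch_inf ?s ?q ^ 2"
  proof -
    have "\<tau> - \<tau> / 2 = \<tau> / 2" by simp
    thus ?thesis
      unfolding klein_def theta_def by (simp add: power2_eq_square)
  qed
  have 2: "klein 0 (1/2) \<tau> = qexp (-1/4) * (2 * qpoch_inf (-?q) ?q ^ 2)"
    unfolding klein_def theta_def using qpoch_inf_rec[OF q, of "-1"]
    by (simp add: power2_eq_square half minus)
  have 3: "klein (1/2) (1/2) \<tau> = qexp ((\<tau> / 2 + 1/2) / 4) * qexp (- (\<tau> / 2 + 1/2) / 2) * qpoch_inf (-?s) ?q ^ 2"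
  proof -
    have "\<tau> - (\<tau> / 2 + 1/2) = \<tau> / 2 - 1/2" by simp
    thus ?thesis
      unfolding klein_def theta_def
      by (simp add: power2_eq_square minus)
  qed
  have "qpoch_inf ?s ?q * qpoch_inf (-?s) ?q * qpoch_inf (-?q) ?q = 1"
  proof -
    have q2: "norm (?q ^ 2) < 1"
      using q by (simp add: norm_power_less_1)
    have "qpoch_inf ?s ?q * qpoch_inf (-?s) ?q = qpoch_inf ?q (?q ^ 2)"
      using qpoch_inf_mult_minus[OF q, of ?s] by (simp add: s2)
    moreover have "qpoch_inf ?q ?q = qpoch_inf ?q (?q ^ 2) * qpoch_inf (?q ^ 2) (?q ^ 2)"
      using qpoch_inf_dissect[OF q, of ?q] by (simp add: power2_eq_square)
    ultimately show ?thesis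
      using q q2 qpoch_inf_neq_0_norm_less_1[OF q2 q] by (simp add: qpoch_inf_minus_q)
  qed
  moreover have "klein_quot torsion_list \<tau> = 2 * (qexp (\<tau> / 8) * qexp (- (\<tau> / 4)) * qexp (-1/4) *
      qexp ((\<tau> / 2 + 1/2) / 4) * qexp (- (\<tau> / 2 + 1/2) / 2)) *
      (qpoch_inf ?s ?q * qpoch_inf (-?s) ?q * qpoch_inf (-?q) ?q) ^ 2"
    unfolding torsion_list_def klein_quot_Cons klein_quot_Nil power_int_1_right 1 2 3 power_mult_distrib
    by (simp only: mult_ac mult_1_right mult_1_left)
  moreover have "qexp (\<tau> / 8) * qexp (- (\<tau> / 4)) * qexp (-1/4) *
      qexp ((\<tau> / 2 + 1/2) / 4) * qexp (- (\<tau> / 2 + 1/2) / 2) =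
      qexp (-3/8) * qexp (-\<tau> / 4)"
    unfolding qexp_add[symmetric] by (rule arg_cong[of _ _ qexp]) (simp add: field_simps)
  ultimately show ?thesis
    by simp
qed

lemma klein_16:
  assumes \<tau>: "Im \<tau> > 0" and r: "r \<le> 16"
  shows "klein (of_nat r / 16) 0 (8 * \<tau>) = qexp ((of_nat (r ^ 2) / 64 - of_nat r / 4) * \<tau>) *
     (qpoch_inf (qexp (\<tau> / 2) ^ r) (qexp (\<tau> / 2) ^ 16) * qpoch_inf (qexp (\<tau> / 2) ^ (16 - r)) (qexp (\<tau> / 2) ^ 16))"
proof -
  let ?x = "of_nat r / 16 :: complex"
  have "qexp (\<tau> / 2) ^ 16 = qexp (8 * \<tau>)" "qexp (\<tau> / 2) ^ r = qexp (?x * (8 * \<tau>))"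
    "qexp (\<tau> / 2) ^ (16 - r) = qexp (8 * \<tau> - ?x * (8 * \<tau>))"
    using r unfolding qexp_of_nat_mult[symmetric] by (simp_all add: of_nat_diff field_simps)
  moreover have "klein (of_nat r / 16) 0 (8 * \<tau>) = qexp (?x * (?x * (8 * \<tau>)) / 2 + (- (?x * (8 * \<tau>)) / 2)) *
      (qpoch_inf (qexp (?x * (8 * \<tau>))) (qexp (8 * \<tau>)) * qpoch_inf (qexp (8 * \<tau> - ?x * (8 * \<tau>))) (qexp (8 * \<tau>)))"
    unfolding klein_def theta_def qexp_add by simp
  moreover have "?x * (?x * (8 * \<tau>)) / 2 + (- (?x * (8 * \<tau>)) / 2) = (of_nat (r ^ 2) / 64 - of_nat r / 4) * \<tau>"
    by (simp add: field_simps power2_eq_square)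
  ultimately show ?thesis by simp
qed

text \<open>The exponents r, 8 + r and 8 - r, 16 - r modulo 16 are the full classes of r and 8 - r
  modulo 8.\<close>

lemma klein_16_pair:
  assumes \<tau>: "Im \<tau> > 0" and r: "r \<le> 8"
  shows "klein (of_nat r / 16) 0 (8 * \<tau>) * klein (of_nat (8 - r) / 16) 0 (8 * \<tau>) =
     qexp ((of_nat (r ^ 2 + (8 - r) ^ 2) / 64 - 2) * \<tau>) *
     (qpoch_inf (qexp (\<tau> / 2) ^ r) (qexp (\<tau> / 2) ^ 8) * qpoch_inf (qexp (\<tau> / 2) ^ (8 - r)) (qexp (\<tau> / 2) ^ 8))"
proof -
  let ?s = "qexp (\<tau> / 2)"
  have s: "norm ?s < 1"
    using \<tau> by (intro norm_qexp_less_1) auto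
  have dis: "qpoch_inf (?s ^ k) (?s ^ 8) = qpoch_inf (?s ^ k) (?s ^ 16) * qpoch_inf (?s ^ (k + 8)) (?s ^ 16)" for k
    using qpoch_inf_dissect[OF norm_power_less_1[OF s, of 8], of "?s ^ k"] by (simp flip: power_mult power_add)
  have sub: "16 - (8 - r) = r + 8" "8 - r + 8 = 16 - r"
    using r by auto
  have "(of_nat (r ^ 2) / 64 - of_nat r / 4) * \<tau> + (of_nat ((8 - r) ^ 2) / 64 - of_nat (8 - r) / 4) * \<tau> =
        (of_nat (r ^ 2 + (8 - r) ^ 2) / 64 - 2) * \<tau>"
    using r by (simp add: of_nat_diff add_divide_distrib diff_divide_distrib algebra_simps)
  hence e: "qexp ((of_nat (r ^ 2) / 64 - of_nat r / 4) * \<tau>) * qexp ((of_nat ((8 - r) ^ 2) / 64 - of_nat (8 - r) / 4) * \<tau>)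
      = qexp ((of_nat (r ^ 2 + (8 - r) ^ 2) / 64 - 2) * \<tau>)"
    by (metis qexp_add)
  have r16: "r \<le> 16" "8 - r \<le> 16"
    using r by auto
  show ?thesis
    unfolding klein_16[OF \<tau> r16(1)] klein_16[OF \<tau> r16(2)] dis e[symmetric] sub by (simp only: mult_ac)
qed

text \<open>The exponents 4 and 12 modulo 16 already fill the class of 4 modulo 8, so one Klein form
  does the work of a pair.\<close>

lemma klein_quarter:
  assumes \<tau>: "Im \<tau> > 0"
  shows "klein (1/4) 0 (8 * \<tau>) = qexp (- 3 / 4 * \<tau>) * qpoch_inf (qexp (\<tau> / 2) ^ 4) (qexp (\<tau> / 2) ^ 8)"
proof -
  let ?s = "qexp (\<tau> / 2)"
  have s: "norm ?s < 1"
    using \<tau> by (intro norm_qexp_less_1) auto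
  have "qpoch_inf (?s ^ 4) (?s ^ 8) = qpoch_inf (?s ^ 4) (?s ^ 16) * qpoch_inf (?s ^ 12) (?s ^ 16)"
    using qpoch_inf_dissect[OF norm_power_less_1[OF s, of 8], of "?s ^ 4"] by (simp flip: power_mult power_add)
  thus ?thesis
    using klein_16[OF \<tau>, of 4] by simp
qed

text \<open>The exponent of q is -1/32, 1/8, 7/32 for r = 1, 2, 3: exactly the values of C that
  accompany these products.\<close>

lemma klein_quot_triple:
  assumes \<tau>: "Im \<tau> > 0" and r: "r \<le> 8"
  shows "klein_quot (torsion_list @ triple_list r) (8 * \<tau>) = 2 * qexp (-3/8) *
     (qexp ((1 - of_nat (r ^ 2 + (8 - r) ^ 2 + 16) / 64) * \<tau>) *
      (1 / (qpoch_inf (qexp (\<tau> / 2) ^ r) (qexp (\<tau> / 2) ^ 8) * qpoch_inf (qexp (\<tau> / 2) ^ (8 - r)) (qexp (\<tau> / 2) ^ 8) *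
       qpoch_inf (qexp (\<tau> / 2) ^ 4) (qexp (\<tau> / 2) ^ 8))))"
proof -
  let ?s = "qexp (\<tau> / 2)"
  let ?n = "of_nat (r ^ 2 + (8 - r) ^ 2) :: complex"
  define X where "X = qpoch_inf (?s ^ r) (?s ^ 8) * qpoch_inf (?s ^ (8 - r)) (?s ^ 8)"
  define Y where "Y = qpoch_inf (?s ^ 4) (?s ^ 8)"
  have tors: "klein_quot torsion_list (8 * \<tau>) = 2 * qexp (-3/8) * qexp (-2 * \<tau>)"
    using klein_quot_torsion[of "8 * \<tau>"] \<tau> by simp
  have "klein_quot (triple_list r) (8 * \<tau>) = inverse (klein (of_nat r / 16) 0 (8 * \<tau>) * 
      klein (of_nat (8 - r) / 16) 0 (8 * \<tau>)) * inverse (klein (1/4) 0 (8 * \<tau>))"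
    unfolding triple_list_def by (simp add: power_int_minus mult_ac)
  also have "\<dots> = qexp (- ((?n / 64 - 2) * \<tau>)) * qexp (- (- 3 / 4 * \<tau>)) * (1 / (X * Y))"
  proof -
    have gen: "inverse (u * x) * inverse (v * y) = inverse u * inverse v * (1 / (x * y))" for u v x y :: complex
      by (simp add: divide_inverse)
    show ?thesis
      unfolding klein_16_pair[OF \<tau> r] klein_quarter[OF \<tau>] X_def[symmetric] Y_def[symmetric] qexp_minus
      by (rule gen)
  qed
  finally have "klein_quot (torsion_list @ triple_list r) (8 * \<tau>) = 2 * qexp (-3/8) *
      (qexp (-2 * \<tau>) * qexp (- ((?n / 64 - 2) * \<tau>)) * qexp (- (- 3 / 4 * \<tau>)) * (1 / (X * Y)))"
    unfolding klein_quot_append tors by (simp only: mult_ac)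
  also have "qexp (-2 * \<tau>) * qexp (- ((?n / 64 - 2) * \<tau>)) * qexp (- (- 3 / 4 * \<tau>)) =
       qexp ((1 - of_nat (r ^ 2 + (8 - r) ^ 2 + 16) / 64) * \<tau>)"
    unfolding qexp_add[symmetric] of_nat_add[of "r ^ 2 + (8 - r) ^ 2"]
    by (rule arg_cong[of _ _ qexp]) (simp add: algebra_simps add_divide_distrib)
  finally show ?thesis
    unfolding X_def Y_def .
qed

text \<open>The exponents -2, -3/4 and 11/4 of q cancel, in accordance with C = 0.\<close>

lemma klein_quot_sextuple:
  assumes \<tau>: "Im \<tau> > 0"
  shows "klein_quot (torsion_list @ sextuple_list) (8 * \<tau>) = 2 * qexp (-3/8) *
     (qpoch_inf (qexp (\<tau> / 2) ^ 4) (qexp (\<tau> / 2) ^ 8) /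
      (qpoch_inf (qexp (\<tau> / 2) ^ 2) (qexp (\<tau> / 2) ^ 8) * qpoch_inf (qexp (\<tau> / 2) ^ 6) (qexp (\<tau> / 2) ^ 8)) ^ 2)"
proof -
  let ?s = "qexp (\<tau> / 2)"
  define X where "X = qpoch_inf (?s ^ 2) (?s ^ 8) * qpoch_inf (?s ^ 6) (?s ^ 8)"
  define Y where "Y = qpoch_inf (?s ^ 4) (?s ^ 8)"
  have tors: "klein_quot torsion_list (8 * \<tau>) = 2 * qexp (-3/8) * qexp (-2 * \<tau>)"
    using klein_quot_torsion[of "8 * \<tau>"] \<tau> by simp
  have pair: "klein (1/8) 0 (8 * \<tau>) * klein (3/8) 0 (8 * \<tau>) = qexp (- 11 / 8 * \<tau>) * X"
    using klein_16_pair[OF \<tau>, of 2] by (simp add: X_def)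
  have "klein_quot sextuple_list (8 * \<tau>) =
      klein (1/4) 0 (8 * \<tau>) * (klein (1/8) 0 (8 * \<tau>) * klein (3/8) 0 (8 * \<tau>)) powi (-2)"
    unfolding sextuple_list_def klein_quot_Cons klein_quot_Nil power_int_mult_distrib
    by (simp only: power_int_1_right mult_1_right)
  also have "\<dots> = qexp (- 3 / 4 * \<tau>) * qexp (11 / 4 * \<tau>) * (Y / X ^ 2)"
  proof -
    have "qexp (- 11 / 8 * \<tau>) powi (-2) = qexp (11 / 4 * \<tau>)"
      unfolding qexp_power_int by (rule arg_cong[of _ _ qexp]) simp
    moreover have "X powi (-2) = inverse (X ^ 2)"
      by (simp add: power_int_minus)
    ultimately show ?thesis
      unfolding pair klein_quarter[OF \<tau>] Y_def[symmetric] power_int_mult_distrib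
      by (simp only: divide_inverse mult_ac)
  qed
  finally have "klein_quot (torsion_list @ sextuple_list) (8 * \<tau>) = 2 * qexp (-3/8) *
      (qexp (-2 * \<tau>) * qexp (- 3 / 4 * \<tau>) * qexp (11 / 4 * \<tau>) * (Y / X ^ 2))"
    unfolding klein_quot_append tors by (simp only: mult_ac)
  also have "qexp (-2 * \<tau>) * qexp (- 3 / 4 * \<tau>) * qexp (11 / 4 * \<tau>) = 1"
  proof -
    have "-2 * \<tau> + - 3 / 4 * \<tau> + 11 / 4 * \<tau> = 0"
      by (simp add: field_simps)
    thus ?thesis
      by (simp only: qexp_add[symmetric] qexp_0)
  qed
  finally show ?thesis
    unfolding X_def Y_def by simp
qed

section \<open>From Nahm sums to product formulas\<close>

text \<open>Apart from C the exponents are half-integers, hence the bookkeeping in powers of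
  e(\<tau>/2), with \<open>E i j\<close> twice the exponent.\<close>

lemma nahm_sum_has_sum:
  assumes E: "\<And>i j. nahm_exponent A B C (vector [i, j]) = of_nat (E i j) / 2 + C"
    and sum: "((\<lambda>(i, j). qexp (\<tau> / 2) ^ E i j / (qpoch (qexp \<tau>) (qexp \<tau>) i * qpoch (qexp \<tau>) (qexp \<tau>) j)) has_sum S) UNIV"
  shows "nahm_sum A B C \<tau> = qexp (of_rat C * \<tau>) * S"
proof -
  let ?q = "qexp \<tau>" and ?s = "qexp (\<tau> / 2)"
  have vec: "vector [n $ 1, n $ 2] = n" for n :: "nat^2"
    by (simp add: vec_eq_iff forall_2)
  have expo: "exp (2 * of_real pi * \<i> * of_rat (nahm_exponent A B C (vector [i, j])) * \<tau>) =
      qexp (of_rat C * \<tau>) * ?s ^ E i j" for i j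
  proof -
    have "exp (2 * of_real pi * \<i> * of_rat (nahm_exponent A B C (vector [i, j])) * \<tau>) =
          qexp (of_rat C * \<tau> + of_nat (E i j) * (\<tau> / 2))"
      unfolding E qexp_def by (rule arg_cong[of _ _ exp]) (simp add: of_rat_add of_rat_divide algebra_simps)
    thus ?thesis
      by (simp only: qexp_add qexp_of_nat_mult)
  qed
  have "((\<lambda>(i, j). qexp (of_rat C * \<tau>) * (?s ^ E i j / (qpoch ?q ?q i * qpoch ?q ?q j))) has_sum
      qexp (of_rat C * \<tau>) * S) UNIV"
    using has_sum_cmult_right[OF sum, of "qexp (of_rat C * \<tau>)"] by (simp add: case_prod_unfold)
  also have "?this \<longleftrightarrow> ((\<lambda>n. exp (2 * of_real pi * \<i> * of_rat (nahm_exponent A B C n) * \<tau>)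
           / (qpoch ?q ?q (n $ 1) * qpoch ?q ?q (n $ 2))) has_sum qexp (of_rat C * \<tau>) * S) UNIV"
    by (rule has_sum_reindex_bij_witness[of _ "\<lambda>n :: nat^2. (n $ 1, n $ 2)" "\<lambda>(i, j). vector [i, j]"])
       (auto simp: vec expo)
  finally show ?thesis
    unfolding nahm_sum_def Let_def qexp_def by (rule infsumI)
qed

abbreviation (input) "nahm_matrix \<equiv> (vector [vector [2, 1], vector [1, 1]] :: rat^2^2)"

lemma nahm_exponent_eq:
  fixes b1 b2 C :: rat
  shows "nahm_exponent nahm_matrix (vector [b1, b2]) C (vector [i, j]) =
    (2 * of_nat i ^ 2 + 2 * of_nat i * of_nat j + of_nat j ^ 2 + 2 * of_nat i * b1 + 2 * of_nat j * b2) / 2 + C"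
  by (simp add: nahm_exponent_def Let_def sum_2 matrix_vector_mult_def power2_eq_square field_simps)

lemma denom_eqI:
  assumes "x = of_int a / of_int b" "b > 0" "coprime a b"
  shows "denom x = b"
proof -
  have "quotient_of x = (a, b)"
    using assms by (simp add: quotient_of_div quotient_of_Fract normalize_def Fract_of_int_quotient[symmetric] coprime_iff_gcd_eq_1)
  thus ?thesis by (simp add: denom_def)
qed

lemma denom_values: "denom (1/8) = 8" "denom (-(1/32)) = 32" "denom 0 = 1" "denom (7/32) = 32"
proof -
  show "denom (1/8) = 8" by (rule denom_eqI[of _ 1]) auto
  show "denom (-(1/32)) = 32" by (rule denom_eqI[of _ "-1"]) auto
  show "denom 0 = 1" by (rule denom_eqI[of _ 0]) auto
  have "coprime (7::int) 32"
  proof (rule coprimeI)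
    fix c :: int assume "c dvd 7" "c dvd 32"
    hence "c dvd 2 * 32 - 9 * 7"
      by (intro dvd_diff dvd_mult)
    thus "is_unit c" by simp
  qed
  thus "denom (7/32) = 32" by (intro denom_eqI[of _ 7]) auto
qed

lemma double_half_square_add: "2 * ((j ^ 2 + j) div 2) = j ^ 2 + (j::nat)"
  by (rule dvd_mult_div_cancel) (simp add: power2_eq_square)

lemma nahm_sum_product_half:
  assumes \<tau>: "Im \<tau> > 0" and b1: "b1 \<in> {-1, 0, 1}"
    and sum: "((\<lambda>(i, j). qexp \<tau> ^ E i j / (qpoch (qexp \<tau>) (qexp \<tau>) i * qpoch (qexp \<tau>) (qexp \<tau>) j)) has_sum S) UNIV"
    and E: "\<And>i j. int (2 * E i j) = 2 * int i ^ 2 + 2 * int i * int j + int j ^ 2 + int j + 2 * b1 * int i"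
  shows "nahm_sum nahm_matrix (vector [of_int b1, 1/2]) C \<tau> = qexp (of_rat C * \<tau>) * S"
proof (rule nahm_sum_has_sum)
  show "nahm_exponent nahm_matrix (vector [of_int b1, 1/2]) C (vector [i, j]) = of_nat (2 * E i j) / 2 + C" for i j
  proof -
    have "(of_nat (2 * E i j) :: rat) = of_int (int (2 * E i j))"
      by (simp only: of_int_of_nat_eq)
    thus ?thesis
      unfolding nahm_exponent_eq E by simp
  qed
  have "qexp (\<tau> / 2) ^ (2 * k) = qexp \<tau> ^ k" for k
    unfolding power_mult by (simp flip: qexp_of_nat_mult)
  with sum show "((\<lambda>(i, j). qexp (\<tau> / 2) ^ (2 * E i j) / (qpoch (qexp \<tau>) (qexp \<tau>) i * qpoch (qexp \<tau>) (qexp \<tau>) j)) has_sum S) UNIV"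
    by (simp only:)
qed

lemma nahm_sum_product_whole:
  assumes sum: "((\<lambda>(i, j). qexp (\<tau> / 2) ^ E i j / (qpoch (qexp (\<tau> / 2) ^ 2) (qexp (\<tau> / 2) ^ 2) i *
      qpoch (qexp (\<tau> / 2) ^ 2) (qexp (\<tau> / 2) ^ 2) j)) has_sum S) UNIV"
    and E: "\<And>i j. E i j = 2 * i ^ 2 + 2 * i * j + j ^ 2 + 2 * b * i + 2 * b * j"
  shows "nahm_sum nahm_matrix (vector [of_nat b, of_nat b]) C \<tau> = qexp (of_rat C * \<tau>) * S"
proof (rule nahm_sum_has_sum)
  show "nahm_exponent nahm_matrix (vector [of_nat b, of_nat b]) C (vector [i, j]) = of_nat (E i j) / 2 + C" for i j
    unfolding nahm_exponent_eq E by (simp add: mult_ac)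
  have "qexp (\<tau> / 2) ^ 2 = qexp \<tau>"
    by (simp flip: qexp_of_nat_mult)
  with sum show "((\<lambda>(i, j). qexp (\<tau> / 2) ^ E i j / (qpoch (qexp \<tau>) (qexp \<tau>) i * qpoch (qexp \<tau>) (qexp \<tau>) j)) has_sum S) UNIV"
    by (simp only:)
qed

lemma qpoch_inf_q_quarter:
  assumes q: "norm q < 1"
  shows "qpoch_inf q q = qpoch_inf q (q ^ 4) * qpoch_inf (q ^ 3) (q ^ 4) * qpoch_inf (q ^ 2) (q ^ 4) * qpoch_inf (q ^ 4) (q ^ 4)"
proof -
  have "qpoch_inf q q = qpoch_inf q (q ^ 2) * qpoch_inf (q ^ 2) (q ^ 2)"
    using qpoch_inf_dissect[OF q, of q] by (simp add: power2_eq_square)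
  also have "qpoch_inf q (q ^ 2) = qpoch_inf q (q ^ 4) * qpoch_inf (q ^ 3) (q ^ 4)"
    using qpoch_inf_dissect[OF norm_power_less_1[OF q, of 2], of q] by (simp flip: power_mult power_Suc)
  also have "qpoch_inf (q ^ 2) (q ^ 2) = qpoch_inf (q ^ 2) (q ^ 4) * qpoch_inf (q ^ 4) (q ^ 4)"
    using qpoch_inf_even_odd[OF q, of 2] by simp
  finally show ?thesis by (simp add: mult_ac)
qed

lemma eta_quotient_1:
  assumes \<tau>: "Im \<tau> > 0"
  shows "qexp (1/8 * \<tau>) * (qpoch_inf (qexp \<tau> ^ 4) (qexp \<tau> ^ 4) / qpoch_inf (qexp \<tau>) (qexp \<tau>)) =
           inverse (2 * qexp (-3/8)) * klein_quot (torsion_list @ triple_list 2) (8 * \<tau>)"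
proof -
  have q: "norm (qexp \<tau>) < 1"
    using \<tau> by (rule norm_qexp_less_1)
  have s: "qexp (\<tau> / 2) ^ 2 = qexp \<tau>" "qexp (\<tau> / 2) ^ 8 = qexp \<tau> ^ 4" "qexp (\<tau> / 2) ^ 6 = qexp \<tau> ^ 3"
    "qexp (\<tau> / 2) ^ 4 = qexp \<tau> ^ 2"
    by (simp_all flip: qexp_of_nat_mult)
  have "qpoch_inf (qexp \<tau> ^ 4) (qexp \<tau> ^ 4) / qpoch_inf (qexp \<tau>) (qexp \<tau>) =
      1 / (qpoch_inf (qexp \<tau>) (qexp \<tau> ^ 4) * qpoch_inf (qexp \<tau> ^ 3) (qexp \<tau> ^ 4) * qpoch_inf (qexp \<tau> ^ 2) (qexp \<tau> ^ 4))"
    unfolding qpoch_inf_q_quarter[OF q] using qpoch_inf_power_neq_0[OF q, of 4 4] by simp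
  thus ?thesis
    using klein_quot_triple[OF \<tau>, of 2] by (simp add: s)
qed

lemma eta_quotient_3:
  assumes \<tau>: "Im \<tau> > 0"
  shows "(qpoch_inf (qexp \<tau> ^ 2) (qexp \<tau> ^ 2))^3 / ((qpoch_inf (qexp \<tau>) (qexp \<tau>))^2 * qpoch_inf (qexp \<tau> ^ 4) (qexp \<tau> ^ 4)) =
           inverse (2 * qexp (-3/8)) * klein_quot (torsion_list @ sextuple_list) (8 * \<tau>)"
proof -
  have q: "norm (qexp \<tau>) < 1"
    using \<tau> by (rule norm_qexp_less_1)
  have s: "qexp (\<tau> / 2) ^ 2 = qexp \<tau>" "qexp (\<tau> / 2) ^ 8 = qexp \<tau> ^ 4" "qexp (\<tau> / 2) ^ 6 = qexp \<tau> ^ 3"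
    "qexp (\<tau> / 2) ^ 4 = qexp \<tau> ^ 2"
    by (simp_all flip: qexp_of_nat_mult)
  have "qpoch_inf (qexp \<tau> ^ 2) (qexp \<tau> ^ 2) = qpoch_inf (qexp \<tau> ^ 2) (qexp \<tau> ^ 4) * qpoch_inf (qexp \<tau> ^ 4) (qexp \<tau> ^ 4)"
    using qpoch_inf_even_odd[OF q, of 2] by simp
  hence "(qpoch_inf (qexp \<tau> ^ 2) (qexp \<tau> ^ 2))^3 / ((qpoch_inf (qexp \<tau>) (qexp \<tau>))^2 * qpoch_inf (qexp \<tau> ^ 4) (qexp \<tau> ^ 4)) =
      qpoch_inf (qexp \<tau> ^ 2) (qexp \<tau> ^ 4) / (qpoch_inf (qexp \<tau>) (qexp \<tau> ^ 4) * qpoch_inf (qexp \<tau> ^ 3) (qexp \<tau> ^ 4)) ^ 2"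
    unfolding qpoch_inf_q_quarter[OF q] using qpoch_inf_power_neq_0[OF q, of 4 4] qpoch_inf_power_neq_0[OF q, of 2 4]
    by (simp add: power2_eq_square power3_eq_cube)
  thus ?thesis
    using klein_quot_sextuple[OF \<tau>] by (simp add: s)
qed

section \<open>Modularity of the five Nahm sums\<close>

lemma triple_list_Ints:
  assumes "r \<in> {1, 2, 3}"
  shows "\<forall>(x, y, k)\<in>set (torsion_list @ triple_list r). x \<notin> \<int> \<or> y \<notin> \<int>"
    and "\<forall>(x, y, k)\<in>set (torsion_list @ triple_list r). x * of_nat 16 \<in> \<int> \<and> y * of_nat 16 \<in> \<int>"
proof -
  have nonint: "x \<notin> \<int>" if "0 < x" "x < 1" for x :: real
    using that by (auto elim!: Ints_cases)
  show "\<forall>(x, y, k)\<in>set (torsion_list @ triple_list r). x \<notin> \<int> \<or> y \<notin> \<int>"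
    using assms by (auto simp: torsion_list_def triple_list_def intro!: nonint)
  show "\<forall>(x, y, k)\<in>set (torsion_list @ triple_list r). x * of_nat 16 \<in> \<int> \<and> y * of_nat 16 \<in> \<int>"
    using assms by (auto simp: torsion_list_def triple_list_def)
qed

lemma sextuple_list_Ints:
  "\<forall>(x, y, k)\<in>set (torsion_list @ sextuple_list). x \<notin> \<int> \<or> y \<notin> \<int>"
  "\<forall>(x, y, k)\<in>set (torsion_list @ sextuple_list). x * of_nat 8 \<in> \<int> \<and> y * of_nat 8 \<in> \<int>"
proof -
  have nonint: "x \<notin> \<int>" if "0 < x" "x < 1" for x :: real
    using that by (auto elim!: Ints_cases)
  show "\<forall>(x, y, k)\<in>set (torsion_list @ sextuple_list). x \<notin> \<int> \<or> y \<notin> \<int>"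
    by (auto simp: torsion_list_def sextuple_list_def intro!: nonint)
  show "\<forall>(x, y, k)\<in>set (torsion_list @ sextuple_list). x * of_nat 8 \<in> \<int> \<and> y * of_nat 8 \<in> \<int>"
    by (auto simp: torsion_list_def sextuple_list_def)
qed

text \<open>In each pair M is 8 denom(C) for the C belonging to r: one factor 8 comes from the Klein
  quotient at 8\<tau>, the other from the substitution of q^denom(C) for q.\<close>

lemma modular_function_triple:
  assumes rM: "(r, M) \<in> {(1, 256), (2, 64), (3, 256)}" and N: "N = 4 * M"
    and f: "\<And>\<tau>. Im \<tau> > 0 \<Longrightarrow> f \<tau> = K * klein_quot (torsion_list @ triple_list r) (of_nat M * \<tau>)"
  shows "modular_function_on (Gamma1 N) f"
proof (rule modular_function_klein_quot[where ws = "torsion_list @ triple_list r" and M = M and D = 16 and K = K])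
  show "\<forall>(x, y, k)\<in>set (torsion_list @ triple_list r). x \<notin> \<int> \<or> y \<notin> \<int>"
    "\<forall>(x, y, k)\<in>set (torsion_list @ triple_list r). x * of_nat 16 \<in> \<int> \<and> y * of_nat 16 \<in> \<int>"
    using rM by (intro triple_list_Ints; auto)+
  show "(\<Sum>(x, y, k)\<leftarrow>torsion_list @ triple_list r. k) = 0"
    by (simp add: torsion_list_def triple_list_def)
  fix a b c d :: int and \<tau> :: complex
  assume *: "int (4 * M) dvd a - 1" "int (4 * M) dvd d - 1" "int M dvd b" "4 dvd c" "Im \<tau> > 0"
  have M8: "8 dvd M"
    using rM by auto
  hence "8 dvd int M" "8 dvd int (4 * M)"
    by (auto simp: int_dvd_int_iff[of 8, simplified])
  hence "klein_quot (act a b c d torsion_list) \<tau> = klein_quot torsion_list \<tau>"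
    using * by (intro torsion_list_act) (auto intro: dvd_trans)
  moreover have "32 dvd M * r" "32 dvd M * (8 - r)" "512 dvd M * (r ^ 2 + (8 - r) ^ 2 + 16)"
    using rM by auto
  hence "klein_quot (act a b c d (triple_list r)) \<tau> = klein_quot (triple_list r) \<tau>"
    using * M8 by (intro triple_list_act[of _ M]) auto
  ultimately show "klein_quot (act a b c d (torsion_list @ triple_list r)) \<tau> = klein_quot (torsion_list @ triple_list r) \<tau>"
    by simp
qed (use rM N f in auto)

lemma modular_function_sextuple:
  assumes f: "\<And>\<tau>. Im \<tau> > 0 \<Longrightarrow> f \<tau> = K * klein_quot (torsion_list @ sextuple_list) (8 * \<tau>)"
  shows "modular_function_on (Gamma1 32) f"
proof (rule modular_function_klein_quot[where ws = "torsion_list @ sextuple_list" and M = 8 and D = 8 and K = K])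
  show "(\<Sum>(x, y, k)\<leftarrow>torsion_list @ sextuple_list. k) = 0"
    by (simp add: torsion_list_def sextuple_list_def)
  fix a b c d :: int and \<tau> :: complex
  assume *: "int (4 * 8) dvd a - 1" "int (4 * 8) dvd d - 1" "int 8 dvd b" "4 dvd c" "Im \<tau> > 0"
  have "(8::int) dvd int (4 * 8)" by simp
  hence "klein_quot (act a b c d torsion_list) \<tau> = klein_quot torsion_list \<tau>"
    using * by (intro torsion_list_act) (auto intro: dvd_trans)
  moreover have "klein_quot (act a b c d sextuple_list) \<tau> = klein_quot sextuple_list \<tau>"
    using * by (intro sextuple_list_act) auto
  ultimately show "klein_quot (act a b c d (torsion_list @ sextuple_list)) \<tau> = klein_quot (torsion_list @ sextuple_list) \<tau>"
    by simp
qed (use f sextuple_list_Ints in auto)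

lemma modular_nahm_1:
  "modular_function_on (Gamma1 256) (\<lambda>\<tau>. nahm_sum nahm_matrix (vector [-1, 1/2]) (1/8) (8 * \<tau>))"
proof (rule modular_function_triple[where r = 2 and M = 64 and K = "2 * inverse (2 * qexp (-3/8))"])
  fix \<tau> :: complex assume "Im \<tau> > 0"
  hence \<tau>: "Im (8 * \<tau>) > 0" by simp
  have expo: "int (2 * (i ^ 2 - i + i * j + (j ^ 2 + j) div 2)) =
      2 * int i ^ 2 + 2 * int i * int j + int j ^ 2 + int j + 2 * (-1) * int i" for i j :: nat
  proof -
    have "i \<le> i ^ 2" by (cases i) (auto simp: power2_eq_square)
    moreover have "int (2 * ((j ^ 2 + j) div 2)) = int (j ^ 2 + j)"
      unfolding double_half_square_add ..
    ultimately show ?thesis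
      by (simp add: of_nat_diff algebra_simps)
  qed
  have "nahm_sum nahm_matrix (vector [of_int (-1), 1/2]) (1/8) (8 * \<tau>) = qexp (of_rat (1/8) * (8 * \<tau>)) *
      (2 * (qpoch_inf (qexp (8 * \<tau>) ^ 4) (qexp (8 * \<tau>) ^ 4) / qpoch_inf (qexp (8 * \<tau>)) (qexp (8 * \<tau>))))"
    by (rule nahm_sum_product_half[OF \<tau> _ nahm_identity_1[OF norm_qexp_less_1[OF \<tau>]] expo]) simp
  thus "nahm_sum nahm_matrix (vector [-1, 1/2]) (1/8) (8 * \<tau>) =
     2 * inverse (2 * qexp (-3/8)) * klein_quot (torsion_list @ triple_list 2) (of_nat 64 * \<tau>)"
    using eta_quotient_1[OF \<tau>] by (simp add: of_rat_divide mult_ac)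
qed auto

lemma modular_nahm_4:
  "modular_function_on (Gamma1 256) (\<lambda>\<tau>. nahm_sum nahm_matrix (vector [1, 1/2]) (1/8) (8 * \<tau>))"
proof (rule modular_function_triple[where r = 2 and M = 64 and K = "inverse (2 * qexp (-3/8))"])
  fix \<tau> :: complex assume "Im \<tau> > 0"
  hence \<tau>: "Im (8 * \<tau>) > 0" by simp
  have expo: "int (2 * (i ^ 2 + i * j + (j ^ 2 + j) div 2 + i)) =
      2 * int i ^ 2 + 2 * int i * int j + int j ^ 2 + int j + 2 * 1 * int i" for i j :: nat
  proof -
    have "int (2 * ((j ^ 2 + j) div 2)) = int (j ^ 2 + j)"
      unfolding double_half_square_add ..
    thus ?thesis
      by (simp add: algebra_simps)
  qed
  have "nahm_sum nahm_matrix (vector [of_int 1, 1/2]) (1/8) (8 * \<tau>) = qexp (of_rat (1/8) * (8 * \<tau>)) *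
      (qpoch_inf (qexp (8 * \<tau>) ^ 4) (qexp (8 * \<tau>) ^ 4) / qpoch_inf (qexp (8 * \<tau>)) (qexp (8 * \<tau>)))"
    by (rule nahm_sum_product_half[OF \<tau> _ nahm_identity_4[OF norm_qexp_less_1[OF \<tau>]] expo]) simp
  thus "nahm_sum nahm_matrix (vector [1, 1/2]) (1/8) (8 * \<tau>) =
     inverse (2 * qexp (-3/8)) * klein_quot (torsion_list @ triple_list 2) (of_nat 64 * \<tau>)"
    using eta_quotient_1[OF \<tau>] by (simp add: of_rat_divide mult_ac)
qed auto

lemma modular_nahm_3:
  "modular_function_on (Gamma1 32) (\<lambda>\<tau>. nahm_sum nahm_matrix (vector [0, 1/2]) 0 \<tau>)"
proof (rule modular_function_sextuple[where K = "inverse (2 * qexp (-3/8))"])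
  fix \<tau> :: complex assume \<tau>: "Im \<tau> > 0"
  have expo: "int (2 * (i ^ 2 + i * j + (j ^ 2 + j) div 2)) =
      2 * int i ^ 2 + 2 * int i * int j + int j ^ 2 + int j + 2 * 0 * int i" for i j :: nat
  proof -
    have "int (2 * ((j ^ 2 + j) div 2)) = int (j ^ 2 + j)"
      unfolding double_half_square_add ..
    thus ?thesis
      by (simp add: algebra_simps)
  qed
  have "nahm_sum nahm_matrix (vector [of_int 0, 1/2]) 0 \<tau> = qexp (of_rat 0 * \<tau>) *
      ((qpoch_inf (qexp \<tau> ^ 2) (qexp \<tau> ^ 2))^3 / ((qpoch_inf (qexp \<tau>) (qexp \<tau>))^2 * qpoch_inf (qexp \<tau> ^ 4) (qexp \<tau> ^ 4)))"
    by (rule nahm_sum_product_half[OF \<tau> _ nahm_identity_3[OF norm_qexp_less_1[OF \<tau>]] expo]) simp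
  thus "nahm_sum nahm_matrix (vector [0, 1/2]) 0 \<tau> =
     inverse (2 * qexp (-3/8)) * klein_quot (torsion_list @ sextuple_list) (8 * \<tau>)"
    using eta_quotient_3[OF \<tau>] by simp
qed

lemma modular_nahm_2:
  "modular_function_on (Gamma1 1024) (\<lambda>\<tau>. nahm_sum nahm_matrix (vector [0, 0]) (-1/32) (32 * \<tau>))"
proof (rule modular_function_triple[where r = 1 and M = 256 and K = "inverse (2 * qexp (-3/8))"])
  fix \<tau> :: complex assume "Im \<tau> > 0"
  hence \<tau>: "Im (32 * \<tau>) > 0" "Im (32 * \<tau> / 2) > 0" by simp_all
  let ?s = "qexp (32 * \<tau> / 2)"
  have "nahm_sum nahm_matrix (vector [of_nat 0, of_nat 0]) (-1/32) (32 * \<tau>) = qexp (of_rat (-1/32) * (32 * \<tau>)) *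
      (1 / (qpoch_inf ?s (?s^8) * qpoch_inf (?s^4) (?s^8) * qpoch_inf (?s^7) (?s^8)))"
    by (rule nahm_sum_product_whole[OF nahm_identity_2[OF norm_qexp_less_1[OF \<tau>(2)]]]) simp
  moreover have "of_rat (-1/32) * (32 * \<tau>) = - \<tau>"
    by (simp add: of_rat_divide of_rat_minus)
  ultimately show "nahm_sum nahm_matrix (vector [0, 0]) (-1/32) (32 * \<tau>) =
     inverse (2 * qexp (-3/8)) * klein_quot (torsion_list @ triple_list 1) (of_nat 256 * \<tau>)"
    using klein_quot_triple[OF \<tau>(1), of 1] by (simp add: mult_ac)
qed auto

lemma modular_nahm_5:
  "modular_function_on (Gamma1 1024) (\<lambda>\<tau>. nahm_sum nahm_matrix (vector [1, 1]) (7/32) (32 * \<tau>))"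
proof (rule modular_function_triple[where r = 3 and M = 256 and K = "inverse (2 * qexp (-3/8))"])
  fix \<tau> :: complex assume "Im \<tau> > 0"
  hence \<tau>: "Im (32 * \<tau>) > 0" "Im (32 * \<tau> / 2) > 0" by simp_all
  let ?s = "qexp (32 * \<tau> / 2)"
  have "nahm_sum nahm_matrix (vector [of_nat 1, of_nat 1]) (7/32) (32 * \<tau>) = qexp (of_rat (7/32) * (32 * \<tau>)) *
      (1 / (qpoch_inf (?s^3) (?s^8) * qpoch_inf (?s^4) (?s^8) * qpoch_inf (?s^5) (?s^8)))"
    by (rule nahm_sum_product_whole[OF nahm_identity_5[OF norm_qexp_less_1[OF \<tau>(2)]]]) simp
  moreover have "of_rat (7/32) = (7/32 :: complex)"
    by (simp add: of_rat_divide)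
  ultimately show "nahm_sum nahm_matrix (vector [1, 1]) (7/32) (32 * \<tau>) =
     inverse (2 * qexp (-3/8)) * klein_quot (torsion_list @ triple_list 3) (of_nat 256 * \<tau>)"
    using klein_quot_triple[OF \<tau>(1), of 3] by (simp add: mult_ac)
qed auto

theorem theorem3p2:
  shows "(\<forall>q::complex. norm q < 1 \<longrightarrow>
      ((\<lambda>(i::nat, j::nat). q ^ (i^2 - i + i*j + (j^2 + j) div 2) / (qpoch q q i * qpoch q q j))
         has_sum 2 * (qpoch_inf (q^4) (q^4) / qpoch_inf q q)) UNIV \<and>
      ((\<lambda>(i::nat, j::nat). q ^ (2*i^2 + 2*i*j + j^2) / (qpoch (q^2) (q^2) i * qpoch (q^2) (q^2) j))
         has_sum 1 / (qpoch_inf q (q^8) * qpoch_inf (q^4) (q^8) * qpoch_inf (q^7) (q^8))) UNIV \<and>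
      ((\<lambda>(i::nat, j::nat). q ^ (i^2 + i*j + (j^2 + j) div 2) / (qpoch q q i * qpoch q q j))
         has_sum (qpoch_inf (q^2) (q^2))^3 / ((qpoch_inf q q)^2 * qpoch_inf (q^4) (q^4))) UNIV \<and>
      ((\<lambda>(i::nat, j::nat). q ^ (i^2 + i*j + (j^2 + j) div 2 + i) / (qpoch q q i * qpoch q q j))
         has_sum qpoch_inf (q^4) (q^4) / qpoch_inf q q) UNIV \<and>
      ((\<lambda>(i::nat, j::nat). q ^ (2*i^2 + 2*i*j + j^2 + 2*i + 2*j)
                               / (qpoch (q^2) (q^2) i * qpoch (q^2) (q^2) j))
         has_sum 1 / (qpoch_inf (q^3) (q^8) * qpoch_inf (q^4) (q^8) * qpoch_inf (q^5) (q^8))) UNIV) \<and>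
    (let A = vector [vector [2, 1], vector [1, 1]] :: rat^2^2 in
      \<forall>(B, C, N) \<in> {(vector [-1, 1/2], 1/8, 256),
                    (vector [0, 0], -1/32, 1024),
                    (vector [0, 1/2], 0, 32),
                    (vector [1, 1/2], 1/8, 256),
                    (vector [1, 1], 7/32, 1024)}.
        modular_function_on (Gamma1 N) (\<lambda>\<tau>. nahm_sum A B C (of_int (denom C) * \<tau>)))"
  (is "?identities \<and> ?modular")
proof
  show ?identities
    using nahm_identity_1 nahm_identity_2 nahm_identity_3 nahm_identity_4 nahm_identity_5 by blast
  show ?modular
    unfolding Let_def
    using modular_nahm_1 modular_nahm_2 modular_nahm_3 modular_nahm_4 modular_nahm_5
    by (simp add: denom_values)
qed

end
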